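(* Let $m,n\ge 2$ and let $\mu$ be the invariant measure of a grid IFS on an $m\times n$ grid that keeps all cells with nonzero weights, i.e. of the IFS $$\left\{\tau_{ij}(x,y)=\left(\frac{x}{n}+\frac{i}{n},\frac{y}{m}+\frac{j}{m}\right):0\le i\le n-1,\ 0\le j\le m-1\right\}$$ with weights $p_{ij}>0$, $\sum_{i,j}p_{ij}=1$. Suppose $\mu$ has a singular $y$-marginal (respectively $x$-marginal) measure. Let $\beta_{\max}$ denote the maximum total weight in a row (respectively column), and let $b$ denote the number of rows (respectively columns) within which the weights are all equal. If $\beta_{\max}<\frac1b$ (or if $b=0$), then $\mu$ is $y$-slice-singular (respectively $x$-slice-singular), and hence every $f\in L^2(\mu)$ can be written as $$f(x,y)=\sum_{k=0}^{\infty}\sum_{l=0}^{\infty}d_{kl}e^{2\pi i(kx+ly)}\qquad\Big(\text{respectively } f(x,y)=\sum_{k=0}^{\infty}\sum_{l=0}^{\infty}d_{kl}e^{2\pi i(ky+lx)}\Big)$$ for some $d_{kl}\in\mathbb{C}$ depending on $f$, with conditional convergence in the norm of $L^2(\mu)$.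
   Context: Row $j$ consists of the cells with weights $p_{0j},\dots,p_{n-1,j}$, and its total weight is $\sum_{i}p_{ij}$; column $i$ consists of the cells with weights $p_{i0},\dots,p_{i,m-1}$, and its total weight is $\sum_j p_{ij}$. The invariant measure $\mu$ is the unique Borel probability measure, supported on $[0,1]^2$, with $\int f\,d\mu=\sum_{i,j}p_{ij}\int f\circ\tau_{ij}\,d\mu$ for every continuous $f$. "Singular" means singular with respect to Lebesgue measure. The marginals are $\mu_1=\mu\circ\pi_x^{-1}$ ($x$-marginal), $\mu_2=\mu\circ\pi_y^{-1}$ ($y$-marginal), with $\pi_x(x,y)=x$, $\pi_y(x,y)=y$. Rokhlin disintegrations: there are families of Borel probability measures $\{\rho_x\}$, $\{\rho^y\}$ on $[0,1]$, unique up to $\mu_1$-null, respectively $\mu_2$-null, sets, with $\int f\,d\mu=\int\int f(x,y)\,\rho_x(dy)\,\mu_1(dx)=\int\int f(x,y)\,\rho^y(dx)\,\mu_2(dy)$ for all $f\in L^1(\mu)$. The measure $\mu$ is $y$-slice-singular if $\mu_2$ is singular and $\rho^y$ is singular for $\mu_2$-a.e. $y$; it is $x$-slice-singular if $\mu_1$ is singular and $\rho_x$ is singular for $\mu_1$-a.e. $x$. Conditional convergence in norm: the double sum is an iterated sum (for each $k$ the inner sum over $l$ converges in $L^2(\mu)$, and then the outer sum over $k$ converges in $L^2(\mu)$); unconditional convergence is not claimed. *)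

theory Defs
  imports "HOL-Probability.Probability"
begin

text \<open>Throughout, measures on the unit interval (unit square) are Borel measures on the real line
  (plane) that give no mass to the complement of the interval (square).\<close>

definition lebesgue_singular :: "real measure \<Rightarrow> bool" where
  "lebesgue_singular M \<longleftrightarrow>
     (\<exists>N\<in>sets borel. emeasure lborel N = 0 \<and> emeasure M (UNIV - N) = 0)"


definition grid_map :: "nat \<Rightarrow> nat \<Rightarrow> nat \<Rightarrow> nat \<Rightarrow> real \<times> real \<Rightarrow> real \<times> real" where
  "grid_map n m i j = (\<lambda>(x, y). (x / real n + real i / real n, y / real m + real j / real m))"

definition invariant_measure ::
    "nat \<Rightarrow> nat \<Rightarrow> (nat \<Rightarrow> nat \<Rightarrow> real) \<Rightarrow> (real \<times> real) measure \<Rightarrow> bool" where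
  "invariant_measure n m p \<mu> \<longleftrightarrow>
     prob_space \<mu> \<and> sets \<mu> = sets borel \<and>
     emeasure \<mu> (UNIV - {0..1} \<times> {0..1}) = 0 \<and>
     (\<forall>f :: real \<times> real \<Rightarrow> real. continuous_on UNIV f \<longrightarrow>
        (\<integral>z. f z \<partial>\<mu>) = (\<Sum>i<n. \<Sum>j<m. p i j * (\<integral>z. f (grid_map n m i j z) \<partial>\<mu>)))"

definition row_weight :: "nat \<Rightarrow> (nat \<Rightarrow> nat \<Rightarrow> real) \<Rightarrow> nat \<Rightarrow> real" where
  "row_weight n p j = (\<Sum>i<n. p i j)"

definition column_weight :: "nat \<Rightarrow> (nat \<Rightarrow> nat \<Rightarrow> real) \<Rightarrow> nat \<Rightarrow> real" where
  "column_weight m p i = (\<Sum>j<m. p i j)"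

definition max_row_weight :: "nat \<Rightarrow> nat \<Rightarrow> (nat \<Rightarrow> nat \<Rightarrow> real) \<Rightarrow> real" where
  "max_row_weight n m p = Max (row_weight n p ` {..<m})"

definition max_column_weight :: "nat \<Rightarrow> nat \<Rightarrow> (nat \<Rightarrow> nat \<Rightarrow> real) \<Rightarrow> real" where
  "max_column_weight n m p = Max (column_weight m p ` {..<n})"

definition equal_rows :: "nat \<Rightarrow> nat \<Rightarrow> (nat \<Rightarrow> nat \<Rightarrow> real) \<Rightarrow> nat" where
  "equal_rows n m p = card {j. j < m \<and> (\<forall>i<n. \<forall>i'<n. p i j = p i' j)}"

definition equal_columns :: "nat \<Rightarrow> nat \<Rightarrow> (nat \<Rightarrow> nat \<Rightarrow> real) \<Rightarrow> nat" where
  "equal_columns n m p = card {i. i < n \<and> (\<forall>j<m. \<forall>j'<m. p i j = p i j')}"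


definition x_marginal :: "(real \<times> real) measure \<Rightarrow> real measure" where
  "x_marginal \<mu> = distr \<mu> borel fst"

definition y_marginal :: "(real \<times> real) measure \<Rightarrow> real measure" where
  "y_marginal \<mu> = distr \<mu> borel snd"

text \<open>The measurability of the kernel is stated explicitly, because the Bochner integral of a
  non-measurable function is 0 by convention.\<close>

definition unit_kernel :: "(real \<Rightarrow> real measure) \<Rightarrow> bool" where
  "unit_kernel \<rho> \<longleftrightarrow>
     \<rho> \<in> borel \<rightarrow>\<^sub>M prob_algebra borel \<and> (\<forall>t. emeasure (\<rho> t) (UNIV - {0..1}) = 0)"

definition x_disintegration :: "(real \<times> real) measure \<Rightarrow> (real \<Rightarrow> real measure) \<Rightarrow> bool" where
  "x_disintegration \<mu> \<rho> \<longleftrightarrow>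
     unit_kernel \<rho> \<and>
     (\<forall>f :: real \<times> real \<Rightarrow> real. integrable \<mu> f \<longrightarrow>
        (\<integral>z. f z \<partial>\<mu>) = (\<integral>x. (\<integral>y. f (x, y) \<partial>\<rho> x) \<partial>x_marginal \<mu>))"

definition y_disintegration :: "(real \<times> real) measure \<Rightarrow> (real \<Rightarrow> real measure) \<Rightarrow> bool" where
  "y_disintegration \<mu> \<rho> \<longleftrightarrow>
     unit_kernel \<rho> \<and>
     (\<forall>f :: real \<times> real \<Rightarrow> real. integrable \<mu> f \<longrightarrow>
        (\<integral>z. f z \<partial>\<mu>) = (\<integral>y. (\<integral>x. f (x, y) \<partial>\<rho> y) \<partial>y_marginal \<mu>))"

text \<open>Disintegrations are unique up to null sets of the marginal, so it does not matter which one
  is used; the existential form also asserts that there is one.\<close>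

definition x_slice_singular :: "(real \<times> real) measure \<Rightarrow> bool" where
  "x_slice_singular \<mu> \<longleftrightarrow>
     lebesgue_singular (x_marginal \<mu>) \<and>
     (\<exists>\<rho>. x_disintegration \<mu> \<rho> \<and> (AE x in x_marginal \<mu>. lebesgue_singular (\<rho> x)))"

definition y_slice_singular :: "(real \<times> real) measure \<Rightarrow> bool" where
  "y_slice_singular \<mu> \<longleftrightarrow>
     lebesgue_singular (y_marginal \<mu>) \<and>
     (\<exists>\<rho>. y_disintegration \<mu> \<rho> \<and> (AE y in y_marginal \<mu>. lebesgue_singular (\<rho> y)))"


definition in_L2 :: "'a measure \<Rightarrow> ('a \<Rightarrow> complex) \<Rightarrow> bool" where
  "in_L2 M f \<longleftrightarrow> f \<in> borel_measurable M \<and> integrable M (\<lambda>z. (cmod (f z))\<^sup>2)"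

definition L2_norm :: "'a measure \<Rightarrow> ('a \<Rightarrow> complex) \<Rightarrow> real" where
  "L2_norm M f = sqrt (\<integral>z. (cmod (f z))\<^sup>2 \<partial>M)"

text \<open>Membership of all terms and of the limit in \<open>L\<^sup>2\<close> is required, so that the integrals below
  are never 0 by convention.\<close>

definition L2_sums :: "'a measure \<Rightarrow> (nat \<Rightarrow> 'a \<Rightarrow> complex) \<Rightarrow> ('a \<Rightarrow> complex) \<Rightarrow> bool" where
  "L2_sums M u g \<longleftrightarrow>
     (\<forall>k. in_L2 M (u k)) \<and> in_L2 M g \<and>
     (\<lambda>N. L2_norm M (\<lambda>z. g z - (\<Sum>k<N. u k z))) \<longlonglongrightarrow> 0"

definition L2_double_sums ::
    "'a measure \<Rightarrow> (nat \<Rightarrow> nat \<Rightarrow> 'a \<Rightarrow> complex) \<Rightarrow> ('a \<Rightarrow> complex) \<Rightarrow> bool" where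
  "L2_double_sums M u f \<longleftrightarrow> (\<exists>g. (\<forall>k. L2_sums M (u k) (g k)) \<and> L2_sums M g f)"

end

theory Submission
  imports Defs
begin

text \<open>Along almost every horizontal line the first coordinate has independent base-\<open>n\<close> digits, the
  \<open>k\<close>-th one distributed as the weights of row \<open>j\<^sub>k\<close>, where \<open>j\<^sub>k\<close> are the base-\<open>m\<close> digits of \<open>y\<close>. The condition
  on the weights guarantees a row with unequal weights, so \<open>\<mu>\<close> differs from the product of Lebesgue
  measure with its \<open>y\<close>-marginal. Both are invariant measures of the same grid system with different
  weights, hence mutually singular, and Fubini makes almost every slice singular.

  For a singular probability measure on \<open>[0, 1)\<close> the Kaczmarz algorithm for \<open>e\<^sub>0, e\<^sub>1, \<dots>\<close> converges
  on all of \<open>L\<^sup>2\<close>: the vectors on which the residual tends to \<open>0\<close> form a closed subspace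
  which contains every \<open>e\<^sub>k\<close> as soon as it contains \<open>e\<^sub>-\<^sub>1\<close>, and for \<open>e\<^sub>-\<^sub>1\<close> the coefficients \<open>a\<^sub>k\<close> satisfy
  \<open>\<Sum> a\<^sub>k z\<^sup>k\<^sup>+\<^sup>1 = 1 - 1 / C(z)\<close> with the Cauchy transform \<open>C\<close> of the measure. Singularity makes this function
  inner, so \<open>\<Sum> \<bar>a\<^sub>k\<bar>\<^sup>2 = 1\<close>. Applying this on the slices and then to
  the coefficients as functions of \<open>y\<close> gives the double series.\<close>

section \<open>Exponentials and square integrable functions\<close>

text \<open>Two obstacles shape the proof. An inner function is usually handled through its boundary
  values, that is through Fatou's theorem and Hardy spaces. Here only circles of radius
  \<open>r < 1\<close> occur: if the squared coefficients summed to less than 1, the mean square of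
  their power series on all these circles would stay below a constant less than 1, whereas the
  Poisson integral of a singular measure, cut off at 1, has arbitrarily small mean on a suitable
  circle. No boundary function is ever formed. The other obstacle is measurability in
  \<open>y\<close> of whatever is computed on the slices. The slice over \<open>y\<close> is the
  image of the uniform law under a quantile function \<open>Q y\<close> that is jointly measurable,
  so integrals over slices become integrals over a product with one fixed measure. The bound on the
  weights is used by contradiction: if the weights were equal within each of the \<open>m\<close>
  rows, then \<open>b = m\<close>, and \<open>m\<close> rows of total weight 1 cannot all weigh less
  than \<open>1 / m\<close>.\<close>

definition wave :: "int \<Rightarrow> real \<Rightarrow> complex" where
  "wave k x = cis (2 * pi * of_int k * x)"

lemma wave_0 [simp]: "wave 0 x = 1"
  and norm_wave [simp]: "cmod (wave k x) = 1"
  and cnj_wave: "cnj (wave k x) = wave (- k) x"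
  by (simp_all add: wave_def cis_cnj)

lemma wave_add: "wave (j + k) x = wave j x * wave k x"
  by (simp add: wave_def cis_mult algebra_simps)

lemma wave_add_arg: "wave k (x + y) = wave k x * wave k y"
  by (simp add: wave_def cis_mult algebra_simps)

lemma wave_uminus_arg: "wave k (- x) = wave (- k) x"
  by (simp add: wave_def)

lemma wave_int_eq_power: "wave (int k) x = wave 1 x ^ k"
  by (induction k) (simp_all add: wave_add)

lemma wave_neg_eq_power: "wave (- int k) x = wave (- 1) x ^ k"
  using wave_int_eq_power[of k "- x"] by (simp add: wave_uminus_arg)

lemma continuous_wave [continuous_intros]: "continuous_on A (wave k)"
  unfolding wave_def[abs_def] by (intro continuous_intros)

lemma measurable_wave [measurable]: "wave k \<in> borel_measurable borel"
  by (intro borel_measurable_continuous_onI continuous_intros)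

lemma wave_eq_exp: "wave (int k) x = exp (2 * of_real pi * \<i> * of_real (real k * x))"
  by (simp add: wave_def cis_conv_exp algebra_simps)

text \<open>Squares rather than norms, because a Kaczmarz step subtracts a squared coefficient from
  the squared norm. The price is the factor 2 of \<open>sq_norm_add_le\<close> in place of the
  triangle inequality.\<close>

definition sq_norm :: "'a measure \<Rightarrow> ('a \<Rightarrow> complex) \<Rightarrow> real" where
  "sq_norm M f = (\<integral>z. (cmod (f z))\<^sup>2 \<partial>M)"

lemma sq_norm_nonneg [simp]: "sq_norm M f \<ge> 0"
  by (simp add: sq_norm_def)

lemma L2_norm_tendsto_0_iff:
  "((\<lambda>N. L2_norm M (u N)) \<longlonglongrightarrow> 0) \<longleftrightarrow> ((\<lambda>N. sq_norm M (u N)) \<longlonglongrightarrow> 0)"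
proof
  assume "(\<lambda>N. L2_norm M (u N)) \<longlonglongrightarrow> 0"
  then have "(\<lambda>N. (L2_norm M (u N))\<^sup>2) \<longlonglongrightarrow> 0\<^sup>2"
    by (intro tendsto_intros)
  then show "(\<lambda>N. sq_norm M (u N)) \<longlonglongrightarrow> 0"
    by (simp add: L2_norm_def sq_norm_def)
next
  assume "(\<lambda>N. sq_norm M (u N)) \<longlonglongrightarrow> 0"
  then have "(\<lambda>N. sqrt (sq_norm M (u N))) \<longlonglongrightarrow> sqrt 0"
    by (intro tendsto_intros)
  then show "(\<lambda>N. L2_norm M (u N)) \<longlonglongrightarrow> 0"
    by (simp add: L2_norm_def sq_norm_def)
qed

lemma cmod_add_sq_le: "(cmod (a + b))\<^sup>2 \<le> 2 * (cmod a)\<^sup>2 + 2 * (cmod b)\<^sup>2"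
proof -
  have "(cmod (a + b))\<^sup>2 \<le> (cmod a + cmod b)\<^sup>2"
    by (intro power_mono norm_triangle_ineq) simp
  also have "\<dots> \<le> 2 * (cmod a)\<^sup>2 + 2 * (cmod b)\<^sup>2"
    using sum_squares_bound[of "cmod a" "cmod b"] by (simp add: power2_sum)
  finally show ?thesis .
qed

lemma in_L2_add:
  assumes "in_L2 M f" "in_L2 M g"
  shows "in_L2 M (\<lambda>x. f x + g x)"
  unfolding in_L2_def
proof
  have [measurable]: "f \<in> borel_measurable M" "g \<in> borel_measurable M"
    using assms by (auto simp: in_L2_def)
  show "(\<lambda>x. f x + g x) \<in> borel_measurable M" by measurable
  have "integrable M (\<lambda>z. 2 * (cmod (f z))\<^sup>2 + 2 * (cmod (g z))\<^sup>2)"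
    using assms by (auto simp: in_L2_def)
  then show "integrable M (\<lambda>z. (cmod (f z + g z))\<^sup>2)"
    by (rule Bochner_Integration.integrable_bound) (auto simp: cmod_add_sq_le)
qed

lemma in_L2_mult_bounded:
  assumes "in_L2 M f" and [measurable]: "\<phi> \<in> borel_measurable M"
    and "AE x in M. cmod (\<phi> x) \<le> B"
  shows "in_L2 M (\<lambda>x. \<phi> x * f x)"
  unfolding in_L2_def
proof
  have [measurable]: "f \<in> borel_measurable M"
    using assms by (auto simp: in_L2_def)
  show "(\<lambda>x. \<phi> x * f x) \<in> borel_measurable M" by measurable
  have "integrable M (\<lambda>z. B\<^sup>2 * (cmod (f z))\<^sup>2)"
    using assms by (auto simp: in_L2_def)
  then show "integrable M (\<lambda>z. (cmod (\<phi> z * f z))\<^sup>2)"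
  proof (rule Bochner_Integration.integrable_bound)
    show "AE x in M. norm ((cmod (\<phi> x * f x))\<^sup>2) \<le> norm (B\<^sup>2 * (cmod (f x))\<^sup>2)"
      using assms(3)
    proof eventually_elim
      case (elim x)
      then show ?case
        by (auto simp: norm_mult power_mult_distrib intro!: mult_right_mono power_mono)
    qed
  qed simp
qed

lemma in_L2_cmult: "in_L2 M f \<Longrightarrow> in_L2 M (\<lambda>x. c * f x)"
  using in_L2_mult_bounded[of M f "\<lambda>_. c" "cmod c"] by simp

lemma in_L2_uminus: "in_L2 M f \<Longrightarrow> in_L2 M (\<lambda>x. - f x)"
  using in_L2_cmult[of M f "-1"] by simp

lemma in_L2_diff: "in_L2 M f \<Longrightarrow> in_L2 M g \<Longrightarrow> in_L2 M (\<lambda>x. f x - g x)"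
  using in_L2_add[OF _ in_L2_uminus, of M f g] by simp

lemma sq_norm_add_le:
  assumes "in_L2 M f" "in_L2 M g"
  shows "sq_norm M (\<lambda>x. f x + g x) \<le> 2 * sq_norm M f + 2 * sq_norm M g"
proof -
  have "sq_norm M (\<lambda>x. f x + g x) \<le> (\<integral>z. 2 * (cmod (f z))\<^sup>2 + 2 * (cmod (g z))\<^sup>2 \<partial>M)"
    unfolding sq_norm_def using assms in_L2_add[OF assms]
    by (intro integral_mono) (auto simp: in_L2_def cmod_add_sq_le)
  also have "\<dots> = 2 * sq_norm M f + 2 * sq_norm M g"
    using assms by (simp add: in_L2_def sq_norm_def)
  finally show ?thesis .
qed

lemma (in finite_measure) integrable_L2:
  assumes "in_L2 M f"
  shows "integrable M f"
proof (rule Bochner_Integration.integrable_bound)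
  show "integrable M (\<lambda>z. 1 + (cmod (f z))\<^sup>2)"
    using assms by (auto simp: in_L2_def)
  show "f \<in> borel_measurable M" using assms by (auto simp: in_L2_def)
  have "t \<le> 1 + t\<^sup>2" for t :: real
    using zero_le_power2[of "t - 1/2"] by (simp add: power2_eq_square algebra_simps)
  then show "AE x in M. norm (f x) \<le> norm (1 + (cmod (f x))\<^sup>2)"
    by simp
qed

lemma (in finite_measure) in_L2_bounded:
  assumes "\<phi> \<in> borel_measurable M" "AE x in M. cmod (\<phi> x) \<le> B"
  shows "in_L2 M \<phi>"
  using in_L2_mult_bounded[of M "\<lambda>_. 1" \<phi> B] assms by (simp add: in_L2_def)

lemma (in finite_measure) in_L2_const: "in_L2 M (\<lambda>_. c)"
  by (rule in_L2_bounded[of _ "cmod c"]) auto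

lemma sq_norm_dominated:
  assumes "in_L2 M h" and [measurable]: "\<And>j. u j \<in> borel_measurable M"
    and "\<And>j. AE x in M. cmod (u j x) \<le> cmod (h x)"
    and "AE x in M. (\<lambda>j. u j x) \<longlonglongrightarrow> 0"
  shows "(\<lambda>j. sq_norm M (u j)) \<longlonglongrightarrow> 0"
proof -
  have "(\<lambda>j. \<integral>x. (cmod (u j x))\<^sup>2 \<partial>M) \<longlonglongrightarrow> (\<integral>x. 0 \<partial>M)"
  proof (rule integral_dominated_convergence)
    show "integrable M (\<lambda>x. (cmod (h x))\<^sup>2)"
      using assms(1) by (simp add: in_L2_def)
    show "AE x in M. (\<lambda>j. (cmod (u j x))\<^sup>2) \<longlonglongrightarrow> 0"
      using assms(4)
    proof eventually_elim
      case (elim x)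
      then have "(\<lambda>j. (cmod (u j x))\<^sup>2) \<longlonglongrightarrow> (cmod 0)\<^sup>2"
        by (intro tendsto_intros)
      then show ?case by simp
    qed
    show "AE x in M. norm ((cmod (u j x))\<^sup>2) \<le> (cmod (h x))\<^sup>2" for j
      using assms(3)[of j] by eventually_elim (simp add: power_mono)
  qed measurable
  then show ?thesis by (simp add: sq_norm_def)
qed

text \<open>\<open>e\<^sub>N \<cdot> (twist M ^^ N) f\<close> is the residual of \<open>f\<close> after \<open>N\<close> steps of the Kaczmarz algorithm
  for the sequence \<open>e\<^sub>0, e\<^sub>1, \<dots>\<close> of exponentials in \<open>L\<^sup>2(M)\<close>; the rotation by \<open>e\<^sub>N\<close> turns the
  non-autonomous algorithm into the iteration of a single operator.\<close>

definition twist :: "real measure \<Rightarrow> (real \<Rightarrow> complex) \<Rightarrow> real \<Rightarrow> complex" where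
  "twist M f x = wave (- 1) x * (f x - (\<integral>t. f t \<partial>M))"

text \<open>In the inner product of the residual after \<open>k\<close> steps with
  \<open>wave k\<close>, the exponential cancels against its conjugate, and a plain mean
  remains.\<close>

definition kaczmarz_coeff :: "real measure \<Rightarrow> (real \<Rightarrow> complex) \<Rightarrow> nat \<Rightarrow> complex" where
  "kaczmarz_coeff M f k = (\<integral>t. (twist M ^^ k) f t \<partial>M)"

lemma kaczmarz_expansion:
  "f x - (\<Sum>k<N. kaczmarz_coeff M f k * wave (int k) x) = wave (int N) x * (twist M ^^ N) f x"
proof (induction N)
  case (Suc N)
  have "wave (int (Suc N)) x * (twist M ^^ Suc N) f x
      = (wave (int (Suc N)) x * wave (- 1) x) * ((twist M ^^ N) f x - kaczmarz_coeff M f N)"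
    by (simp add: twist_def kaczmarz_coeff_def algebra_simps)
  also have "wave (int (Suc N)) x * wave (- 1) x = wave (int N) x"
    by (simp flip: wave_add)
  finally show ?case using Suc by (simp add: algebra_simps)
qed simp

context real_distribution
begin

lemma in_L2_wave_mult: "in_L2 M f \<Longrightarrow> in_L2 M (\<lambda>x. wave k x * f x)"
  by (rule in_L2_mult_bounded[where B = 1]) auto

lemma in_L2_wave: "in_L2 M (wave k)"
  using in_L2_wave_mult[OF in_L2_const[of 1], of k] by simp

lemma in_L2_twist: "in_L2 M f \<Longrightarrow> in_L2 M (twist M f)"
  unfolding twist_def[abs_def] by (intro in_L2_wave_mult in_L2_diff in_L2_const)

lemma in_L2_twist_iter: "in_L2 M f \<Longrightarrow> in_L2 M ((twist M ^^ k) f)"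
  by (induction k) (auto intro: in_L2_twist)

text \<open>Pythagoras: subtracting the mean projects onto the orthogonal complement of the
  constants, and the unimodular factor keeps the norm.\<close>

lemma sq_norm_twist:
  assumes "in_L2 M f"
  shows "sq_norm M (twist M f) = sq_norm M f - (cmod (\<integral>t. f t \<partial>M))\<^sup>2"
proof -
  define c where "c = (\<integral>t. f t \<partial>M)"
  note int = integrable_L2[OF assms]
  have eq: "(cmod (a - c))\<^sup>2 = (cmod a)\<^sup>2 - 2 * Re (cnj c * a) + (cmod c)\<^sup>2" for a
    unfolding cmod_power2 by (simp add: power2_eq_square algebra_simps)
  have "sq_norm M (twist M f) = (\<integral>x. (cmod (f x))\<^sup>2 - 2 * Re (cnj c * f x) + (cmod c)\<^sup>2 \<partial>M)"
    unfolding sq_norm_def twist_def c_def[symmetric] norm_mult norm_wave mult_1 eq ..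
  also have "\<dots> = sq_norm M f - 2 * Re (cnj c * c) + (cmod c)\<^sup>2"
    using int assms prob_space by (simp add: in_L2_def sq_norm_def c_def)
  also have "Re (cnj c * c) = (cmod c)\<^sup>2"
    unfolding cmod_power2 by (simp add: power2_eq_square)
  finally show ?thesis by (simp add: c_def)
qed

text \<open>Telescoped Pythagoras. The residual tends to 0 exactly when the squared coefficients add
  up to the full squared norm, and \<open>effective_wave_minus_1\<close> is proved in that
  form.\<close>

lemma sq_norm_twist_iter:
  assumes "in_L2 M f"
  shows "sq_norm M ((twist M ^^ N) f) = sq_norm M f - (\<Sum>k<N. (cmod (kaczmarz_coeff M f k))\<^sup>2)"
  by (induction N)
    (simp_all add: sq_norm_twist[OF in_L2_twist_iter[OF assms]] kaczmarz_coeff_def)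

lemma sq_norm_twist_iter_le:
  assumes "in_L2 M f"
  shows "sq_norm M ((twist M ^^ N) f) \<le> sq_norm M f"
  using sq_norm_twist_iter[OF assms, of N] sum_nonneg[of "{..<N}" "\<lambda>k. (cmod (kaczmarz_coeff M f k))\<^sup>2"]
  by simp

lemma kaczmarz_coeff_bound:
  assumes "in_L2 M f"
  shows "(cmod (kaczmarz_coeff M f k))\<^sup>2 \<le> sq_norm M f"
proof -
  have "(cmod (kaczmarz_coeff M f k))\<^sup>2 \<le> (\<Sum>j<Suc k. (cmod (kaczmarz_coeff M f j))\<^sup>2)"
    by (intro member_le_sum) auto
  also have "\<dots> \<le> sq_norm M f"
    using sq_norm_twist_iter[OF assms, of "Suc k"] sq_norm_nonneg[of M "(twist M ^^ Suc k) f"] by linarith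
  finally show ?thesis .
qed

lemma twist_iter_add:
  assumes "in_L2 M f" "in_L2 M g"
  shows "(twist M ^^ k) (\<lambda>x. f x + g x) = (\<lambda>x. (twist M ^^ k) f x + (twist M ^^ k) g x)"
proof (induction k)
  case (Suc k)
  then show ?case
    using integrable_L2[OF in_L2_twist_iter[OF assms(1), of k]]
      integrable_L2[OF in_L2_twist_iter[OF assms(2), of k]]
    by (simp add: twist_def[abs_def] algebra_simps)
qed simp

lemma twist_iter_cmult: "(twist M ^^ k) (\<lambda>x. c * f x) = (\<lambda>x. c * (twist M ^^ k) f x)"
  by (induction k) (simp_all add: twist_def[abs_def] algebra_simps)

text \<open>The vectors that the algorithm recovers. They are shown to be stable under
  multiplication by ever larger classes of functions: \<open>wave 1\<close> and
  \<open>wave (- 1)\<close>, polynomials in a cosine, continuous functions of a cosine, indicators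
  of arcs, indicators of Borel sets.\<close>

definition effective :: "(real \<Rightarrow> complex) \<Rightarrow> bool" where
  "effective f \<longleftrightarrow> in_L2 M f \<and> (\<lambda>N. sq_norm M ((twist M ^^ N) f)) \<longlonglongrightarrow> 0"

lemma effective_add:
  assumes "effective f" "effective g"
  shows "effective (\<lambda>x. f x + g x)"
  unfolding effective_def
proof
  have L: "in_L2 M f" "in_L2 M g" using assms by (auto simp: effective_def)
  then show "in_L2 M (\<lambda>x. f x + g x)" by (rule in_L2_add)
  show "(\<lambda>N. sq_norm M ((twist M ^^ N) (\<lambda>x. f x + g x))) \<longlonglongrightarrow> 0"
  proof (rule tendsto_sandwich[of "\<lambda>_. 0"])
    show "\<forall>\<^sub>F N in sequentially. sq_norm M ((twist M ^^ N) (\<lambda>x. f x + g x))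
        \<le> 2 * sq_norm M ((twist M ^^ N) f) + 2 * sq_norm M ((twist M ^^ N) g)"
      using sq_norm_add_le[OF in_L2_twist_iter[OF L(1)] in_L2_twist_iter[OF L(2)]]
      by (intro always_eventually allI) (simp add: twist_iter_add[OF L])
    have "(\<lambda>N. 2 * sq_norm M ((twist M ^^ N) f) + 2 * sq_norm M ((twist M ^^ N) g))
        \<longlonglongrightarrow> 2 * 0 + 2 * 0"
      using assms by (intro tendsto_intros) (auto simp: effective_def)
    then show "(\<lambda>N. 2 * sq_norm M ((twist M ^^ N) f) + 2 * sq_norm M ((twist M ^^ N) g)) \<longlonglongrightarrow> 0"
      by simp
  qed auto
qed

lemma effective_cmult:
  assumes "effective f"
  shows "effective (\<lambda>x. c * f x)"
proof -
  have "(\<lambda>N. (cmod c)\<^sup>2 * sq_norm M ((twist M ^^ N) f)) \<longlonglongrightarrow> (cmod c)\<^sup>2 * 0"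
    using assms by (intro tendsto_intros) (auto simp: effective_def)
  moreover have "sq_norm M ((twist M ^^ N) (\<lambda>x. c * f x))
      = (cmod c)\<^sup>2 * sq_norm M ((twist M ^^ N) f)" for N
    by (simp add: twist_iter_cmult sq_norm_def norm_mult power_mult_distrib)
  ultimately show ?thesis
    using assms by (simp add: effective_def in_L2_cmult)
qed

lemma effective_diff:
  assumes "effective f" "effective g"
  shows "effective (\<lambda>x. f x - g x)"
  using effective_add[OF assms(1) effective_cmult[OF assms(2), of "-1"]] by simp

text \<open>The iterates of \<open>twist\<close> never increase the norm, so one good approximation
  \<open>u j\<close> controls the residual of \<open>f - u j\<close> at all steps at once.\<close>

lemma effective_limit:
  assumes "\<And>j. effective (u j)" "in_L2 M f"
    and "(\<lambda>j. sq_norm M (\<lambda>x. f x - u j x)) \<longlonglongrightarrow> 0"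
  shows "effective f"
  unfolding effective_def
proof
  show "in_L2 M f" by fact
  show "(\<lambda>N. sq_norm M ((twist M ^^ N) f)) \<longlonglongrightarrow> 0"
  proof (rule LIMSEQ_I)
    fix r :: real assume "0 < r"
    \<comment> \<open>The bound \<open>r / 4\<close> is used for both summands and absorbs the
      factor 2 of \<open>sq_norm_add_le\<close>.\<close>
    then obtain j where j: "sq_norm M (\<lambda>x. f x - u j x) < r / 4"
      using LIMSEQ_D[OF assms(3), of "r / 4"] by auto
    have L: "in_L2 M (u j)" and lim: "(\<lambda>N. sq_norm M ((twist M ^^ N) (u j))) \<longlonglongrightarrow> 0"
      using assms(1) by (auto simp: effective_def)
    note L' = in_L2_diff[OF assms(2) L]
    obtain N0 where N0: "\<And>N. N \<ge> N0 \<Longrightarrow> sq_norm M ((twist M ^^ N) (u j)) < r / 4"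
      using LIMSEQ_D[OF lim, of "r / 4"] \<open>0 < r\<close> by auto
    have "sq_norm M ((twist M ^^ N) f) < r" if "N \<ge> N0" for N
    proof -
      have "(twist M ^^ N) f = (\<lambda>x. (twist M ^^ N) (u j) x + (twist M ^^ N) (\<lambda>x. f x - u j x) x)"
        using twist_iter_add[OF L L', of N] by simp
      then have "sq_norm M ((twist M ^^ N) f) \<le> 2 * sq_norm M ((twist M ^^ N) (u j))
          + 2 * sq_norm M ((twist M ^^ N) (\<lambda>x. f x - u j x))"
        using sq_norm_add_le[OF in_L2_twist_iter[OF L] in_L2_twist_iter[OF L'], of N N] by simp
      then show ?thesis
        using N0[OF that] sq_norm_twist_iter_le[OF L', of N] j by linarith
    qed
    then show "\<exists>no. \<forall>n\<ge>no. norm (sq_norm M ((twist M ^^ n) f) - 0) < r"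
      by auto
  qed
qed

text \<open>Each passage to a larger class of multipliers is a bounded pointwise limit of this kind;
  \<open>2 * B\<close> times \<open>f\<close> is the majorant.\<close>

lemma effective_limit_mult:
  assumes "\<And>j. effective (\<lambda>x. \<phi> j x * f x)" and L: "in_L2 M f"
    and [measurable]: "\<phi>' \<in> borel_measurable borel" "\<And>j. \<phi> j \<in> borel_measurable borel"
    and bd: "\<And>j x. cmod (\<phi> j x) \<le> B" and lim: "AE x in M. (\<lambda>j. \<phi> j x) \<longlonglongrightarrow> \<phi>' x"
  shows "effective (\<lambda>x. \<phi>' x * f x)"
proof (rule effective_limit[OF assms(1)])
  have [measurable]: "f \<in> borel_measurable M" using L by (simp add: in_L2_def)
  have bd': "AE x in M. cmod (\<phi>' x) \<le> B"
    using lim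
  proof eventually_elim
    case (elim x)
    then show ?case
      using tendsto_norm[OF elim] bd by (rule_tac LIMSEQ_le_const2) auto
  qed
  show "in_L2 M (\<lambda>x. \<phi>' x * f x)"
    by (rule in_L2_mult_bounded[OF L _ bd']) simp
  show "(\<lambda>j. sq_norm M (\<lambda>x. \<phi>' x * f x - \<phi> j x * f x)) \<longlonglongrightarrow> 0"
  proof (rule sq_norm_dominated[OF in_L2_cmult[OF L, of "of_real (2 * B)"]])
    show "AE x in M. cmod (\<phi>' x * f x - \<phi> j x * f x) \<le> cmod (of_real (2 * B) * f x)" for j
      using bd'
    proof eventually_elim
      case (elim x)
      have "cmod (\<phi>' x - \<phi> j x) \<le> 2 * B"
        using norm_triangle_ineq4[of "\<phi>' x" "\<phi> j x"] elim bd[of j x] by linarith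
      moreover have "B \<ge> 0" using norm_ge_zero[of "\<phi>' x"] elim by linarith
      ultimately show ?case
        by (simp add: norm_mult mult_right_mono flip: left_diff_distrib)
    qed
    show "AE x in M. (\<lambda>j. \<phi>' x * f x - \<phi> j x * f x) \<longlonglongrightarrow> 0"
      using lim
    proof eventually_elim
      case (elim x)
      have "(\<lambda>j. \<phi>' x * f x - \<phi> j x * f x) \<longlonglongrightarrow> \<phi>' x * f x - \<phi>' x * f x"
        by (intro tendsto_intros elim)
      then show ?case by simp
    qed
  qed measurable
qed

text \<open>The vectors are functions and not classes, so a change on a null set has to be
  justified; the iterates of a function of norm 0 keep norm 0.\<close>

lemma effective_null:
  assumes "AE x in M. f x = 0" "f \<in> borel_measurable borel"
  shows "effective f"
proof -
  have [measurable]: "f \<in> borel_measurable M" using assms by simp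
  have "AE x in M. (cmod (f x))\<^sup>2 = 0" using assms(1) by eventually_elim simp
  then have "integrable M (\<lambda>x. (cmod (f x))\<^sup>2)" and 0: "sq_norm M f = 0"
    using integrable_cong_AE[of "\<lambda>x. (cmod (f x))\<^sup>2" M "\<lambda>_. 0"]
     integral_cong_AE[of "\<lambda>x. (cmod (f x))\<^sup>2" M "\<lambda>_. 0"] by (simp_all add: sq_norm_def)
  then have L: "in_L2 M f" by (simp add: in_L2_def)
  have "sq_norm M ((twist M ^^ N) f) = 0" for N
    using sq_norm_twist_iter_le[OF L, of N] sq_norm_nonneg[of M "(twist M ^^ N) f"] 0 by linarith
  then show ?thesis by (simp add: effective_def L)
qed

lemma effective_twist_iff:
  "in_L2 M f \<Longrightarrow> effective (twist M f) \<longleftrightarrow> effective f"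
  unfolding effective_def
  using filterlim_sequentially_Suc[of "\<lambda>N. sq_norm M ((twist M ^^ N) f)"]
  by (simp add: in_L2_twist funpow_Suc_right del: funpow.simps)

text \<open>Up to a multiple of \<open>wave (- 1)\<close>, the twist of \<open>f\<close> is
  \<open>wave (- 1)\<close> times \<open>f\<close>; this gives the first claim. The twist of
  \<open>wave 1\<close> times \<open>f\<close> is \<open>f\<close> minus a multiple of
  \<open>wave (- 1)\<close>, hence effective, and twisting merely shifts the sequence of residuals
  by one; this gives the second.\<close>

lemma effective_wave_mult:
  assumes "effective (wave (- 1))"
  shows "effective f \<Longrightarrow> effective (\<lambda>x. wave (- 1) x * f x)"
    and "effective f \<Longrightarrow> effective (\<lambda>x. wave 1 x * f x)"
proof -
  assume f: "effective f"
  then have L: "in_L2 M f" by (simp add: effective_def)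
  have "effective (\<lambda>x. twist M f x + (\<integral>t. f t \<partial>M) * wave (- 1) x)"
    by (intro effective_add effective_cmult assms) (simp add: effective_twist_iff L f)
  then show "effective (\<lambda>x. wave (- 1) x * f x)"
    by (simp add: twist_def algebra_simps)
  let ?g = "\<lambda>x. wave 1 x * f x"
  have "effective (\<lambda>x. f x - (\<integral>t. ?g t \<partial>M) * wave (- 1) x)"
    by (intro effective_diff effective_cmult assms f)
  moreover have "wave (- 1) x * wave 1 x = 1" for x by (simp flip: wave_add)
  then have "wave (- 1) x * (wave 1 x * c) = c" for x c by (metis mult.assoc mult_1)
  then have "(\<lambda>x. f x - (\<integral>t. ?g t \<partial>M) * wave (- 1) x) = twist M ?g"
    unfolding twist_def[abs_def] right_diff_distrib by (auto simp only: mult.commute[of _ "wave (- 1) _"])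
  ultimately show "effective ?g"
    using effective_twist_iff[OF in_L2_wave_mult[OF L, of 1]] by simp
qed

end

section \<open>The Cauchy transform and its inner function\<close>

text \<open>Half-open, so that it runs through the circle once: \<open>wave 1\<close> is injective
  on the interval, and its \<open>n\<close> equal parts do not overlap.\<close>

definition unit_lebesgue :: "real measure" where
  "unit_lebesgue = density lborel (\<lambda>x. ennreal (indicator {0..<1} x))"

lemma sets_unit_lebesgue [simp, measurable_cong]: "sets unit_lebesgue = sets borel"
  by (simp add: unit_lebesgue_def)

lemma nn_integral_unit_lebesgue:
  "f \<in> borel_measurable borel \<Longrightarrow>
    (\<integral>\<^sup>+x. f x \<partial>unit_lebesgue) = (\<integral>\<^sup>+x. indicator {0..<1} x * f x \<partial>lborel)"
  unfolding unit_lebesgue_def by (subst nn_integral_density) (auto simp: ennreal_indicator)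

lemma AE_unit_lebesgue: "(AE x in unit_lebesgue. P x) \<longleftrightarrow> (AE x in lborel. 0 \<le> x \<and> x < 1 \<longrightarrow> P x)"
  unfolding unit_lebesgue_def by (subst AE_density) (auto simp: indicator_def intro!: AE_cong)

lemma real_distribution_unit_lebesgue: "real_distribution unit_lebesgue"
proof -
  have "emeasure unit_lebesgue (space unit_lebesgue) = (\<integral>\<^sup>+x. 1 \<partial>unit_lebesgue)"
    by simp
  also have "\<dots> = 1"
    by (subst nn_integral_unit_lebesgue) auto
  finally show ?thesis
    by (intro real_distribution.intro prob_spaceI real_distribution_axioms.intro) auto
qed

interpretation U: real_distribution unit_lebesgue
  by (rule real_distribution_unit_lebesgue)

section \<open>Orthogonality of the exponentials and Bessel's inequality on circles\<close>

lemma integral_wave_unit_lebesgue: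
  "(\<integral>x. wave k x \<partial>unit_lebesgue) = (if k = 0 then 1 else 0)"
proof (cases "k = 0")
  case True
  then show ?thesis using U.prob_space by simp
next
  case False
  have "(\<integral>x. wave k x \<partial>unit_lebesgue) = (\<integral>x. indicator {0..<1} x *\<^sub>R wave k x \<partial>lborel)"
    unfolding unit_lebesgue_def by (subst integral_density) auto
  also have "\<dots> = (\<integral>x. indicator {0..1} x *\<^sub>R wave k x \<partial>lborel)"
  proof (rule integral_cong_AE)
    show "AE x in lborel. indicator {0..<1} x *\<^sub>R wave k x = indicator {0..1} x *\<^sub>R wave k x"
      using AE_lborel_singleton[of "1::real"] by eventually_elim (auto simp: indicator_def)
  qed auto
  also have "\<dots> = wave k 1 / (2 * pi * k * \<i>) - wave k 0 / (2 * pi * k * \<i>)"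
  proof (rule integral_FTC_Icc)
    fix x :: real
    show "((\<lambda>x. wave k x / (2 * pi * k * \<i>)) has_vector_derivative wave k x) (at x within {0..1})"
      unfolding wave_def cis_conv_exp using False
      by (auto intro!: derivative_eq_intros has_vector_derivative_real_field simp: scaleR_conv_of_real)
  qed (auto intro: continuous_intros)
  also have "wave k 1 = wave k 0"
    using cis_multiple_2pi[of "of_int k"] by (simp add: wave_def mult.commute mult.left_commute)
  finally show ?thesis using False by simp
qed

lemma parseval_finite:
  "(\<integral>\<theta>. (cmod (\<Sum>k<N. b k * wave (int k) \<theta>))\<^sup>2 \<partial>unit_lebesgue) = (\<Sum>k<N. (cmod (b k))\<^sup>2)"
proof -
  let ?S = "\<lambda>\<theta>. \<Sum>k<N. b k * wave (int k) \<theta>"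
  have int: "integrable unit_lebesgue (\<lambda>\<theta>. c * wave k \<theta>)" for c k
    using U.integrable_L2[OF in_L2_cmult[OF U.in_L2_wave]] .
  have "complex_of_real (\<integral>\<theta>. (cmod (?S \<theta>))\<^sup>2 \<partial>unit_lebesgue)
      = (\<integral>\<theta>. of_real ((cmod (?S \<theta>))\<^sup>2) \<partial>unit_lebesgue)"
    by (rule integral_complex_of_real[symmetric])
  also have "\<dots> = (\<integral>\<theta>. (\<Sum>j<N. \<Sum>k<N. (b j * cnj (b k)) * wave (int j - int k) \<theta>) \<partial>unit_lebesgue)"
  proof (rule Bochner_Integration.integral_cong[OF refl])
    fix \<theta>
    have "wave (int j) \<theta> * cnj (wave (int k) \<theta>) = wave (int j - int k) \<theta>" for j k
      using wave_add[of "int j" "- int k" \<theta>] by (simp add: cnj_wave)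
    then have "(b j * wave (int j) \<theta>) * cnj (b k * wave (int k) \<theta>)
        = (b j * cnj (b k)) * wave (int j - int k) \<theta>" for j k
      by (metis complex_cnj_mult mult.assoc mult.left_commute)
    then show "complex_of_real ((cmod (?S \<theta>))\<^sup>2)
        = (\<Sum>j<N. \<Sum>k<N. (b j * cnj (b k)) * wave (int j - int k) \<theta>)"
      by (simp only: complex_norm_square cnj_sum sum_product)
  qed
  also have "\<dots> = (\<Sum>j<N. \<Sum>k<N. (b j * cnj (b k)) * (if int j - int k = 0 then 1 else 0))"
    by (simp only: Bochner_Integration.integral_sum int Bochner_Integration.integrable_sum
        integral_mult_right_zero integral_wave_unit_lebesgue)
  also have "\<dots> = (\<Sum>j<N. b j * cnj (b j))"
    by (intro sum.cong refl) (simp add: if_distrib cong: if_cong)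
  also have "\<dots> = complex_of_real (\<Sum>k<N. (cmod (b k))\<^sup>2)"
    by (simp only: of_real_sum complex_norm_square)
  finally show ?thesis by (simp only: of_real_eq_iff)
qed

text \<open>Parseval holds for the partial sums and passes to the limit under the geometric
  majorant; the powers of \<open>r\<close> only shrink the coefficients.\<close>

lemma bessel_power_series:
  assumes a: "\<And>k. cmod (a k) \<le> 1" and s: "\<And>N. (\<Sum>k<N. (cmod (a k))\<^sup>2) \<le> s" and r: "0 \<le> r" "r < 1"
  shows "(\<integral>\<theta>. (cmod (\<Sum>k. a k * (of_real r * wave 1 \<theta>) ^ k))\<^sup>2 \<partial>unit_lebesgue) \<le> s"
proof -
  let ?t = "\<lambda>\<theta> k. a k * (of_real r * wave 1 \<theta>) ^ k"
  have nt: "cmod (?t \<theta> k) \<le> r ^ k" for \<theta> k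
    using mult_right_mono[OF a, of "r ^ k" k] r by (simp add: norm_mult norm_power)
  have geo: "summable (\<lambda>k. r ^ k)" using r by (simp add: summable_geometric)
  have sm: "summable (?t \<theta>)" for \<theta>
    by (rule summable_comparison_test'[OF geo]) (use nt in auto)
  have bd: "cmod (\<Sum>k<N. ?t \<theta> k) \<le> (\<Sum>k. r ^ k)" for \<theta> N
  proof -
    have "cmod (\<Sum>k<N. ?t \<theta> k) \<le> (\<Sum>k<N. r ^ k)" by (rule order_trans[OF norm_sum sum_mono[OF nt]])
    also have "\<dots> \<le> (\<Sum>k. r ^ k)" using geo r by (intro sum_le_suminf) auto
    finally show ?thesis .
  qed
  have "(\<lambda>N. \<integral>\<theta>. (cmod (\<Sum>k<N. ?t \<theta> k))\<^sup>2 \<partial>unit_lebesgue)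
      \<longlonglongrightarrow> (\<integral>\<theta>. (cmod (\<Sum>k. ?t \<theta> k))\<^sup>2 \<partial>unit_lebesgue)"
  proof (rule integral_dominated_convergence[where w = "\<lambda>_. (\<Sum>k. r ^ k)\<^sup>2"])
    show "AE \<theta> in unit_lebesgue. (\<lambda>N. (cmod (\<Sum>k<N. ?t \<theta> k))\<^sup>2) \<longlonglongrightarrow> (cmod (\<Sum>k. ?t \<theta> k))\<^sup>2"
      by (intro always_eventually allI tendsto_intros summable_LIMSEQ sm)
    show "AE \<theta> in unit_lebesgue. norm ((cmod (\<Sum>k<N. ?t \<theta> k))\<^sup>2) \<le> (\<Sum>k. r ^ k)\<^sup>2" for N
      using bd by (auto intro!: power_mono)
  qed auto
  moreover have "(\<integral>\<theta>. (cmod (\<Sum>k<N. ?t \<theta> k))\<^sup>2 \<partial>unit_lebesgue) \<le> s" for N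
  proof -
    have "?t \<theta> k = (a k * of_real (r ^ k)) * wave (int k) \<theta>" for \<theta> k
      by (simp add: power_mult_distrib wave_int_eq_power)
    then have "(\<integral>\<theta>. (cmod (\<Sum>k<N. ?t \<theta> k))\<^sup>2 \<partial>unit_lebesgue) = (\<Sum>k<N. (cmod (a k * of_real (r ^ k)))\<^sup>2)"
      by (simp only: parseval_finite)
    also have "\<dots> \<le> (\<Sum>k<N. (cmod (a k))\<^sup>2)"
    proof (intro sum_mono power_mono)
      fix k
      have "cmod (a k) * r ^ k \<le> cmod (a k) * 1"
        using r by (intro mult_left_mono power_le_one) auto
      then show "cmod (a k * of_real (r ^ k)) \<le> cmod (a k)"
        using r by (simp add: norm_mult norm_power)
    qed simp
    finally show ?thesis using s[of N] by linarith
  qed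
  ultimately show ?thesis by (intro LIMSEQ_le_const2) auto
qed

section \<open>The Poisson kernel\<close>

definition poisson :: "real \<Rightarrow> real \<Rightarrow> real" where
  "poisson r t = (1 - r\<^sup>2) / (cmod (1 - of_real r * wave 1 t))\<^sup>2"

lemma measurable_poisson [measurable]: "poisson r \<in> borel_measurable borel"
  unfolding poisson_def[abs_def] by measurable

text \<open>Used in two places. With \<open>w = z * wave (- 1) x\<close> it exhibits the Poisson
  kernel as a real part of the Cauchy kernel; with \<open>w\<close> the candidate inner function,
  where \<open>1 / (1 - w)\<close> is the Cauchy transform, it computes \<open>1 - |w|^2\<close>
  from the Poisson integral.\<close>

lemma two_Re_inverse_minus_one:
  assumes "w \<noteq> (1::complex)"
  shows "2 * Re (1 / (1 - w)) - 1 = (1 - (cmod w)\<^sup>2) / (cmod (1 - w))\<^sup>2"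
proof -
  have nz: "(cmod (1 - w))\<^sup>2 \<noteq> 0" using assms by simp
  have "Re (1 / (1 - w)) = (1 - Re w) / (cmod (1 - w))\<^sup>2"
    by (simp add: Re_divide cmod_power2)
  moreover have "2 * (1 - Re w) - (cmod (1 - w))\<^sup>2 = 1 - (cmod w)\<^sup>2"
    unfolding cmod_power2 by (simp add: power2_eq_square algebra_simps)
  ultimately show ?thesis using nz by (simp add: field_simps)
qed

lemma one_minus_le_cmod: "0 \<le> r \<Longrightarrow> 1 - r \<le> cmod (1 - of_real r * wave k t)"
  using norm_triangle_ineq2[of 1 "of_real r * wave k t"] by (simp add: norm_mult)

lemma poisson_nonneg: "0 \<le> r \<Longrightarrow> r < 1 \<Longrightarrow> 0 \<le> poisson r t"
  by (simp add: poisson_def power_le_one)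

lemma poisson_eq_Re:
  assumes "0 \<le> r" "r < 1"
  shows "poisson r (\<theta> - x) = 2 * Re (1 / (1 - (of_real r * wave 1 \<theta>) * wave (- 1) x)) - 1"
proof -
  let ?w = "(of_real r * wave 1 \<theta>) * wave (- 1) x"
  have w: "?w = of_real r * wave 1 (\<theta> - x)"
    using wave_add_arg[of 1 \<theta> "- x"] by (simp add: wave_uminus_arg)
  have "cmod ?w = r" using assms by (simp add: norm_mult)
  moreover from this have "?w \<noteq> 1" using assms by auto
  ultimately show ?thesis
    unfolding poisson_def by (subst two_Re_inverse_minus_one) (auto simp: w)
qed

lemma poisson_bound:
  assumes "0 \<le> r" "r < 1"
  shows "poisson r t \<le> (1 - r\<^sup>2) / (1 - r)\<^sup>2"
  unfolding poisson_def using one_minus_le_cmod[of r 1 t] assms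
  by (intro divide_left_mono power_mono mult_pos_pos zero_less_power) (auto simp: power_le_one)

text \<open>Moving from radius 1 to radius \<open>r\<close> changes the distance to the point 1 by
  at most \<open>1 - r\<close>, which is itself a lower bound for the new distance. The distance
  thus drops at most by the factor 2, and the 4 is its square.\<close>

lemma poisson_off_diagonal:
  assumes r: "0 \<le> r" "r < 1" and d: "0 < d" "d \<le> cmod (wave 1 x - wave 1 \<theta>)"
  shows "poisson r (\<theta> - x) \<le> (1 - r\<^sup>2) * (4 / d\<^sup>2)"
proof -
  let ?w = "wave 1 (\<theta> - x)"
  have "wave 1 x * ?w = wave 1 \<theta>"
    by (simp flip: wave_add_arg)
  then have "wave 1 x - wave 1 \<theta> = wave 1 x * (1 - ?w)"
    by (simp add: algebra_simps)
  then have "d \<le> cmod (1 - ?w)" using d by (simp add: norm_mult)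
  also have "1 - ?w = (1 - of_real r * ?w) + (of_real r - 1) * ?w"
    by (simp add: algebra_simps)
  also have "cmod \<dots> \<le> cmod (1 - of_real r * ?w) + (1 - r)"
    using norm_triangle_ineq[of "1 - of_real r * ?w" "(of_real r - 1) * ?w"] r
      norm_of_real[of "r - 1", where ?'a = complex]
    by (simp add: norm_mult)
  also have "\<dots> \<le> 2 * cmod (1 - of_real r * ?w)"
    using one_minus_le_cmod[OF r(1), of 1 "\<theta> - x"] by simp
  finally have "(d / 2)\<^sup>2 \<le> (cmod (1 - of_real r * ?w))\<^sup>2"
    using d by (intro power_mono) auto
  then have "poisson r (\<theta> - x) \<le> (1 - r\<^sup>2) / (d / 2)\<^sup>2"
    unfolding poisson_def using r d one_minus_le_cmod[OF r(1), of 1 "\<theta> - x"]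
    by (intro divide_left_mono mult_pos_pos zero_less_power) (auto simp: power_le_one)
  then show ?thesis by (simp add: power_divide)
qed

lemma wave_1_inj:
  assumes "wave 1 x = wave 1 y" "0 \<le> x" "x < 1" "0 \<le> y" "y < 1"
  shows "x = y"
proof -
  have "sin (2 * pi * x) = sin (2 * pi * y) \<and> cos (2 * pi * x) = cos (2 * pi * y)"
    using assms(1) by (simp add: wave_def complex_eq_iff)
  then obtain n :: int where "2 * pi * x = 2 * pi * y + 2 * pi * n"
    by (subst (asm) sin_cos_eq_iff) auto
  then have "2 * pi * x = 2 * pi * (y + n)" by (simp add: algebra_simps)
  then have "x = y + n" by simp
  then have "n = 0" using assms by linarith
  with \<open>x = y + n\<close> show ?thesis by simp
qed

section \<open>Cauchy transform and Poisson integral of a probability measure\<close>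

context real_distribution
begin

definition moment :: "nat \<Rightarrow> complex" where
  "moment k = (\<integral>x. wave (- int k) x \<partial>M)"

definition cauchy :: "complex \<Rightarrow> complex" where
  "cauchy z = (\<integral>x. 1 / (1 - z * wave (- 1) x) \<partial>M)"

lemma moment_0 [simp]: "moment 0 = 1"
  using prob_space by (simp add: moment_def)

lemma norm_moment_le: "cmod (moment k) \<le> 1"
proof -
  have "cmod (moment k) \<le> (\<integral>x. cmod (wave (- int k) x) \<partial>M)"
    unfolding moment_def by (rule integral_norm_bound)
  then show ?thesis using prob_space by simp
qed

lemma cauchy_sums:
  assumes "cmod z < 1"
  shows "(\<lambda>k. moment k * z ^ k) sums cauchy z"
proof -
  let ?f = "\<lambda>k x. z ^ k * wave (- int k) x"
  have eq: "?f k x = (z * wave (- 1) x) ^ k" for k x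
    by (simp add: power_mult_distrib wave_neg_eq_power)
  have geo: "summable (\<lambda>k. cmod z ^ k)" using assms by (simp add: summable_geometric)
  have "(\<lambda>k. \<integral>x. ?f k x \<partial>M) sums (\<integral>x. (\<Sum>k. ?f k x) \<partial>M)"
  proof (rule sums_integral)
    show "integrable M (?f k)" for k
      by (rule integrable_L2[OF in_L2_cmult[OF in_L2_wave]])
    show "AE x in M. summable (\<lambda>k. norm (?f k x))" "summable (\<lambda>k. \<integral>x. norm (?f k x) \<partial>M)"
      using geo prob_space by (simp_all add: norm_mult norm_power)
  qed
  moreover have "(\<Sum>k. ?f k x) = 1 / (1 - z * wave (- 1) x)" for x
    unfolding eq using assms by (intro suminf_geometric) (simp add: norm_mult)
  moreover have "(\<integral>x. ?f k x \<partial>M) = moment k * z ^ k" for k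
    by (simp add: moment_def mult.commute)
  ultimately show ?thesis by (simp only: cauchy_def)
qed

abbreviation "wcoeff \<equiv> kaczmarz_coeff M (wave (- 1))"

lemma norm_wcoeff_le: "cmod (wcoeff k) \<le> 1"
proof -
  have "sq_norm M (wave (- 1)) = 1" using prob_space by (simp add: sq_norm_def)
  then have "(cmod (wcoeff k))\<^sup>2 \<le> 1\<^sup>2" using kaczmarz_coeff_bound[OF in_L2_wave, of "-1" k] by simp
  then show ?thesis by (rule power2_le_imp_le) simp
qed

text \<open>Dividing the expansion after \<open>k\<close> steps by \<open>wave k\<close> writes the
  \<open>k\<close>-th iterate as a combination of exponentials, and its mean is a combination of
  moments. In terms of power series: the coefficient series times the moment series is the shifted
  moment series.\<close>

lemma wcoeff_convolution: "(\<Sum>j\<le>k. wcoeff j * moment (k - j)) = moment (Suc k)"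
proof -
  have "(twist M ^^ k) (wave (- 1)) x
      = wave (- int (Suc k)) x - (\<Sum>j<k. wcoeff j * wave (- int (k - j)) x)" for x
  proof -
    have "(twist M ^^ k) (wave (- 1)) x
        = wave (- int k) x * (wave (int k) x * (twist M ^^ k) (wave (- 1)) x)"
      using wave_add[of "- int k" "int k" x] by (simp flip: mult.assoc)
    also have "\<dots> = wave (- int k) x * wave (- 1) x - (\<Sum>j<k. wcoeff j * (wave (- int k) x * wave (int j) x))"
      by (simp add: right_diff_distrib sum_distrib_left mult.left_commute
          flip: kaczmarz_expansion[where f = "wave (- 1)" and N = k])
    also have "wave (- int k) x * wave (- 1) x = wave (- int (Suc k)) x"
      using wave_add[of "- 1" "- int k" x] by (simp add: mult.commute)
    also have "(\<Sum>j<k. wcoeff j * (wave (- int k) x * wave (int j) x))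
        = (\<Sum>j<k. wcoeff j * wave (- int (k - j)) x)"
      by (intro sum.cong refl) (simp add: of_nat_diff flip: wave_add)
    finally show ?thesis .
  qed
  note eq = this
  have int: "integrable M (\<lambda>x. c * wave i x)" for c i
    by (rule integrable_L2[OF in_L2_cmult[OF in_L2_wave]])
  have "wcoeff k = moment (Suc k) - (\<Sum>j<k. wcoeff j * moment (k - j))"
    unfolding kaczmarz_coeff_def[of M _ k] eq moment_def
    using int[of 1]
    by (subst Bochner_Integration.integral_diff)
      (auto simp: int Bochner_Integration.integral_sum simp del: of_nat_Suc)
  then show ?thesis by (simp flip: lessThan_Suc_atMost)
qed

text \<open>The Cauchy product turns the recursion into this equation. As a product equal to 1 it
  also shows that neither factor vanishes.\<close>

lemma cauchy_identity:
  assumes "cmod z < 1"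
  shows "(1 - z * (\<Sum>k. wcoeff k * z ^ k)) * cauchy z = 1"
proof -
  have geo: "summable (\<lambda>k. cmod z ^ k)" using assms by (simp add: summable_geometric)
  have sm: "summable (\<lambda>k. norm (c k * z ^ k))" if "\<And>k. cmod (c k) \<le> 1" for c
  proof (rule summable_comparison_test'[OF geo])
    show "norm (norm (c k * z ^ k)) \<le> cmod z ^ k" for k
      using mult_right_mono[OF that[of k], of "cmod z ^ k"] by (simp add: norm_mult norm_power)
  qed
  note 1 = cauchy_sums[OF assms]
  have "(\<Sum>k. wcoeff k * z ^ k) * (\<Sum>k. moment k * z ^ k)
      = (\<Sum>k. \<Sum>i\<le>k. (wcoeff i * z ^ i) * (moment (k - i) * z ^ (k - i)))"
    by (intro Cauchy_product sm norm_wcoeff_le norm_moment_le)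
  also have "\<dots> = (\<Sum>k. moment (Suc k) * z ^ k)"
  proof (rule suminf_cong)
    fix k
    have "(\<Sum>i\<le>k. (wcoeff i * z ^ i) * (moment (k - i) * z ^ (k - i)))
        = (\<Sum>i\<le>k. (wcoeff i * moment (k - i)) * z ^ k)"
      by (intro sum.cong refl) (simp add: mult_ac flip: power_add)
    then show "(\<Sum>i\<le>k. (wcoeff i * z ^ i) * (moment (k - i) * z ^ (k - i))) = moment (Suc k) * z ^ k"
      by (simp add: wcoeff_convolution flip: sum_distrib_right)
  qed
  finally have "(\<Sum>k. wcoeff k * z ^ k) * cauchy z = (\<Sum>k. moment (Suc k) * z ^ k)"
    using sums_unique[OF 1] by simp
  moreover have "cauchy z = 1 + z * (\<Sum>k. moment (Suc k) * z ^ k)"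
    using powser_split_head(1)[OF sums_summable[OF 1]] sums_unique[OF 1] by (simp add: mult.commute)
  ultimately show ?thesis by (simp add: algebra_simps)
qed

definition poisson_integral :: "real \<Rightarrow> real \<Rightarrow> real" where
  "poisson_integral r \<theta> = (\<integral>x. poisson r (\<theta> - x) \<partial>M)"

lemma integrable_poisson:
  assumes "0 \<le> r" "r < 1"
  shows "integrable M (\<lambda>x. poisson r (\<theta> - x))"
  by (rule integrable_const_bound[where B = "(1 - r\<^sup>2) / (1 - r)\<^sup>2"])
    (use poisson_bound[OF assms] poisson_nonneg[OF assms] in auto)

lemma integrable_poisson_part:
  assumes "A \<in> sets borel" "0 \<le> r" "r < 1"
  shows "integrable M (\<lambda>x. indicator A x * poisson r (\<theta> - x))"
  using integrable_real_mult_indicator[OF _ integrable_poisson[OF assms(2,3), of \<theta>], of A] assms(1)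
  by (simp add: mult.commute)

lemma poisson_integral_eq:
  assumes r: "0 \<le> r" "r < 1"
  shows "poisson_integral r \<theta> = 2 * Re (cauchy (of_real r * wave 1 \<theta>)) - 1"
proof -
  let ?g = "\<lambda>x. 1 / (1 - (of_real r * wave 1 \<theta>) * wave (- 1) x)"
  have bd: "cmod (?g x) \<le> 1 / (1 - r)" for x
  proof -
    have w: "(of_real r * wave 1 \<theta>) * wave (- 1) x = of_real r * wave 1 (\<theta> - x)"
      using wave_add_arg[of 1 \<theta> "- x"] by (simp add: wave_uminus_arg)
    show ?thesis
      unfolding w norm_divide norm_one
      using one_minus_le_cmod[OF r(1), of 1 "\<theta> - x"] r by (intro frac_le) auto
  qed
  have "integrable M ?g"
    by (rule integrable_const_bound[where B = "1 / (1 - r)"]) (use bd in auto)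
  then show ?thesis
    using prob_space unfolding poisson_integral_def poisson_eq_Re[OF r] cauchy_def by simp
qed

text \<open>Let \<open>w\<close> be the function under the norm, \<open>C = 1 / (1 - w)\<close> the
  Cauchy transform and \<open>P\<close> the Poisson integral. From
  \<open>P = 2 * Re C - 1 \<ge> 0\<close> follows \<open>|C| \<ge> 1/2\<close>, hence
  \<open>|1 - w| \<le> 2\<close>, and \<open>1 - |w|^2 = P * |1 - w|^2 \<le> 4 * P\<close>. The
  minimum with 1 keeps the bound dominated as \<open>r\<close> tends to 1, where \<open>P\<close>
  itself need not be.\<close>

lemma one_minus_norm_inner_le:
  assumes r: "0 \<le> r" "r < 1"
  defines "z \<equiv> \<lambda>\<theta>. of_real r * wave 1 \<theta>"
  shows "1 - (cmod (z \<theta> * (\<Sum>k. wcoeff k * z \<theta> ^ k)))\<^sup>2 \<le> min 1 (4 * poisson_integral r \<theta>)"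
proof -
  define w where "w = z \<theta> * (\<Sum>k. wcoeff k * z \<theta> ^ k)"
  define C where "C = cauchy (z \<theta>)"
  have "cmod (z \<theta>) < 1" using r by (simp add: z_def norm_mult)
  from cauchy_identity[OF this] have 1: "(1 - w) * C = 1" by (simp add: w_def C_def)
  then have w1: "w \<noteq> 1" by auto
  have C: "C = 1 / (1 - w)" using 1 w1 by (simp add: field_simps)
  have P: "poisson_integral r \<theta> = 2 * Re C - 1"
    using poisson_integral_eq[OF r] by (simp add: C_def z_def)
  have P0: "poisson_integral r \<theta> \<ge> 0"
    unfolding poisson_integral_def by (rule integral_nonneg_AE) (simp add: poisson_nonneg r)
  have "1 / 2 \<le> Re C" using P P0 by simp
  also have "\<dots> \<le> cmod C" by (rule complex_Re_le_cmod)
  finally have "1 / 2 * cmod (1 - w) \<le> cmod C * cmod (1 - w)" by (rule mult_right_mono) simp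
  also have "\<dots> = 1" using 1 by (metis mult.commute norm_mult norm_one)
  finally have "(cmod (1 - w))\<^sup>2 \<le> 2\<^sup>2" by (intro power_mono) auto
  moreover have "1 - (cmod w)\<^sup>2 = poisson_integral r \<theta> * (cmod (1 - w))\<^sup>2"
    using two_Re_inverse_minus_one[OF w1] w1 by (simp add: P C)
  ultimately have "1 - (cmod w)\<^sup>2 \<le> 4 * poisson_integral r \<theta>"
    using mult_left_mono[of "(cmod (1 - w))\<^sup>2" 4 "poisson_integral r \<theta>"] P0 by simp
  then show ?thesis by (simp add: w_def)
qed


text \<open>By compactness \<open>K\<close> stays at a distance \<open>d > 0\<close> from
  \<open>\<theta>\<close> on the circle, so the kernel on \<open>K\<close> is at most a fixed
  multiple of \<open>1 - r^2\<close>.\<close>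

lemma poisson_integral_on_compact_tendsto_0:
  assumes K: "compact K" "K \<subseteq> {0..<1}" "\<theta> \<notin> K" "0 \<le> \<theta>" "\<theta> < 1"
    and r: "\<And>j. 0 \<le> r j" "\<And>j. r j < 1" "r \<longlonglongrightarrow> 1"
  shows "(\<lambda>j. \<integral>x. indicator K x * poisson (r j) (\<theta> - x) \<partial>M) \<longlonglongrightarrow> 0"
proof (cases "K = {}")
  case False
  have cont: "continuous_on K (\<lambda>x. cmod (wave 1 x - wave 1 \<theta>))"
    by (intro continuous_intros)
  obtain x0 where x0: "x0 \<in> K" "\<And>x. x \<in> K \<Longrightarrow> cmod (wave 1 x0 - wave 1 \<theta>) \<le> cmod (wave 1 x - wave 1 \<theta>)"
    using continuous_attains_inf[OF K(1) False cont] by blast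
  define d where "d = cmod (wave 1 x0 - wave 1 \<theta>)"
  have "wave 1 x0 \<noteq> wave 1 \<theta>"
    using wave_1_inj[of x0 \<theta>] x0(1) K by auto
  then have d: "0 < d" by (simp add: d_def)
  have K': "K \<in> sets borel" using K(1) by (simp add: borel_compact)
  have le: "indicator K x * poisson (r j) (\<theta> - x) \<le> (1 - (r j)\<^sup>2) * (4 / d\<^sup>2)" for x j
  proof (cases "x \<in> K")
    case True
    then show ?thesis
      using poisson_off_diagonal[OF r(1,2) d, of x \<theta> j] x0(2)[OF True] by (simp add: d_def)
  next
    case False
    have "0 \<le> (1 - (r j)\<^sup>2) * (4 / d\<^sup>2)"
      using r(1,2)[of j] by (intro mult_nonneg_nonneg) (auto simp: power_le_one)
    then show ?thesis using False by simp
  qed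
  show ?thesis
  proof (rule tendsto_sandwich[of "\<lambda>_. 0"])
    show "\<forall>\<^sub>F j in sequentially. 0 \<le> (\<integral>x. indicator K x * poisson (r j) (\<theta> - x) \<partial>M)"
      by (intro always_eventually allI integral_nonneg_AE AE_I2 mult_nonneg_nonneg poisson_nonneg r) simp
    show "\<forall>\<^sub>F j in sequentially. (\<integral>x. indicator K x * poisson (r j) (\<theta> - x) \<partial>M) \<le> (1 - (r j)\<^sup>2) * (4 / d\<^sup>2)"
    proof (intro always_eventually allI)
      fix j
      have "(\<integral>x. indicator K x * poisson (r j) (\<theta> - x) \<partial>M) \<le> (\<integral>x. (1 - (r j)\<^sup>2) * (4 / d\<^sup>2) \<partial>M)"
        using K' le by (intro integral_mono integrable_poisson_part r) auto
      then show "(\<integral>x. indicator K x * poisson (r j) (\<theta> - x) \<partial>M) \<le> (1 - (r j)\<^sup>2) * (4 / d\<^sup>2)"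
        using prob_space by simp
    qed
    have "(\<lambda>j. (1 - (r j)\<^sup>2) * (4 / d\<^sup>2)) \<longlonglongrightarrow> (1 - 1\<^sup>2) * (4 / d\<^sup>2)"
      by (intro tendsto_intros r(3))
    then show "(\<lambda>j. (1 - (r j)\<^sup>2) * (4 / d\<^sup>2)) \<longlonglongrightarrow> 0" by simp
  qed simp
qed simp

end

text \<open>The kernel is even, so this is the Poisson integral of Lebesgue measure at
  \<open>x\<close>; the Cauchy transform of that measure is constantly 1, since all its moments
  except the zeroth vanish.\<close>

lemma integral_poisson_unit_lebesgue:
  assumes r: "0 \<le> r" "r < 1"
  shows "(\<integral>\<theta>. poisson r (\<theta> - x) \<partial>unit_lebesgue) = 1"
proof -
  have "poisson r (\<theta> - x) = poisson r (x - \<theta>)" for \<theta>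
  proof -
    have "cnj (1 - of_real r * wave 1 (\<theta> - x)) = 1 - of_real r * wave 1 (x - \<theta>)"
      using wave_uminus_arg[of 1 "\<theta> - x"] by (simp add: cnj_wave)
    then show ?thesis unfolding poisson_def by (metis complex_mod_cnj)
  qed
  then have "(\<integral>\<theta>. poisson r (\<theta> - x) \<partial>unit_lebesgue) = U.poisson_integral r x"
    by (simp add: U.poisson_integral_def)
  also have "\<dots> = 2 * Re (U.cauchy (of_real r * wave 1 x)) - 1"
    by (rule U.poisson_integral_eq[OF r])
  also have "U.cauchy (of_real r * wave 1 x) = 1"
  proof -
    have "cmod (of_real r * wave 1 x) < 1" using r by (simp add: norm_mult)
    from U.cauchy_sums[OF this]
    have "(\<lambda>k. (if k = 0 then 1 else 0) * (of_real r * wave 1 x) ^ k) sums U.cauchy (of_real r * wave 1 x)"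
      by (simp add: U.moment_def integral_wave_unit_lebesgue)
    moreover have "(\<lambda>k. (if k = 0 then 1 else 0) * (of_real r * wave 1 x) ^ k) sums 1"
      using sums_single[of 0 "\<lambda>k. (of_real r * wave 1 x) ^ k"]
      by (simp add: if_distrib if_distribR cong: if_cong)
    ultimately show ?thesis by (rule sums_unique2)
  qed
  finally show ?thesis by simp
qed

context real_distribution
begin

lemma borel_measurable_poisson_part:
  assumes [measurable]: "A \<in> sets borel"
  shows "(\<lambda>\<theta>. \<integral>x. indicator A x * poisson r (\<theta> - x) \<partial>M) \<in> borel_measurable borel"
  by measurable

text \<open>By Fubini, each point of \<open>A\<close> spreads its mass over the circle without
  loss.\<close>

lemma integral_poisson_part:
  assumes [measurable]: "A \<in> sets borel" and r: "0 \<le> r" "r < 1"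
  shows "(\<integral>\<theta>. (\<integral>x. indicator A x * poisson r (\<theta> - x) \<partial>M) \<partial>unit_lebesgue) = measure M A"
    and "integrable unit_lebesgue (\<lambda>\<theta>. \<integral>x. indicator A x * poisson r (\<theta> - x) \<partial>M)"
proof -
  interpret P: pair_sigma_finite M unit_lebesgue ..
  interpret P': pair_prob_space M unit_lebesgue ..
  have int: "integrable (M \<Otimes>\<^sub>M unit_lebesgue) (\<lambda>(x, \<theta>). indicator A x * poisson r (\<theta> - x))"
  proof (rule P'.integrable_const_bound[where B = "(1 - r\<^sup>2) / (1 - r)\<^sup>2"])
    have "\<bar>indicator A x * poisson r t\<bar> \<le> (1 - r\<^sup>2) / (1 - r)\<^sup>2" for x t
      using poisson_bound[OF r, of t] poisson_nonneg[OF r, of t] r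
      by (auto simp: indicator_def power_le_one)
    then show "AE x in M \<Otimes>\<^sub>M unit_lebesgue.
        norm (case x of (x, \<theta>) \<Rightarrow> indicator A x * poisson r (\<theta> - x)) \<le> (1 - r\<^sup>2) / (1 - r)\<^sup>2"
      by auto
  qed measurable
  show "(\<integral>\<theta>. (\<integral>x. indicator A x * poisson r (\<theta> - x) \<partial>M) \<partial>unit_lebesgue) = measure M A"
    using P.Fubini_integral[OF int] integral_poisson_unit_lebesgue[OF r]
    by simp
  show "integrable unit_lebesgue (\<lambda>\<theta>. \<integral>x. indicator A x * poisson r (\<theta> - x) \<partial>M)"
    by (rule P.integrable_snd[OF int])
qed

text \<open>The compact null set \<open>K\<close> carries all but \<open>e\<close> of the mass. The Poisson integral of the
  mass on \<open>K\<close> vanishes at the boundary off \<open>K\<close>, and the rest contributes at most \<open>4 e\<close>.\<close>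

lemma poisson_integral_small:
  assumes sing: "lebesgue_singular M" and unit: "emeasure M (UNIV - {0..<1}) = 0" and "0 < e"
  shows "\<exists>r. 0 \<le> r \<and> r < 1 \<and>
    (\<integral>\<theta>. min 1 (4 * poisson_integral r \<theta>) \<partial>unit_lebesgue) < 5 * e"
proof -
  obtain N where N: "N \<in> sets borel" "emeasure lborel N = 0" "emeasure M (UNIV - N) = 0"
    using sing by (auto simp: lebesgue_singular_def)
  let ?B = "N \<inter> {0..<1}"
  have B: "?B \<in> sets borel" using N by auto
  have AEB: "AE x in M. x \<in> ?B"
  proof -
    have "AE x in M. x \<notin> UNIV - N"
      by (rule AE_not_in) (use N in \<open>simp add: null_sets_def\<close>)
    moreover have "AE x in M. x \<notin> UNIV - {0..<1}"
      by (rule AE_not_in) (use unit in \<open>simp add: null_sets_def\<close>)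
    ultimately show ?thesis by eventually_elim auto
  qed
  have "emeasure M ?B = 1"
    using AEB B by (simp add: emeasure_eq_1_AE)
  moreover have "emeasure M ?B = (SUP K\<in>{K. K \<subseteq> ?B \<and> compact K}. emeasure M K)"
    using B by (intro inner_regular) auto
  moreover have "ennreal (1 - e) < 1" using \<open>0 < e\<close> by (simp add: ennreal_less_one_iff)
  ultimately have "ennreal (1 - e) < (SUP K\<in>{K. K \<subseteq> ?B \<and> compact K}. emeasure M K)" by simp
  then obtain K where K: "K \<subseteq> ?B" "compact K" "ennreal (1 - e) < emeasure M K"
    by (auto simp: less_SUP_iff)
  have K'[measurable]: "K \<in> sets borel" using K(2) by (simp add: borel_compact)
  have mK: "measure M (- K) < e"
  proof -
    have "1 - e < measure M K"
      using K(3) by (cases "1 - e \<ge> 0") (auto simp: emeasure_eq_measure ennreal_less_iff intro: less_le_trans[OF _ measure_nonneg])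
    then show ?thesis using prob_compl[of K] by (simp add: Compl_eq_Diff_UNIV)
  qed
  \<comment> \<open>Any sequence in the half-open unit interval with limit 1 would serve.\<close>
  define r where "r j = 1 - 1 / (real j + 2)" for j :: nat
  have r: "0 \<le> r j" "r j < 1" for j by (simp_all add: r_def)
  have rlim: "r \<longlonglongrightarrow> 1" unfolding r_def by real_asymp
  let ?P1 = "\<lambda>j \<theta>. \<integral>x. indicator K x * poisson (r j) (\<theta> - x) \<partial>M"
  let ?P2 = "\<lambda>j \<theta>. \<integral>x. indicator (- K) x * poisson (r j) (\<theta> - x) \<partial>M"
  have nonneg: "0 \<le> (\<integral>x. indicator A x * poisson (r j) (\<theta> - x) \<partial>M)" for A j \<theta>
    by (intro integral_nonneg_AE AE_I2 mult_nonneg_nonneg poisson_nonneg r) simp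
  have split: "poisson_integral (r j) \<theta> = ?P1 j \<theta> + ?P2 j \<theta>" for j \<theta>
  proof -
    have "poisson_integral (r j) \<theta>
        = (\<integral>x. indicator K x * poisson (r j) (\<theta> - x) + indicator (- K) x * poisson (r j) (\<theta> - x) \<partial>M)"
      unfolding poisson_integral_def by (intro Bochner_Integration.integral_cong) (auto simp: indicator_def)
    also have "\<dots> = ?P1 j \<theta> + ?P2 j \<theta>"
      using r by (intro Bochner_Integration.integral_add integrable_poisson_part) auto
    finally show ?thesis .
  qed
  \<comment> \<open>Here singularity enters: \<open>K\<close> lies in a Lebesgue null set, so almost
    every boundary point is off \<open>K\<close>.\<close>
  have AEK: "AE \<theta> in unit_lebesgue. \<theta> \<notin> K \<and> 0 \<le> \<theta> \<and> \<theta> < 1"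
  proof -
    have "AE \<theta> in lborel. \<theta> \<notin> N" using N by (intro AE_not_in) (auto simp: null_sets_def)
    then show ?thesis unfolding AE_unit_lebesgue by eventually_elim (use K in auto)
  qed
  note [measurable] = borel_measurable_poisson_part
  have "(\<lambda>j. \<integral>\<theta>. min 1 (4 * ?P1 j \<theta>) \<partial>unit_lebesgue) \<longlonglongrightarrow> (\<integral>\<theta>. 0 \<partial>unit_lebesgue)"
  proof (rule integral_dominated_convergence[where w = "\<lambda>_. 1"])
    show "AE \<theta> in unit_lebesgue. (\<lambda>j. min 1 (4 * ?P1 j \<theta>)) \<longlonglongrightarrow> 0"
      using AEK
    proof eventually_elim
      case (elim \<theta>)
      have "(\<lambda>j. min 1 (4 * ?P1 j \<theta>)) \<longlonglongrightarrow> min 1 (4 * 0)"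
        using K elim by (intro tendsto_intros poisson_integral_on_compact_tendsto_0 r rlim) auto
      then show ?case by simp
    qed
    show "AE \<theta> in unit_lebesgue. norm (min 1 (4 * ?P1 j \<theta>)) \<le> 1" for j
      using nonneg[of K j] by (intro always_eventually allI) (auto simp: min_def)
  qed (auto intro!: borel_measurable_min borel_measurable_times borel_measurable_poisson_part)
  then obtain j where j: "(\<integral>\<theta>. min 1 (4 * ?P1 j \<theta>) \<partial>unit_lebesgue) < e"
    using order_tendstoD(2)[of _ 0 sequentially e] \<open>0 < e\<close> eventually_happens by fastforce
  have int1: "integrable unit_lebesgue (\<lambda>\<theta>. min 1 (4 * ?P1 j \<theta>))"
    using nonneg[of K j]
    by (intro U.integrable_const_bound[where B = 1] borel_measurable_min) (auto simp: min_def)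
  have int2: "integrable unit_lebesgue (\<lambda>\<theta>. 4 * ?P2 j \<theta>)"
    using integral_poisson_part(2)[of "- K", OF _ r] by simp
  have "(\<integral>\<theta>. min 1 (4 * poisson_integral (r j) \<theta>) \<partial>unit_lebesgue)
      \<le> (\<integral>\<theta>. min 1 (4 * ?P1 j \<theta>) + 4 * ?P2 j \<theta> \<partial>unit_lebesgue)"
  proof (rule integral_mono)
    show "integrable unit_lebesgue (\<lambda>\<theta>. min 1 (4 * poisson_integral (r j) \<theta>))"
    proof (rule U.integrable_const_bound[where B = 1])
      show "AE \<theta> in unit_lebesgue. norm (min 1 (4 * poisson_integral (r j) \<theta>)) \<le> 1"
        unfolding split using nonneg[of K j] nonneg[of "- K" j] by (auto simp: min_def intro!: add_nonneg_nonneg)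
      show "(\<lambda>\<theta>. min 1 (4 * poisson_integral (r j) \<theta>)) \<in> borel_measurable unit_lebesgue"
        unfolding split by (intro borel_measurable_min) auto
    qed
    \<comment> \<open>Only the part on \<open>K\<close> is cut off at 1, for dominated convergence;
      the other part has a small integral without truncation.\<close>
    show "min 1 (4 * poisson_integral (r j) \<theta>) \<le> min 1 (4 * ?P1 j \<theta>) + 4 * ?P2 j \<theta>" for \<theta>
      unfolding split using nonneg[of K j \<theta>] nonneg[of "- K" j \<theta>] by (simp add: min_def)
  qed (use int1 int2 in auto)
  also have "\<dots> = (\<integral>\<theta>. min 1 (4 * ?P1 j \<theta>) \<partial>unit_lebesgue) + 4 * measure M (- K)"
    using int1 int2 integral_poisson_part(1)[of "- K", OF _ r[of j]] by simp
  also have "\<dots> < 5 * e" using j mK by simp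
  finally show ?thesis using r[of j] by blast
qed

text \<open>If residuals of squared norm at least \<open>\<delta>\<close> kept occurring, the
  squared coefficients would sum to at most \<open>1 - \<delta>\<close>. By Bessel the inner
  function would then have mean square at most \<open>1 - \<delta>\<close> on every circle, while
  \<open>poisson_integral_small\<close> with \<open>\<delta> / 5\<close> gives a circle where it
  exceeds \<open>1 - \<delta>\<close>.\<close>

theorem effective_wave_minus_1:
  assumes sing: "lebesgue_singular M" and unit: "emeasure M (UNIV - {0..<1}) = 0"
  shows "effective (wave (- 1))"
  unfolding effective_def
proof
  show "in_L2 M (wave (- 1))" by (rule in_L2_wave)
  have n1: "sq_norm M (wave (- 1)) = 1" using prob_space by (simp add: sq_norm_def)
  note eq = sq_norm_twist_iter[OF in_L2_wave[of "- 1"], unfolded n1]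
  show "(\<lambda>N. sq_norm M ((twist M ^^ N) (wave (- 1)))) \<longlonglongrightarrow> 0"
  proof (rule LIMSEQ_I, rule ccontr)
    fix \<delta> :: real assume \<delta>: "0 < \<delta>"
      and neg: "\<not> (\<exists>N0. \<forall>N\<ge>N0. norm (sq_norm M ((twist M ^^ N) (wave (- 1))) - 0) < \<delta>)"
    \<comment> \<open>The negated limit yields large residuals only at arbitrarily late
      \<open>N'\<close>; since the partial sums increase, the bound there covers every earlier
      \<open>N\<close>.\<close>
    have s: "(\<Sum>k<N. (cmod (wcoeff k))\<^sup>2) \<le> 1 - \<delta>" for N
    proof -
      obtain N' where N': "N' \<ge> N" "sq_norm M ((twist M ^^ N') (wave (- 1))) \<ge> \<delta>"
        using neg by (auto simp: not_less)
      have "(\<Sum>k<N. (cmod (wcoeff k))\<^sup>2) \<le> (\<Sum>k<N'. (cmod (wcoeff k))\<^sup>2)"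
        using N'(1) by (intro sum_mono2) auto
      then show ?thesis using N'(2) eq[of N'] by linarith
    qed
    obtain r where r: "0 \<le> r" "r < 1"
      "(\<integral>\<theta>. min 1 (4 * poisson_integral r \<theta>) \<partial>unit_lebesgue) < 5 * (\<delta> / 5)"
      using poisson_integral_small[OF sing unit, of "\<delta> / 5"] \<delta> by auto
    let ?g = "\<lambda>\<theta>. \<Sum>k. wcoeff k * (of_real r * wave 1 \<theta>) ^ k"
    let ?h = "\<lambda>\<theta>. (cmod ((of_real r * wave 1 \<theta>) * ?g \<theta>))\<^sup>2"
    have B: "(\<integral>\<theta>. (cmod (?g \<theta>))\<^sup>2 \<partial>unit_lebesgue) \<le> 1 - \<delta>"
      by (rule bessel_power_series[OF norm_wcoeff_le s r(1,2)])
    have gm: "?g \<in> borel_measurable borel" by measurable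
    have gb: "cmod (?g \<theta>) \<le> (\<Sum>k. r ^ k)" for \<theta>
    proof (rule norm_suminf_le)
      show "norm (wcoeff k * (of_real r * wave 1 \<theta>) ^ k) \<le> r ^ k" for k
        using mult_right_mono[OF norm_wcoeff_le, of "r ^ k" k] r by (simp add: norm_mult norm_power)
    qed (use r in \<open>simp add: summable_geometric\<close>)
    have gL: "in_L2 unit_lebesgue ?g"
      by (rule U.in_L2_bounded[where B = "\<Sum>k. r ^ k"]) (use gm gb in auto)
    have hint: "integrable unit_lebesgue ?h"
      using in_L2_mult_bounded[OF gL, of "\<lambda>\<theta>. of_real r * wave 1 \<theta>" r] r
      by (simp add: in_L2_def norm_mult)
    have "1 - (\<integral>\<theta>. ?h \<theta> \<partial>unit_lebesgue) = (\<integral>\<theta>. 1 - ?h \<theta> \<partial>unit_lebesgue)"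
      using hint U.prob_space by simp
    also have "\<dots> \<le> (\<integral>\<theta>. min 1 (4 * poisson_integral r \<theta>) \<partial>unit_lebesgue)"
    proof (rule integral_mono)
      show "integrable unit_lebesgue (\<lambda>\<theta>. 1 - ?h \<theta>)" using hint by simp
      show "1 - ?h \<theta> \<le> min 1 (4 * poisson_integral r \<theta>)" for \<theta>
        by (rule one_minus_norm_inner_le[OF r(1,2)])
      show "integrable unit_lebesgue (\<lambda>\<theta>. min 1 (4 * poisson_integral r \<theta>))"
      proof (rule U.integrable_const_bound[where B = 1])
        have "poisson_integral r \<theta> \<ge> 0" for \<theta>
          unfolding poisson_integral_def by (rule integral_nonneg_AE) (simp add: poisson_nonneg r)
        then show "AE \<theta> in unit_lebesgue. norm (min 1 (4 * poisson_integral r \<theta>)) \<le> 1"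
          by (auto simp: min_def)
        show "(\<lambda>\<theta>. min 1 (4 * poisson_integral r \<theta>)) \<in> borel_measurable unit_lebesgue"
          unfolding poisson_integral_def by measurable
      qed
    qed
    also have "\<dots> < \<delta>" using r(3) by simp
    finally have "1 - \<delta> < (\<integral>\<theta>. ?h \<theta> \<partial>unit_lebesgue)" by simp
    also have "(\<integral>\<theta>. ?h \<theta> \<partial>unit_lebesgue) = r\<^sup>2 * (\<integral>\<theta>. (cmod (?g \<theta>))\<^sup>2 \<partial>unit_lebesgue)"
      using r by (simp add: norm_mult power_mult_distrib)
    also have "\<dots> \<le> 1 * (\<integral>\<theta>. (cmod (?g \<theta>))\<^sup>2 \<partial>unit_lebesgue)"
      using r by (intro mult_right_mono) (auto simp: power_le_one)
    finally show False using B by simp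
  qed
qed

end

section \<open>Completeness of the effective vectors\<close>

text \<open>The cosine on the left is its value at the ends of the arc from 0 to \<open>t\<close>,
  whose centre is \<open>t / 2\<close>; on the circle the cosine decreases with the distance from
  the centre. For \<open>t = 1\<close> the arc is everything except the point 0.\<close>

lemma cos_arc_iff:
  assumes x: "0 \<le> x" "x < 1" and t: "0 < t" "t \<le> 1"
  shows "cos (pi * t) < cos (2 * pi * x - pi * t) \<longleftrightarrow> 0 < x \<and> x < t"
proof (cases "2 * x - t \<le> 1")
  case True
  have eq: "2 * pi * x - pi * t = pi * (2 * x - t)" by (simp add: algebra_simps)
  have "\<bar>2 * x - t\<bar> \<le> 1" using True x t by auto
  then have le: "pi * \<bar>2 * x - t\<bar> \<le> pi * 1" by (intro mult_left_mono) auto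
  have "cos (2 * pi * x - pi * t) = cos (pi * \<bar>2 * x - t\<bar>)"
    unfolding eq using cos_minus[of "pi * (2 * x - t)"] by (auto simp: abs_if simp flip: mult_minus_right)
  then have "cos (pi * t) < cos (2 * pi * x - pi * t) \<longleftrightarrow> pi * \<bar>2 * x - t\<bar> < pi * t"
    using le t by (subst cos_mono_less_eq[symmetric]) auto
  then show ?thesis by auto
next
  case False
  \<comment> \<open>The point is more than half a turn from the centre when measured along the
    interval, so the distance is taken the other way round the circle.\<close>
  define s where "s = 2 - (2 * x - t)"
  have s: "t < s" "s < 1" using False x by (auto simp: s_def)
  have "2 * pi * x - pi * t = - (pi * s) + 2 * pi" by (simp add: s_def algebra_simps)
  then have "cos (2 * pi * x - pi * t) = cos (pi * s)"
    using cos_periodic[of "- (pi * s)"] by (simp only: cos_minus)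
  moreover have "cos (pi * s) < cos (pi * t)"
    using s t by (subst cos_mono_less_eq) auto
  ultimately show ?thesis using False x by auto
qed

section \<open>Multipliers of the effective vectors\<close>

context real_distribution
begin

lemma borel_measurable_M_eq: "borel_measurable M = borel_measurable borel"
  by (rule measurable_cong_sets) simp_all

lemma effective_measurable: "effective f \<Longrightarrow> f \<in> borel_measurable borel"
  by (simp add: effective_def in_L2_def borel_measurable_M_eq)

lemma effective_cong_AE:
  assumes "effective f" "AE x in M. f x = g x" and [measurable]: "g \<in> borel_measurable borel"
  shows "effective g"
proof -
  have [measurable]: "f \<in> borel_measurable borel"
    by (rule effective_measurable[OF assms(1)])
  have "effective (\<lambda>x. g x - f x)"
    using assms(2) by (intro effective_null) auto
  from effective_add[OF assms(1) this] show ?thesis by simp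
qed

lemma effective_sum:
  "finite I \<Longrightarrow> (\<And>i. i \<in> I \<Longrightarrow> effective (f i)) \<Longrightarrow> effective (\<lambda>x. \<Sum>i\<in>I. f i x)"
  by (induction I rule: finite_induct) (simp_all add: effective_add effective_null)

context
  assumes wave_effective: "effective (wave (- 1))" and unit: "emeasure M (UNIV - {0..<1}) = 0"
begin

lemma effective_one: "effective (\<lambda>_. 1)"
proof -
  have "wave 1 x * wave (- 1) x = 1" for x by (simp flip: wave_add)
  then show ?thesis using effective_wave_mult(2)[OF wave_effective wave_effective] by simp
qed

lemma effective_cos_mult:
  assumes f: "effective f"
  shows "effective (\<lambda>x. of_real (cos (2 * pi * x - s)) * f x)"
proof -
  have "of_real (cos (2 * pi * x - s))
      = cis (- s) / 2 * wave 1 x + cis s / 2 * wave (- 1) x" for x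
  proof -
    have "cis (- s) * wave 1 x = cis (2 * pi * x - s)" "cis s * wave (- 1) x = cis (- (2 * pi * x - s))"
      by (simp_all add: wave_def cis_mult)
    then show ?thesis
      using cos_minus[of "2 * pi * x - s"] sin_minus[of "2 * pi * x - s"] by (simp add: complex_eq_iff)
  qed
  moreover have "effective (\<lambda>x. cis (- s) / 2 * (wave 1 x * f x) + cis s / 2 * (wave (- 1) x * f x))"
    by (intro effective_add effective_cmult effective_wave_mult[OF wave_effective] f)
  ultimately show ?thesis by (simp add: algebra_simps)
qed

text \<open>Polynomials in one shifted cosine take the place of trigonometric polynomials: the
  approximation then happens on the interval from -1 to 1, and every arc is a superlevel set of such
  a cosine.\<close>

lemma effective_polynomial_mult:
  assumes "real_polynomial_function p" "effective f"
  shows "effective (\<lambda>x. of_real (p (cos (2 * pi * x - s))) * f x)"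
  using assms
proof (induction p arbitrary: f rule: real_polynomial_function.induct)
  case (linear h)
  have "h c = h 1 * c" for c using linear_cmul[of h c 1] linear(1)
    by (simp add: bounded_linear.linear mult.commute)
  then show ?case
    using effective_cmult[OF effective_cos_mult[OF linear(2), of s], of "of_real (h 1)"]
    by (metis (no_types, lifting) ext mult.assoc of_real_mult)
next
  case (add g h)
  then show ?case using effective_add[of "\<lambda>x. of_real (g (cos (2 * pi * x - s))) * f x"]
    by (simp add: ring_distribs)
next
  case (mult g h)
  then show ?case by (simp add: mult.assoc)
qed (simp add: effective_cmult)

lemma effective_continuous_mult:
  assumes \<psi>: "continuous_on UNIV (\<psi> :: real \<Rightarrow> real)" and f: "effective f"
  shows "effective (\<lambda>x. of_real (\<psi> (cos (2 * pi * x - s))) * f x)"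
proof -
  let ?c = "\<lambda>x. cos (2 * pi * x - s)"
  have "\<exists>p. real_polynomial_function p \<and> (\<forall>x\<in>{-1..1}. \<bar>\<psi> x - p x\<bar> < 1 / real (Suc j))" for j
  proof -
    have "continuous_on {-1..1} \<psi>" using \<psi> continuous_on_subset by blast
    then obtain p where "real_polynomial_function p" "\<And>x. x \<in> {-1..1} \<Longrightarrow> \<bar>\<psi> x - p x\<bar> < 1 / real (Suc j)"
      using Stone_Weierstrass_real_polynomial_function[of "{-1..1::real}" \<psi> "1 / real (Suc j)"] by auto
    then show ?thesis by blast
  qed
  then obtain p where p: "\<And>j. real_polynomial_function (p j)"
    "\<And>j x. x \<in> {-1..1} \<Longrightarrow> \<bar>\<psi> x - p j x\<bar> < 1 / real (Suc j)" by metis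
  have "bounded (\<psi> ` {-1..1})"
    using \<psi> by (intro compact_imp_bounded compact_continuous_image) (auto intro: continuous_on_subset)
  then obtain B where "\<forall>y\<in>\<psi> ` {-1..1}. norm y \<le> B"
    unfolding bounded_iff by blast
  then have B: "\<And>x. x \<in> {-1..1} \<Longrightarrow> \<bar>\<psi> x\<bar> \<le> B" by simp
  have cont: "continuous_on UNIV (p j)" for j
    using continuous_real_polymonial_function[OF p(1)] by (simp add: continuous_at_imp_continuous_on)
  have [measurable]: "p j \<in> borel_measurable borel" "\<psi> \<in> borel_measurable borel" for j
    using cont \<psi> by (auto intro: borel_measurable_continuous_onI)
  show ?thesis
  proof (rule effective_limit_mult[where \<phi> = "\<lambda>j x. of_real (p j (?c x))" and B = "B + 1"])
    show "effective (\<lambda>x. of_real (p j (?c x)) * f x)" for j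
      by (rule effective_polynomial_mult[OF p(1) f])
    show "cmod (of_real (p j (?c x))) \<le> B + 1" for j x
    proof -
      have c: "?c x \<in> {-1..1}" by simp
      have "1 / real (Suc j) \<le> 1" by simp
      then show ?thesis using p(2)[OF c, of j] B[OF c] unfolding norm_of_real by linarith
    qed
    have "(\<lambda>j. p j (?c x)) \<longlonglongrightarrow> \<psi> (?c x)" for x
    proof -
      have "norm (p j (?c x) - \<psi> (?c x)) \<le> 1 / real (Suc j)" for j
        using p(2)[of "?c x" j] by simp
      then have "(\<lambda>j. p j (?c x) - \<psi> (?c x)) \<longlonglongrightarrow> 0"
        by (intro Lim_null_comparison[OF _ LIMSEQ_Suc[OF lim_1_over_n]]) auto
      then show ?thesis by (simp add: LIM_zero_iff)
    qed
    then show "AE x in M. (\<lambda>j. complex_of_real (p j (?c x))) \<longlonglongrightarrow> of_real (\<psi> (?c x))"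
      by (intro always_eventually allI tendsto_of_real)
  qed (use f in \<open>auto simp: effective_def\<close>)
qed

lemma effective_arc_mult:
  assumes f: "effective f"
  shows "effective (\<lambda>x. indicator {x. a < cos (2 * pi * x - s)} x * f x)"
proof -
  let ?c = "\<lambda>x. cos (2 * pi * x - s)"
  \<comment> \<open>For \<open>j > 0\<close> the ramps rise from 0 at \<open>a\<close> to 1 at
    \<open>a + 1 / j\<close>; they tend to the indicator of the open half-line, also at
    \<open>a\<close> itself.\<close>
  let ?\<psi> = "\<lambda>j y. min 1 (real j * max 0 (y - a))"
  show ?thesis
  proof (rule effective_limit_mult[where \<phi> = "\<lambda>j x. of_real (?\<psi> j (?c x))" and B = 1])
    show "effective (\<lambda>x. complex_of_real (?\<psi> j (?c x)) * f x)" for j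
      by (rule effective_continuous_mult[OF _ f]) (intro continuous_intros)
    have "(\<lambda>j. ?\<psi> j y) \<longlonglongrightarrow> indicator {a<..} y" for y :: real
    proof (cases "a < y")
      case True
      obtain j0 :: nat where j0: "1 / (y - a) \<le> real j0" using real_arch_simple by blast
      have "?\<psi> j y = 1" if "j \<ge> j0" for j
      proof -
        have "1 / (y - a) \<le> real j" using j0 that by simp
        then show ?thesis using True by (simp add: field_simps)
      qed
      then have "\<forall>\<^sub>F j in sequentially. ?\<psi> j y = indicator {a<..} y"
        using True by (auto simp: eventually_sequentially)
      then show ?thesis by (rule tendsto_eventually)
    qed simp
    then have "(\<lambda>j. complex_of_real (?\<psi> j (?c x))) \<longlonglongrightarrow> of_real (indicator {a<..} (?c x))" for x
      by (intro tendsto_of_real)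
    moreover have "of_real (indicator {a<..} (?c x)) = (indicator {x. a < ?c x} x :: complex)" for x
      by (simp add: indicator_def)
    ultimately show "AE x in M. (\<lambda>j. complex_of_real (?\<psi> j (?c x))) \<longlonglongrightarrow> indicator {x. a < ?c x} x"
      by (simp del: of_real_mult)
  qed (use f in \<open>auto simp: effective_def min_def\<close>)
qed

lemma AE_unit: "AE x in M. 0 \<le> x \<and> x < 1"
proof -
  have "AE x in M. x \<notin> UNIV - {0..<1}"
    by (rule AE_not_in) (use unit in \<open>simp add: null_sets_def\<close>)
  then show ?thesis by eventually_elim auto
qed

text \<open>Asking for multipliers, and not just for effective indicators, makes intersections come
  for free by multiplying twice. The family is therefore a sigma-algebra, and induction over the
  sets generated by half-lines suffices.\<close>

definition multiplier_sets :: "real set set" where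
  "multiplier_sets = {C \<in> sets borel. \<forall>f. effective f \<longrightarrow> effective (\<lambda>x. indicator C x * f x)}"

lemma lessThan_multiplier: "{..<t} \<in> multiplier_sets"
proof -
  have "effective (\<lambda>x. indicator {..<t} x * f x)" if f: "effective f" for f
  proof -
    note [measurable] = effective_measurable[OF f]
    consider "t \<le> 0" | "1 < t" | "0 < t" "t \<le> 1" by linarith
    then show ?thesis
    proof cases
      case 1
      have "AE x in M. indicator {..<t} x * f x = 0"
        using AE_unit by eventually_elim (use 1 in \<open>auto simp: indicator_def\<close>)
      then show ?thesis by (rule effective_null) measurable
    next
      case 2
      have "AE x in M. f x = indicator {..<t} x * f x"
        using AE_unit by eventually_elim (use 2 in \<open>auto simp: indicator_def\<close>)
      then show ?thesis by (rule effective_cong_AE[OF f]) measurable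
    next
      case 3
      let ?A = "\<lambda>t. {x. cos (pi * t) < cos (2 * pi * x - pi * t)}"
      \<comment> \<open>Inside the unit interval, removing \<open>?A 1\<close> leaves just the point
        0, which the open arc \<open>?A t\<close> lacks and the half-line contains.\<close>
      have "effective (\<lambda>x. f x - indicator (?A 1) x * f x + indicator (?A t) x * f x)"
        by (intro effective_add effective_diff effective_arc_mult f)
      then show ?thesis
      proof (rule effective_cong_AE)
        show "AE x in M. f x - indicator (?A 1) x * f x + indicator (?A t) x * f x = indicator {..<t} x * f x"
          using AE_unit
        proof eventually_elim
          case (elim x)
          have "x \<in> ?A 1 \<longleftrightarrow> 0 < x \<and> x < 1" "x \<in> ?A t \<longleftrightarrow> 0 < x \<and> x < t"
            using cos_arc_iff[of x 1] cos_arc_iff[of x t] elim 3 by simp_all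
          then show ?case using elim 3
            by (cases "x = 0"; cases "x < t") (auto simp: indicator_def simp del: mem_Collect_eq)
        qed
      qed measurable
    qed
  qed
  then show ?thesis by (simp add: multiplier_sets_def)
qed

lemma borel_multiplier: "sets borel \<subseteq> multiplier_sets"
proof
  fix C :: "real set" assume "C \<in> sets borel"
  then have "C \<in> sigma_sets UNIV (range lessThan)"
    by (simp add: borel_Iio)
  then show "C \<in> multiplier_sets"
  proof induction
    case (Basic C)
    then show ?case using lessThan_multiplier by auto
  next
    case Empty
    then show ?case by (auto simp: multiplier_sets_def intro!: effective_null)
  next
    case (Compl C)
    have "effective (\<lambda>x. indicator (UNIV - C) x * f x)" if f: "effective f" for f
    proof -
      have "indicator (UNIV - C) x * f x = f x - indicator C x * f x" for x
        by (simp add: indicator_def)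
      then show ?thesis using Compl f by (simp add: multiplier_sets_def effective_diff)
    qed
    moreover have "UNIV - C \<in> sets borel"
      using Compl by (intro sets.Diff) (auto simp: multiplier_sets_def)
    ultimately show ?case by (simp add: multiplier_sets_def)
  next
    case (Union C)
    have [measurable]: "C j \<in> sets borel" for j using Union by (simp add: multiplier_sets_def)
    have "effective (\<lambda>x. indicator (\<Union>j. C j) x * f x)" if f: "effective f" for f
    proof (rule effective_limit_mult[where \<phi> = "\<lambda>N. indicator (\<Union>j<N. C j)" and B = 1])
      show "effective (\<lambda>x. indicator (\<Union>j<N. C j) x * f x)" for N
      proof (induction N)
        case 0
        then show ?case by (auto intro!: effective_null)
      next
        case (Suc N)
        let ?D = "\<Union>j<N. C j"
        have eq: "indicator (\<Union>j<Suc N. C j) x * f x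
            = indicator ?D x * f x + indicator (C N) x * f x - indicator (C N) x * (indicator ?D x * f x)" for x
          by (auto simp: indicator_def less_Suc_eq)
        show ?case unfolding eq
          using Union Suc f by (intro effective_diff effective_add) (auto simp: multiplier_sets_def)
      qed
      have "(\<lambda>N. indicator (\<Union>j<N. C j) x :: complex) \<longlonglongrightarrow> indicator (\<Union>j. C j) x" for x
      proof (cases "x \<in> (\<Union>j. C j)")
        case True
        then obtain j0 where "x \<in> C j0" by auto
        then have "\<forall>\<^sub>F N in sequentially. indicator (\<Union>j<N. C j) x = (indicator (\<Union>j. C j) x :: complex)"
          using True unfolding eventually_sequentially by (intro exI[of _ "Suc j0"]) (auto simp: indicator_def)
        then show ?thesis by (rule tendsto_eventually)
      qed (auto simp: indicator_def)
      then show "AE x in M. (\<lambda>N. indicator (\<Union>j<N. C j) x :: complex) \<longlonglongrightarrow> indicator (\<Union>j. C j) x"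
        by simp
    qed (use f in \<open>auto simp: effective_def indicator_def\<close>)
    then show ?case by (simp add: multiplier_sets_def)
  qed
qed

lemma effective_L2:
  assumes f: "in_L2 M f"
  shows "effective f"
proof -
  have [measurable]: "f \<in> borel_measurable M" using f by (simp add: in_L2_def)
  obtain s where s: "\<And>j. simple_function M (s j)" "\<And>x. (\<lambda>j. s j x) \<longlonglongrightarrow> f x"
    "\<And>j x. cmod (s j x) \<le> 2 * cmod (f x)"
    using borel_measurable_implies_sequence_metric[of f M 0] by auto
  note [measurable] = borel_measurable_simple_function[OF s(1)]
  have se: "effective (s j)" for j
  proof -
    have fin: "finite (range (s j))" using simple_functionD(1)[OF s(1)] by simp
    have "s j -` {y} \<in> sets borel" for y
      using simple_functionD(2)[OF s(1), of j "{y}"] by simp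
    then have "s j -` {y} \<in> multiplier_sets" for y using borel_multiplier by blast
    then have "effective (\<lambda>x. indicator (s j -` {y}) x * 1)" for y
      using effective_one unfolding multiplier_sets_def by blast
    then have "effective (\<lambda>x. y * (indicator (s j -` {y}) x * 1))" for y
      by (rule effective_cmult)
    then have "effective (\<lambda>x. \<Sum>y\<in>range (s j). y * (indicator (s j -` {y}) x * 1))"
      by (intro effective_sum fin)
    moreover have "(\<Sum>y\<in>range (s j). y * (indicator (s j -` {y}) x * 1)) = s j x" for x
      using fin by (simp add: indicator_def if_distrib cong: if_cong)
    ultimately show ?thesis by simp
  qed
  show ?thesis
  proof (rule effective_limit[OF se f])
    show "(\<lambda>j. sq_norm M (\<lambda>x. f x - s j x)) \<longlonglongrightarrow> 0"
    \<comment> \<open>The 3 is 1 for \<open>f\<close> plus the 2 from the bound on the simple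
      functions.\<close>
    proof (rule sq_norm_dominated[OF in_L2_cmult[OF f, of 3]])
      show "AE x in M. cmod (f x - s j x) \<le> cmod (3 * f x)" for j
      proof (rule AE_I2)
        fix x show "cmod (f x - s j x) \<le> cmod (3 * f x)"
          using norm_triangle_ineq4[of "f x" "s j x"] s(3)[of j x] by (simp add: norm_mult)
      qed
      have "(\<lambda>j. f x - s j x) \<longlonglongrightarrow> f x - f x" for x by (intro tendsto_intros s(2))
      then show "AE x in M. (\<lambda>j. f x - s j x) \<longlonglongrightarrow> 0" by simp
    qed measurable
  qed
qed

end

text \<open>Kwapien and Mycielski's theorem that the exponentials are effective for singular measures.\<close>

theorem kaczmarz_singular:
  assumes "lebesgue_singular M" "emeasure M (UNIV - {0..<1}) = 0" "in_L2 M f"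
  shows "(\<lambda>N. sq_norm M ((twist M ^^ N) f)) \<longlonglongrightarrow> 0"
  using effective_L2[OF effective_wave_minus_1[OF assms(1,2)] assms(2,3)] by (simp add: effective_def)

end

section \<open>Disintegration over the second coordinate\<close>

text \<open>Meant for comparing densities. The test set is where the inequality fails; finiteness of
  the integral of \<open>g\<close> allows cancelling it.\<close>

lemma AE_le_if_nn_integral_le:
  assumes [measurable]: "f \<in> borel_measurable M" "g \<in> borel_measurable M"
    and fin: "(\<integral>\<^sup>+x. g x \<partial>M) < \<infinity>"
    and le: "\<And>B. B \<in> sets M \<Longrightarrow> (\<integral>\<^sup>+x. f x * indicator B x \<partial>M) \<le> (\<integral>\<^sup>+x. g x * indicator B x \<partial>M)"
  shows "AE x in M. f x \<le> (g x :: ennreal)"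
proof -
  define B where "B = {x \<in> space M. g x < f x}"
  have B[measurable]: "B \<in> sets M" unfolding B_def by measurable
  let ?d = "\<lambda>x. (f x - g x) * indicator B x"
  have finB: "(\<integral>\<^sup>+x. g x * indicator B x \<partial>M) < \<infinity>"
    using fin by (rule le_less_trans[rotated]) (auto intro!: nn_integral_mono simp: indicator_def)
  have "(\<integral>\<^sup>+x. g x * indicator B x \<partial>M) + (\<integral>\<^sup>+x. ?d x \<partial>M) = (\<integral>\<^sup>+x. g x * indicator B x + ?d x \<partial>M)"
    by (rule nn_integral_add[symmetric]) measurable
  also have "\<dots> = (\<integral>\<^sup>+x. f x * indicator B x \<partial>M)"
    by (intro nn_integral_cong)
      (auto simp: indicator_def B_def intro!: add_diff_inverse_ennreal less_imp_le)
  also have "\<dots> \<le> (\<integral>\<^sup>+x. g x * indicator B x \<partial>M) + 0" using le[OF B] by simp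
  finally have "(\<integral>\<^sup>+x. ?d x \<partial>M) = 0"
    using finB by (subst (asm) ennreal_add_left_cancel_le) (auto simp: top_unique)
  then have "AE x in M. ?d x = 0" by (subst (asm) nn_integral_0_iff_AE) auto
  then show ?thesis
    using AE_space
  proof eventually_elim
    case (elim x)
    then show ?case
      by (auto simp: B_def indicator_def diff_eq_0_iff_ennreal split: if_splits)
  qed
qed

text \<open>The set contains all negative \<open>u\<close> as well, because \<open>ennreal\<close>
  sends them to 0, but they carry no mass.\<close>

lemma emeasure_unit_lebesgue_le:
  assumes "c \<le> 1"
  shows "emeasure unit_lebesgue {u. ennreal u \<le> c} = c"
proof -
  obtain r where r: "c = ennreal r" "0 \<le> r" "r \<le> 1"
    using assms by (cases c) (auto simp: top_unique)
  have "emeasure unit_lebesgue {u. ennreal u \<le> c} = (\<integral>\<^sup>+u. indicator {u. ennreal u \<le> c} u \<partial>unit_lebesgue)"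
    by simp
  also have "\<dots> = (\<integral>\<^sup>+u. indicator {0..<1} u * indicator {u. ennreal u \<le> c} u \<partial>lborel)"
    by (rule nn_integral_unit_lebesgue) measurable
  also have "\<dots> = (\<integral>\<^sup>+u. indicator {0..r} u \<partial>lborel)"
  proof (rule nn_integral_cong_AE)
    show "AE u in lborel. indicator {0..<1} u * indicator {u. ennreal u \<le> c} u = (indicator {0..r} u :: ennreal)"
      using AE_lborel_singleton[of "1::real"] by eventually_elim (use r in \<open>auto simp: indicator_def\<close>)
  qed
  also have "\<dots> = c" using r by simp
  finally show ?thesis .
qed

text \<open>\<open>q k\<close> is the right end of the dyadic interval of length
  \<open>1 / 2 ^ k\<close> that contains \<open>t\<close>. The intervals are nested and half-open,
  so the ends decrease and stay strictly above \<open>t\<close>; they are rational, as the countable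
  set of levels in \<open>conditional_quantile\<close> demands.\<close>

lemma dyadic_approx_from_above:
  fixes t :: real
  assumes "0 \<le> t" "t < 1"
  defines "q \<equiv> \<lambda>k. (real_of_int \<lfloor>2 ^ k * t\<rfloor> + 1) / 2 ^ k"
  shows "decseq q" "q k \<in> \<rat> \<inter> {0..1}" "t < q k" "q \<longlonglongrightarrow> t"
proof -
  have le: "q (Suc k) \<le> q k" for k
  proof -
    have "\<lfloor>2 * (2 ^ k * t)\<rfloor> \<le> 2 * \<lfloor>2 ^ k * t\<rfloor> + 1" by linarith
    then have "real_of_int \<lfloor>2 ^ Suc k * t\<rfloor> + 1 \<le> 2 * (real_of_int \<lfloor>2 ^ k * t\<rfloor> + 1)"
      by (simp add: mult.assoc)
    then have "q (Suc k) \<le> 2 * (real_of_int \<lfloor>2 ^ k * t\<rfloor> + 1) / 2 ^ Suc k"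
      unfolding q_def by (intro divide_right_mono) auto
    also have "\<dots> = q k"
      unfolding q_def power_Suc by (rule mult_divide_mult_cancel_left) simp
    finally show ?thesis .
  qed
  then show "decseq q" by (rule decseq_SucI)
  show lt: "t < q k" for k
  proof -
    have "2 ^ k * t < real_of_int \<lfloor>2 ^ k * t\<rfloor> + 1" by linarith
    then show ?thesis by (simp add: q_def field_simps)
  qed
  have up: "q k \<le> t + (1 / 2) ^ k" for k
  proof -
    have "real_of_int \<lfloor>2 ^ k * t\<rfloor> + 1 \<le> 2 ^ k * t + 1" by linarith
    then show ?thesis by (simp add: q_def field_simps)
  qed
  show "q k \<in> \<rat> \<inter> {0..1}"
  proof -
    have "2 ^ k * t < 2 ^ k" using assms by simp
    then have "\<lfloor>2 ^ k * t\<rfloor> < 2 ^ k" by (simp add: floor_less_iff)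
    then have "real_of_int (\<lfloor>2 ^ k * t\<rfloor> + 1) \<le> real_of_int (2 ^ k)"
      by (simp only: of_int_le_iff)
    then have "q k \<le> 1" by (simp add: q_def)
    moreover have "q k \<in> \<rat>" unfolding q_def by auto
    ultimately show ?thesis using lt[of k] assms by auto
  qed
  show "q \<longlonglongrightarrow> t"
  proof (rule tendsto_sandwich[of "\<lambda>_. t" q sequentially "\<lambda>k. t + (1 / 2) ^ k"])
    have "(\<lambda>k. t + (1 / 2) ^ k) \<longlonglongrightarrow> t + 0" by (intro tendsto_intros LIMSEQ_power_zero) auto
    then show "(\<lambda>k. t + (1 / 2) ^ k) \<longlonglongrightarrow> t" by simp
  qed (auto intro!: always_eventually less_imp_le lt up)
qed

lemma projections_measurable:
  assumes "sets M = sets (borel :: (real \<times> real) measure)"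
  shows "fst \<in> borel_measurable M" "snd \<in> borel_measurable M"
  unfolding measurable_cong_sets[OF assms refl]
  by (intro borel_measurable_continuous_onI continuous_intros)+

text \<open>Half-lines in the first coordinate, because a quantile function is accessible through
  the events \<open>t < Q y u\<close>. For fixed \<open>B\<close> they determine a finite measure on
  the line, and so all rectangles over \<open>B\<close>.\<close>

lemma measure_eqI_rectangles:
  fixes M N :: "(real \<times> real) measure"
  assumes [measurable_cong]: "sets M = sets borel" "sets N = sets borel" and "finite_measure M"
    and eq: "\<And>t B. B \<in> sets borel \<Longrightarrow> emeasure M ({t<..} \<times> B) = emeasure N ({t<..} \<times> B)"
  shows "M = N"
proof -
  interpret M: finite_measure M by fact
  have sp: "space M = UNIV" "space N = UNIV" using assms(1,2) by (auto dest: sets_eq_imp_space_eq)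
  have slice: "emeasure M (A \<times> B) = emeasure N (A \<times> B)" if A: "A \<in> sets borel" and B[measurable]: "B \<in> sets borel" for A B
  proof -
    let ?s = "\<lambda>M. distr (density M (indicator (UNIV \<times> B))) borel fst"
    have UB: "UNIV \<times> B \<in> sets borel" by (intro borel_Times) auto
    have em: "emeasure (?s M') A = emeasure M' (A \<times> B)"
      if [measurable_cong]: "sets M' = sets borel" and A: "A \<in> sets borel" for M' :: "(real \<times> real) measure" and A
    proof -
      have "space M' = UNIV" using that(1) by (auto dest: sets_eq_imp_space_eq)
      moreover have "fst \<in> borel_measurable M'"
        by (rule projections_measurable(1)) fact
      moreover have "A \<times> UNIV \<in> sets M'" using A that(1) by (simp add: borel_Times)
      moreover have "(indicator (UNIV \<times> B) :: _ \<Rightarrow> ennreal) \<in> borel_measurable M'"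
        using UB that(1) by (intro borel_measurable_indicator) simp
      ultimately have "emeasure (?s M') A = (\<integral>\<^sup>+z. indicator (UNIV \<times> B) z * indicator (A \<times> UNIV) z \<partial>M')"
        using A by (simp add: emeasure_distr emeasure_density vimage_fst)
      also have "\<dots> = (\<integral>\<^sup>+z. indicator (A \<times> B) z \<partial>M')"
        by (intro nn_integral_cong) (auto simp: indicator_def)
      also have "\<dots> = emeasure M' (A \<times> B)"
        using A that(1) by (intro nn_integral_indicator) (simp add: borel_Times)
      finally show ?thesis .
    qed
    have "?s M = ?s N"
    proof (rule measure_eqI_lessThan)
      show "emeasure (?s M) {t<..} < \<infinity>" for t
        using M.emeasure_finite[of "{t<..} \<times> B"] by (simp add: em assms(1) flip: less_top)
      show "emeasure (?s M) {t<..} = emeasure (?s N) {t<..}" for t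
        using eq[OF B] by (simp add: em assms(1,2))
    qed auto
    then have "emeasure (?s M) A = emeasure (?s N) A" by (rule arg_cong)
    then show ?thesis unfolding em[OF assms(1) A] em[OF assms(2) A] .
  qed
  let ?E = "{A \<times> B |A B. A \<in> sets (borel :: real measure) \<and> B \<in> sets (borel :: real measure)}"
  have sE: "sets (borel :: (real \<times> real) measure) = sigma_sets UNIV ?E"
    unfolding borel_prod[symmetric] sets_pair_measure by simp
  show ?thesis
  proof (rule measure_eqI_generator_eq[where E = ?E and A = "\<lambda>_. UNIV"])
    show "Int_stable ?E" using Int_stable_pair_measure_generator[of borel borel] by simp
    show "emeasure M X = emeasure N X" if "X \<in> ?E" for X using that slice by auto
    have "UNIV \<times> UNIV \<in> ?E" by (intro CollectI exI[of _ UNIV]) simp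
    then show "range (\<lambda>_::nat. UNIV) \<subseteq> ?E" by simp
    show "sets M = sigma_sets UNIV ?E" "sets N = sigma_sets UNIV ?E"
      using assms(1,2) sE by (simp_all only:)
  qed simp_all
qed

lemma prob_space_y_marginal:
  assumes "prob_space \<mu>" "sets \<mu> = sets borel"
  shows "prob_space (y_marginal \<mu>)" "sets (y_marginal \<mu>) = sets borel"
proof -
  have "snd \<in> borel_measurable \<mu>"
    by (rule projections_measurable(2)) fact
  then show "prob_space (y_marginal \<mu>)"
    unfolding y_marginal_def by (intro prob_space.prob_space_distr assms(1))
qed (simp add: y_marginal_def)

text \<open>\<open>Q y\<close> is a quantile function of the conditional law of the first coordinate given that the
  second is \<open>y\<close>, so that a uniform \<open>u\<close> turns into a sample \<open>Q y u\<close> from this law.\<close>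

lemma conditional_quantile:
  fixes \<mu> :: "(real \<times> real) measure"
  assumes "prob_space \<mu>" and sets_\<mu>[measurable_cong]: "sets \<mu> = sets borel"
    and unit: "AE z in \<mu>. 0 \<le> fst z \<and> fst z \<le> 1"
  obtains Q :: "real \<Rightarrow> real \<Rightarrow> real"
  where "(\<lambda>(y, u). Q y u) \<in> borel_measurable (borel \<Otimes>\<^sub>M borel)" "\<And>y u. Q y u \<in> {0..1}"
    "\<mu> = distr (y_marginal \<mu> \<Otimes>\<^sub>M unit_lebesgue) borel (\<lambda>(y, u). (Q y u, y))"
proof -
  interpret \<mu>: prob_space \<mu> by fact
  define \<nu> where "\<nu> = y_marginal \<mu>"
  interpret \<nu>: prob_space \<nu> unfolding \<nu>_def by (rule prob_space_y_marginal) fact+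
  have sets_\<nu>[simp, measurable_cong]: "sets \<nu> = sets borel" by (simp add: \<nu>_def y_marginal_def)
  have sp_\<mu>[simp]: "space \<mu> = UNIV" using sets_\<mu> by (auto dest: sets_eq_imp_space_eq)
  have [measurable]: "fst \<in> borel_measurable \<mu>" "snd \<in> borel_measurable \<mu>"
    using projections_measurable[OF sets_\<mu>] by simp_all
  define N where "N q = distr (density \<mu> (indicator {z. q \<le> fst z})) borel snd" for q
  have [measurable]: "{z. q \<le> fst z} \<in> sets \<mu>" for q
    using measurable_sets[of fst \<mu> borel "{q..}"] by (simp add: vimage_def)
  have emN: "emeasure (N q) B = emeasure \<mu> {z. q \<le> fst z \<and> snd z \<in> B}" if "B \<in> sets borel" for q B
  proof -
    have m: "snd -` B \<in> sets \<mu>" using measurable_sets[of snd \<mu> borel B] that by simp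
    have "emeasure (N q) B = (\<integral>\<^sup>+z. indicator {z. q \<le> fst z} z * indicator (snd -` B) z \<partial>\<mu>)"
      using that m by (simp add: N_def emeasure_distr emeasure_density)
    also have "\<dots> = (\<integral>\<^sup>+z. indicator {z. q \<le> fst z \<and> snd z \<in> B} z \<partial>\<mu>)"
      by (intro nn_integral_cong) (auto simp: indicator_def)
    also have "{z :: real \<times> real. q \<le> fst z \<and> snd z \<in> B} = {z. q \<le> fst z} \<inter> snd -` B" by auto
    finally show ?thesis using m by (simp add: Collect_conj_eq vimage_def)
  qed
  have em\<nu>: "emeasure \<nu> B = emeasure \<mu> {z. snd z \<in> B}" if "B \<in> sets borel" for B
    using that by (simp add: \<nu>_def y_marginal_def emeasure_distr vimage_def)
  have mNB: "{z :: real \<times> real. q \<le> fst z \<and> snd z \<in> B} \<in> sets \<mu>" if "B \<in> sets borel" for q B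
    using that measurable_sets[of snd \<mu> borel B] by (simp add: Collect_conj_eq vimage_def sets.Int)
  have ac: "absolutely_continuous \<nu> (N q)" for q
    unfolding absolutely_continuous_def
  proof
    fix B assume "B \<in> null_sets \<nu>"
    then have B: "B \<in> sets borel" "emeasure \<nu> B = 0" by auto
    have "emeasure (N q) B \<le> emeasure \<nu> B"
      unfolding emN[OF B(1)] em\<nu>[OF B(1)]
      using measurable_sets[of snd \<mu> borel B] B by (intro emeasure_mono) (auto simp: vimage_def)
    then show "B \<in> null_sets (N q)" using B by (auto simp: N_def null_sets_def)
  qed
  \<comment> \<open>\<open>F q y\<close> is the conditional probability, given the second coordinate
    \<open>y\<close>, that the first is at least \<open>q\<close>.\<close>
  define F where "F q = RN_deriv \<nu> (N q)" for q
  have F[measurable]: "F q \<in> borel_measurable borel" for q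
    using borel_measurable_RN_deriv[of \<nu> "N q"] by (simp add: F_def cong: measurable_cong_sets)
  have intF: "(\<integral>\<^sup>+y. F q y * indicator B y \<partial>\<nu>) = emeasure \<mu> {z. q \<le> fst z \<and> snd z \<in> B}"
    if "B \<in> sets borel" for q B
  proof -
    have "density \<nu> (F q) = N q"
      unfolding F_def using \<nu>.density_RN_deriv[OF ac] by (simp add: N_def)
    then show ?thesis using emeasure_density[of "F q" \<nu> B] that emN[OF that] by simp
  qed
  have finF: "(\<integral>\<^sup>+y. F q y \<partial>\<nu>) < \<infinity>" for q
    using intF[of UNIV q] \<mu>.emeasure_finite by (simp flip: less_top)
  have mono: "AE y in \<nu>. F q' y \<le> F q y" if "q \<le> q'" for q q'
  proof (rule AE_le_if_nn_integral_le)
    show "(\<integral>\<^sup>+y. F q' y * indicator B y \<partial>\<nu>) \<le> (\<integral>\<^sup>+y. F q y * indicator B y \<partial>\<nu>)" if "B \<in> sets \<nu>" for B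
      using that mNB \<open>q \<le> q'\<close> by (auto simp: intF intro!: emeasure_mono)
  qed (use finF in auto)
  have le1: "AE y in \<nu>. F q y \<le> 1" for q
  proof (rule AE_le_if_nn_integral_le)
    show "(\<integral>\<^sup>+y. F q y * indicator B y \<partial>\<nu>) \<le> (\<integral>\<^sup>+y. 1 * indicator B y \<partial>\<nu>)" if "B \<in> sets \<nu>" for B
      using that measurable_sets[of snd \<mu> borel B] by (auto simp: intF em\<nu> vimage_def intro!: emeasure_mono)
  qed (use \<nu>.emeasure_space_1 in auto)
  \<comment> \<open>Every comparison between two levels holds only off a null set of its own, so
    only countably many levels may be used.\<close>
  define R where "R = \<rat> \<inter> {0..1::real}"
  have cR: "countable R" by (simp add: R_def countable_rat)
  have good: "AE y in \<nu>. \<forall>q\<in>R. F q y \<le> 1 \<and> (\<forall>q'\<in>R. q \<le> q' \<longrightarrow> F q' y \<le> F q y)"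
    using mono le1 cR by (auto simp: AE_ball_countable)
  \<comment> \<open>The forced element 0 keeps the set nonempty for every \<open>y\<close>, also for
    those where \<open>F\<close> fails to be monotone, so that \<open>Q\<close> always takes values
    in the unit interval.\<close>
  define S where "S y u = {q \<in> R. ennreal u \<le> F q y \<or> q = 0}" for y u
  define Q where "Q y u = Sup (S y u)" for y u
  have S0: "0 \<in> S y u" "bdd_above (S y u)" "S y u \<subseteq> {0..1}" for y u
    by (auto simp: S_def R_def intro!: bdd_aboveI[of _ 1])
  have Qgt: "t < Q y u \<longleftrightarrow> (\<exists>q\<in>R. t < q \<and> (ennreal u \<le> F q y \<or> q = 0))" for t y u
    unfolding Q_def using S0[of y u] by (subst less_cSup_iff) (auto simp: S_def)
  have Q01: "Q y u \<in> {0..1}" for y u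
    using S0[of y u] unfolding Q_def by (auto intro!: cSup_upper cSup_least)
  have Qm: "(\<lambda>(y, u). Q y u) \<in> borel_measurable (borel \<Otimes>\<^sub>M borel)"
  proof (rule borel_measurableI_greater)
    fix t
    have "{x \<in> space (borel \<Otimes>\<^sub>M borel). t < (case x of (y, u) \<Rightarrow> Q y u)}
        = (\<Union>q\<in>{q\<in>R. t < q}. {x \<in> space (borel \<Otimes>\<^sub>M borel). ennreal (snd x) \<le> F q (fst x) \<or> q = 0})"
      by (auto simp: Qgt)
    also have "\<dots> \<in> sets (borel \<Otimes>\<^sub>M borel)"
      by (rule sets.countable_UN') (use cR in \<open>auto intro: countable_subset\<close>)
    finally show "{x \<in> space (borel \<Otimes>\<^sub>M borel). t < (case x of (y, u) \<Rightarrow> Q y u)} \<in> sets (borel \<Otimes>\<^sub>M borel)" .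
  qed
  note [measurable] = Qm
  let ?T = "\<lambda>(y, u). (Q y u, y)"
  have Tm[measurable]: "?T \<in> \<nu> \<Otimes>\<^sub>M unit_lebesgue \<rightarrow>\<^sub>M borel"
    unfolding borel_prod[symmetric] by measurable
  have "\<mu> = distr (\<nu> \<Otimes>\<^sub>M unit_lebesgue) borel ?T"
  proof (rule measure_eqI_rectangles)
    show "sets \<mu> = sets borel" by fact
    show "finite_measure \<mu>" by unfold_locales
    fix t and B :: "real set" assume B[measurable]: "B \<in> sets borel"
    have eq: "{t<..} \<times> B = {z :: real \<times> real. t < fst z \<and> snd z \<in> B}" by auto
    have tB: "{z :: real \<times> real. t < fst z \<and> snd z \<in> B} \<in> sets \<mu>"
      unfolding eq[symmetric] sets_\<mu> by (intro borel_Times) auto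
    have mu': "emeasure (distr (\<nu> \<Otimes>\<^sub>M unit_lebesgue) borel ?T) ({t<..} \<times> B)
        = (\<integral>\<^sup>+y. emeasure unit_lebesgue {u. t < Q y u} * indicator B y \<partial>\<nu>)"
    proof -
      have "emeasure (distr (\<nu> \<Otimes>\<^sub>M unit_lebesgue) borel ?T) ({t<..} \<times> B)
          = emeasure (\<nu> \<Otimes>\<^sub>M unit_lebesgue) (?T -` ({t<..} \<times> B) \<inter> space (\<nu> \<Otimes>\<^sub>M unit_lebesgue))"
        by (rule emeasure_distr) (auto intro: borel_Times)
      also have "\<dots> = (\<integral>\<^sup>+y. \<integral>\<^sup>+u. indicator (?T -` ({t<..} \<times> B) \<inter> space (\<nu> \<Otimes>\<^sub>M unit_lebesgue)) (y, u) \<partial>unit_lebesgue \<partial>\<nu>)"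
        by (rule U.emeasure_pair_measure) (rule measurable_sets[OF Tm], auto intro: borel_Times)
      also have "\<dots> = (\<integral>\<^sup>+y. emeasure unit_lebesgue {u. t < Q y u} * indicator B y \<partial>\<nu>)"
      proof (rule nn_integral_cong)
        fix y assume "y \<in> space \<nu>"
        then have "indicator (?T -` ({t<..} \<times> B) \<inter> space (\<nu> \<Otimes>\<^sub>M unit_lebesgue)) (y, u)
            = (indicator {u. t < Q y u} u * indicator B y :: ennreal)" for u
          by (auto simp: indicator_def space_pair_measure)
        moreover have "{u. t < Q y u} \<in> sets unit_lebesgue" by measurable
        ultimately show "(\<integral>\<^sup>+u. indicator (?T -` ({t<..} \<times> B) \<inter> space (\<nu> \<Otimes>\<^sub>M unit_lebesgue)) (y, u) \<partial>unit_lebesgue)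
            = emeasure unit_lebesgue {u. t < Q y u} * indicator B y"
          by (simp add: nn_integral_multc)
      qed
      finally show ?thesis .
    qed
    consider "t < 0" | "0 \<le> t" "t < 1" | "1 \<le> t" by linarith
    then show "emeasure \<mu> ({t<..} \<times> B) = emeasure (distr (\<nu> \<Otimes>\<^sub>M unit_lebesgue) borel ?T) ({t<..} \<times> B)"
    proof cases
      case 1
      have "t < Q y u" for y u using Q01[of y u] 1 by auto
      then have "emeasure (distr (\<nu> \<Otimes>\<^sub>M unit_lebesgue) borel ?T) ({t<..} \<times> B) = emeasure \<nu> B"
        unfolding mu' using U.emeasure_space_1 by simp
      also have "\<dots> = emeasure \<mu> {z. snd z \<in> B}" by (rule em\<nu>[OF B])
      also have "\<dots> = emeasure \<mu> {z. t < fst z \<and> snd z \<in> B}"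
      proof (rule emeasure_eq_AE)
        show "AE z in \<mu>. z \<in> {z. snd z \<in> B} \<longleftrightarrow> z \<in> {z. t < fst z \<and> snd z \<in> B}"
          using unit by eventually_elim (use 1 in auto)
        show "{z. snd z \<in> B} \<in> sets \<mu>" using measurable_sets[of snd \<mu> borel B] by (simp add: vimage_def)
      qed (rule tB)
      finally show ?thesis by (simp add: eq)
    next
      case 3
      have "\<not> t < Q y u" for y u using Q01[of y u] 3 by auto
      then have "emeasure (distr (\<nu> \<Otimes>\<^sub>M unit_lebesgue) borel ?T) ({t<..} \<times> B) = 0"
        unfolding mu' by simp
      moreover have "AE z in \<mu>. z \<notin> {z. t < fst z \<and> snd z \<in> B}"
        using unit by eventually_elim (use 3 in auto)
      then have "emeasure \<mu> {z. t < fst z \<and> snd z \<in> B} = 0"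
        using tB by (subst (asm) AE_iff_null_sets[symmetric]) auto
      ultimately show ?thesis by (simp add: eq)
    next
      case 2
      define q where "q k = (real_of_int \<lfloor>2 ^ k * t\<rfloor> + 1) / 2 ^ k" for k
      note q = dyadic_approx_from_above[OF 2, folded q_def]
      have ex: "\<exists>k. q k \<le> x" if "t < x" for x
        using order_tendstoD(2)[OF q(4) that] by (auto simp: eventually_sequentially intro: less_imp_le)
      \<comment> \<open>As \<open>q k\<close> decreases to \<open>t\<close> strictly from above, the
        event that the first coordinate exceeds \<open>t\<close> is the increasing union of the
        events that it is at least \<open>q k\<close>; \<open>Q y u\<close> reproduces these
        probabilities for good \<open>y\<close>.\<close>
      have "emeasure unit_lebesgue {u. t < Q y u} = (SUP k. F (q k) y)"
        if y: "\<forall>q\<in>R. F q y \<le> 1 \<and> (\<forall>q'\<in>R. q \<le> q' \<longrightarrow> F q' y \<le> F q y)" for y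
      proof -
        have "{u. t < Q y u} = (\<Union>k. {u. ennreal u \<le> F (q k) y})"
        proof (intro equalityI subsetI)
          fix u assume "u \<in> {u. t < Q y u}"
          then obtain r where r: "r \<in> R" "t < r" "ennreal u \<le> F r y \<or> r = 0" by (auto simp: Qgt)
          then have "ennreal u \<le> F r y" using 2 by auto
          moreover obtain k where "q k \<le> r" using ex[OF r(2)] by auto
          then have "F r y \<le> F (q k) y" using y r(1) q(2)[of k] by (auto simp: R_def)
          ultimately show "u \<in> (\<Union>k. {u. ennreal u \<le> F (q k) y})" by (auto intro: order_trans)
        next
          fix u assume "u \<in> (\<Union>k. {u. ennreal u \<le> F (q k) y})"
          then obtain k where "ennreal u \<le> F (q k) y" by auto
          then show "u \<in> {u. t < Q y u}"
            using q(2,3)[of k] by (auto simp: Qgt R_def intro!: bexI[of _ "q k"])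
        qed
        also have "emeasure unit_lebesgue \<dots> = (SUP k. emeasure unit_lebesgue {u. ennreal u \<le> F (q k) y})"
        proof (rule SUP_emeasure_incseq[symmetric])
          have "F (q k) y \<le> F (q (Suc k)) y" for k
            using y q(2)[of k] q(2)[of "Suc k"] decseq_SucD[OF q(1), of k] by (auto simp: R_def)
          then show "incseq (\<lambda>k. {u. ennreal u \<le> F (q k) y})"
            by (intro incseq_SucI) (auto intro: order_trans)
        qed auto
        also have "\<dots> = (SUP k. F (q k) y)"
          using y q(2) by (intro SUP_cong refl emeasure_unit_lebesgue_le) (auto simp: R_def)
        finally show ?thesis .
      qed
      then have "AE y in \<nu>. emeasure unit_lebesgue {u. t < Q y u} * indicator B y = (SUP k. F (q k) y * indicator B y)"
        using good by (auto simp: SUP_mult_right_ennreal elim!: eventually_mono)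
      then have "emeasure (distr (\<nu> \<Otimes>\<^sub>M unit_lebesgue) borel ?T) ({t<..} \<times> B)
          = (\<integral>\<^sup>+y. (SUP k. F (q k) y * indicator B y) \<partial>\<nu>)"
        unfolding mu' by (rule nn_integral_cong_AE)
      also have "\<dots> = (SUP k. \<integral>\<^sup>+y. F (q k) y * indicator B y \<partial>\<nu>)"
      proof (rule nn_integral_monotone_convergence_SUP_AE)
        show "AE y in \<nu>. F (q k) y * indicator B y \<le> F (q (Suc k)) y * indicator B y" for k
          using mono[OF decseq_SucD[OF q(1), of k]] by eventually_elim (auto intro: mult_right_mono)
      qed auto
      also have "\<dots> = (SUP k. emeasure \<mu> {z. q k \<le> fst z \<and> snd z \<in> B})" by (simp add: intF)
      also have "\<dots> = emeasure \<mu> (\<Union>k. {z. q k \<le> fst z \<and> snd z \<in> B})"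
      proof (rule SUP_emeasure_incseq)
        show "incseq (\<lambda>k. {z :: real \<times> real. q k \<le> fst z \<and> snd z \<in> B})"
          using q(1) by (auto simp: incseq_def decseq_def intro: order_trans)
      qed (use mNB in auto)
      also have "(\<Union>k. {z :: real \<times> real. q k \<le> fst z \<and> snd z \<in> B}) = {z. t < fst z \<and> snd z \<in> B}"
        using q(3) ex by (auto intro: less_le_trans)
      finally show ?thesis by (simp add: eq)
    qed
  qed simp
  then show thesis using that[OF Qm Q01] by (simp add: \<nu>_def)
qed

section \<open>Slices as images of the uniform law\<close>

locale disintegrated =
  fixes \<mu> :: "(real \<times> real) measure" and Q :: "real \<Rightarrow> real \<Rightarrow> real"
  assumes prob_\<mu>: "prob_space \<mu>" and sets_\<mu>: "sets \<mu> = sets borel"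
    and measurable_Q [measurable]: "(\<lambda>(y, u). Q y u) \<in> borel_measurable (borel \<Otimes>\<^sub>M borel)"
    and Q_unit: "\<And>y u. Q y u \<in> {0..1}"
    and \<mu>_eq_distr: "\<mu> = distr (y_marginal \<mu> \<Otimes>\<^sub>M unit_lebesgue) borel (\<lambda>(y, u). (Q y u, y))"
begin

abbreviation "\<nu> \<equiv> y_marginal \<mu>"

text \<open>As an image of the fixed measure \<open>unit_lebesgue\<close>, the kernel inherits
  measurability and Fubini from the product
  \<open>\<nu> \<Otimes>\<^sub>M unit_lebesgue\<close>.\<close>

definition \<rho> :: "real \<Rightarrow> real measure" where
  "\<rho> y = distr unit_lebesgue borel (Q y)"

lemma measurable_Q_slice [measurable]: "Q y \<in> borel_measurable borel"
  by measurable

lemma sets_\<nu> [simp, measurable_cong]: "sets \<nu> = sets borel"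
  by (simp add: y_marginal_def)

sublocale \<nu>: real_distribution \<nu>
  by (intro real_distribution.intro real_distribution_axioms.intro prob_space_y_marginal prob_\<mu> sets_\<mu>)

sublocale \<rho>: real_distribution "\<rho> y" for y
  unfolding \<rho>_def
  by (intro real_distribution.intro real_distribution_axioms.intro U.prob_space_distr) auto

sublocale P: pair_prob_space \<nu> unit_lebesgue ..

lemma measurable_sample [measurable]:
  "(\<lambda>(y, u). (Q y u, y)) \<in> \<nu> \<Otimes>\<^sub>M unit_lebesgue \<rightarrow>\<^sub>M borel"
  unfolding borel_prod[symmetric] by measurable

lemma unit_kernel_\<rho>: "unit_kernel \<rho>"
  unfolding unit_kernel_def
proof
  have "(\<lambda>_. unit_lebesgue) \<in> borel \<rightarrow>\<^sub>M prob_algebra borel"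
    by (intro measurable_const) (simp add: space_prob_algebra U.prob_space_axioms)
  then show "\<rho> \<in> borel \<rightarrow>\<^sub>M prob_algebra borel"
    unfolding \<rho>_def[abs_def] by (rule measurable_distr_prob_space2) simp
  have "Q t -` (UNIV - {0..1}) = {}" for t using Q_unit by auto
  then show "\<forall>t. emeasure (\<rho> t) (UNIV - {0..1}) = 0"
    unfolding \<rho>_def by (simp add: emeasure_distr)
qed

lemma AE_slice:
  assumes "E \<in> sets borel" "AE z in \<mu>. z \<in> E"
  shows "AE y in \<nu>. AE x in \<rho> y. (x, y) \<in> E"
proof -
  have "AE p in \<nu> \<Otimes>\<^sub>M unit_lebesgue. (case p of (y, u) \<Rightarrow> (Q y u, y)) \<in> E"
    using assms(2) by (subst (asm) \<mu>_eq_distr) (rule AE_distrD[OF measurable_sample])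
  then have "AE y in \<nu>. AE u in unit_lebesgue. (case (y, u) of (y, u) \<Rightarrow> (Q y u, y)) \<in> E"
    by (rule P.AE_pair)
  then show ?thesis
  proof eventually_elim
    case (elim y)
    have "{x. (x, y) \<in> E} = (\<lambda>x. (x, y)) -` E" by auto
    moreover have "(\<lambda>x. (x, y)) \<in> borel \<rightarrow>\<^sub>M borel"
      by (intro borel_measurable_continuous_onI continuous_intros)
    from measurable_sets[OF this assms(1)] have "(\<lambda>x. (x, y)) -` E \<in> sets borel" by simp
    ultimately show ?case
      using elim unfolding \<rho>_def by (subst AE_distr_iff) auto
  qed
qed

lemma measurable_slice:
  assumes "f \<in> borel_measurable borel"
  shows "(\<lambda>x. f (x, y)) \<in> borel_measurable borel"
proof -
  have "(\<lambda>x. (x, y)) \<in> borel \<rightarrow>\<^sub>M borel"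
    by (intro borel_measurable_continuous_onI continuous_intros)
  from measurable_compose[OF this assms] show ?thesis .
qed

context
  fixes f :: "real \<times> real \<Rightarrow> 'a :: {banach, second_countable_topology}"
  assumes f: "integrable \<mu> f"
begin

lemma measurable_integrand: "f \<in> borel_measurable borel"
  using borel_measurable_integrable[OF f] by (simp add: measurable_cong_sets[OF sets_\<mu> refl])

lemma integrable_sample:
  "integrable (\<nu> \<Otimes>\<^sub>M unit_lebesgue) (\<lambda>(y, u). f (Q y u, y))"
proof -
  have "integrable (\<nu> \<Otimes>\<^sub>M unit_lebesgue) (\<lambda>p. f (case p of (y, u) \<Rightarrow> (Q y u, y)))"
    using f by (subst (asm) \<mu>_eq_distr) (rule integrable_distr[OF measurable_sample])
  then show ?thesis by (simp add: split_beta')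
qed

lemma AE_integrable_slice: "AE y in \<nu>. integrable (\<rho> y) (\<lambda>x. f (x, y))"
  using P.AE_integrable_fst[OF integrable_sample]
  by eventually_elim
    (simp add: \<rho>_def integrable_distr_eq measurable_slice[OF measurable_integrand])

lemma integrable_integral_slice: "integrable \<nu> (\<lambda>y. \<integral>x. f (x, y) \<partial>\<rho> y)"
  using P.integrable_fst[OF integrable_sample]
  by (simp add: \<rho>_def integral_distr measurable_slice[OF measurable_integrand])

lemma integral_slice: "(\<integral>z. f z \<partial>\<mu>) = (\<integral>y. (\<integral>x. f (x, y) \<partial>\<rho> y) \<partial>\<nu>)"
proof -
  have "(\<integral>z. f z \<partial>\<mu>) = (\<integral>p. f (case p of (y, u) \<Rightarrow> (Q y u, y)) \<partial>(\<nu> \<Otimes>\<^sub>M unit_lebesgue))"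
    by (subst \<mu>_eq_distr) (rule integral_distr[OF measurable_sample measurable_integrand])
  also have "\<dots> = (\<integral>(y, u). f (Q y u, y) \<partial>(\<nu> \<Otimes>\<^sub>M unit_lebesgue))"
    by (simp add: split_beta')
  also have "\<dots> = (\<integral>y. (\<integral>u. f (Q y u, y) \<partial>unit_lebesgue) \<partial>\<nu>)"
    by (rule P.integral_fst[OF integrable_sample, symmetric])
  also have "\<dots> = (\<integral>y. (\<integral>x. f (x, y) \<partial>\<rho> y) \<partial>\<nu>)"
    by (simp add: \<rho>_def integral_distr measurable_slice[OF measurable_integrand])
  finally show ?thesis .
qed

end

lemma y_disintegration_\<rho>: "y_disintegration \<mu> \<rho>"
  unfolding y_disintegration_def using unit_kernel_\<rho> integral_slice by blast

lemma measurable_integral_slice: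
  fixes g :: "real \<Rightarrow> real \<Rightarrow> complex"
  assumes [measurable]: "(\<lambda>(y, x). g y x) \<in> borel_measurable (borel \<Otimes>\<^sub>M borel)"
  shows "(\<lambda>y. \<integral>x. g y x \<partial>\<rho> y) \<in> borel_measurable borel"
proof -
  have "(\<lambda>y. \<integral>u. g y (Q y u) \<partial>unit_lebesgue) \<in> borel_measurable borel"
    by measurable
  moreover have "(\<integral>x. g y x \<partial>\<rho> y) = (\<integral>u. g y (Q y u) \<partial>unit_lebesgue)" for y
    unfolding \<rho>_def by (rule integral_distr) measurable
  ultimately show ?thesis by simp
qed

end

section \<open>Self-affine measures and their digits\<close>

text \<open>Invariance is required for all nonnegative Borel functions, since it will be applied to
  indicators of edges and to functions of digits, which are not continuous.\<close>

definition self_affine :: "nat \<Rightarrow> nat \<Rightarrow> (nat \<Rightarrow> nat \<Rightarrow> real) \<Rightarrow> (real \<times> real) measure \<Rightarrow> bool" where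
  "self_affine n m p \<mu> \<longleftrightarrow> prob_space \<mu> \<and> sets \<mu> = sets borel \<and>
     (AE z in \<mu>. z \<in> {0..1} \<times> {0..1}) \<and>
     (\<forall>h \<in> borel_measurable borel.
        (\<integral>\<^sup>+z. h z \<partial>\<mu>) = (\<Sum>i<n. \<Sum>j<m. ennreal (p i j) * (\<integral>\<^sup>+z. h (grid_map n m i j z) \<partial>\<mu>)))"

lemma self_affineD:
  assumes "self_affine n m p \<mu>"
  shows "prob_space \<mu>" "sets \<mu> = sets borel" "AE z in \<mu>. z \<in> {0..1} \<times> {0..1}"
    "h \<in> borel_measurable borel \<Longrightarrow>
      (\<integral>\<^sup>+z. h z \<partial>\<mu>) = (\<Sum>i<n. \<Sum>j<m. ennreal (p i j) * (\<integral>\<^sup>+z. h (grid_map n m i j z) \<partial>\<mu>))"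
  using assms by (auto simp: self_affine_def)

section \<open>From continuous to Borel test functions\<close>

lemma continuous_grid_map: "continuous_on A (grid_map n m i j)"
  unfolding grid_map_def split_beta' divide_inverse by (intro continuous_intros)

lemma measurable_grid_map [measurable]: "grid_map n m i j \<in> borel \<rightarrow>\<^sub>M borel"
  by (intro borel_measurable_continuous_onI continuous_grid_map)

text \<open>The indicator of \<open>U\<close> is the increasing limit of the continuous functions
  \<open>min 1 (k * dist)\<close>, with the distance to the complement.\<close>

lemma invariant_measure_open:
  assumes inv: "invariant_measure n m p \<mu>" and U: "open U"
    and p1: "(\<Sum>i<n. \<Sum>j<m. p i j) = 1"
  shows "measure \<mu> U = (\<Sum>i<n. \<Sum>j<m. p i j * measure \<mu> (grid_map n m i j -` U))"
proof -
  interpret prob_space \<mu> using inv by (simp add: invariant_measure_def)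
  have sets_\<mu>[measurable_cong]: "sets \<mu> = sets borel" using inv by (simp add: invariant_measure_def)
  have sp: "space \<mu> = UNIV" using sets_\<mu> by (auto dest: sets_eq_imp_space_eq)
  show ?thesis
  \<comment> \<open>\<open>infdist\<close> to the empty set is 0 by convention, so the approximation
    would give 0 on the whole plane; there the total weight 1 decides.\<close>
  proof (cases "U = UNIV")
    case True
    then show ?thesis using p1 prob_space by (simp add: sp)
  next
    case False
    let ?f = "\<lambda>k z. min 1 (real k * infdist z (- U))"
    have cont: "continuous_on UNIV (?f k)" for k
      by (intro continuous_intros)
    have [measurable]: "?f k \<in> borel_measurable borel" for k
      by (intro borel_measurable_continuous_onI cont)
    have lim: "(\<lambda>k. ?f k z) \<longlonglongrightarrow> indicator U z" for z
    proof (cases "z \<in> U")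
      case True
      then have "infdist z (- U) \<noteq> 0"
        using in_closed_iff_infdist_zero[of "- U" z] U False by auto
      then have pos: "infdist z (- U) > 0" using infdist_nonneg[of z "- U"] by linarith
      obtain k0 :: nat where k0: "1 / infdist z (- U) \<le> real k0" using real_arch_simple by blast
      have "?f k z = 1" if "k \<ge> k0" for k
      proof -
        have "1 / infdist z (- U) \<le> real k" using k0 that by simp
        then show ?thesis using pos by (simp add: field_simps)
      qed
      then show ?thesis
        using True by (intro tendsto_eventually) (auto simp: eventually_sequentially)
    qed simp
    have dom: "(\<lambda>k. \<integral>z. ?f k (T z) \<partial>\<mu>) \<longlonglongrightarrow> measure \<mu> (T -` U)"
      if [measurable]: "T \<in> borel \<rightarrow>\<^sub>M borel" for T
    proof -
      have "T -` U \<in> sets borel" using measurable_sets[OF that, of U] U by simp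
      then have TU: "T -` U \<in> sets \<mu>" by (simp add: sets_\<mu>)
      have "(\<lambda>k. \<integral>z. ?f k (T z) \<partial>\<mu>) \<longlonglongrightarrow> (\<integral>z. indicator (T -` U) z \<partial>\<mu>)"
      proof (rule integral_dominated_convergence[where w = "\<lambda>_. 1"])
        show "AE z in \<mu>. (\<lambda>k. ?f k (T z)) \<longlonglongrightarrow> indicator (T -` U) z"
          using lim by (auto simp: indicator_def)
        show "AE z in \<mu>. norm (?f k (T z)) \<le> 1" for k
          by (auto simp: min_def infdist_nonneg)
        show "indicator (T -` U) \<in> borel_measurable \<mu>"
          using TU by (rule borel_measurable_indicator)
      qed auto
      then show ?thesis using TU by simp
    qed
    have "(\<lambda>k. \<integral>z. ?f k z \<partial>\<mu>) \<longlonglongrightarrow> measure \<mu> U"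
      using dom[of "\<lambda>z. z"] by simp
    moreover have "(\<integral>z. f z \<partial>\<mu>) = (\<Sum>i<n. \<Sum>j<m. p i j * (\<integral>z. f (grid_map n m i j z) \<partial>\<mu>))"
      if "continuous_on UNIV f" for f :: "real \<times> real \<Rightarrow> real"
      using inv that unfolding invariant_measure_def by (elim conjE allE[where x = f]) (erule mp)
    from this[OF cont] have "(\<lambda>k. \<integral>z. ?f k z \<partial>\<mu>) = (\<lambda>k. \<Sum>i<n. \<Sum>j<m. p i j * (\<integral>z. ?f k (grid_map n m i j z) \<partial>\<mu>))"
      by (rule ext)
    moreover have "(\<lambda>k. \<Sum>i<n. \<Sum>j<m. p i j * (\<integral>z. ?f k (grid_map n m i j z) \<partial>\<mu>))
        \<longlonglongrightarrow> (\<Sum>i<n. \<Sum>j<m. p i j * measure \<mu> (grid_map n m i j -` U))"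
      by (intro tendsto_intros dom measurable_grid_map)
    ultimately show ?thesis by (simp only: LIMSEQ_unique)
  qed
qed

lemma double_sum_ennreal:
  assumes "\<And>i j. i < n \<Longrightarrow> j < m \<Longrightarrow> (f i j :: real) \<ge> 0"
  shows "(\<Sum>i<n. \<Sum>j<m. ennreal (f i j)) = ennreal (\<Sum>i<n. \<Sum>j<m. f i j)"
proof -
  have "(\<Sum>i<n. \<Sum>j<m. ennreal (f i j)) = (\<Sum>i<n. ennreal (\<Sum>j<m. f i j))"
    using assms by (intro sum.cong refl sum_ennreal) auto
  also have "\<dots> = ennreal (\<Sum>i<n. \<Sum>j<m. f i j)"
    using assms by (intro sum_ennreal sum_nonneg) auto
  finally show ?thesis .
qed

text \<open>The right-hand side is itself integration against a measure \<open>\<mu>'\<close>, the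
  law of \<open>grid_map\<close> for a random cell and an independent
  \<open>\<mu>\<close>-distributed point. The two measures agree on the intersection-stable family
  of open sets, hence everywhere.\<close>

lemma invariant_measure_self_affine:
  assumes inv: "invariant_measure n m p \<mu>"
    and p: "\<And>i j. i < n \<Longrightarrow> j < m \<Longrightarrow> p i j \<ge> 0" and p1: "(\<Sum>i<n. \<Sum>j<m. p i j) = 1"
  shows "self_affine n m p \<mu>"
proof -
  interpret prob_space \<mu> using inv by (simp add: invariant_measure_def)
  have sets_\<mu>[measurable_cong]: "sets \<mu> = sets borel" using inv by (simp add: invariant_measure_def)
  have sp: "space \<mu> = UNIV" using sets_\<mu> by (auto dest: sets_eq_imp_space_eq)
  let ?C = "{..<n} \<times> {..<m}"
  define P where "P = point_measure ?C (\<lambda>c. ennreal (p (fst c) (snd c)))"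
  let ?T = "\<lambda>(c, z). grid_map n m (fst c) (snd c) z"
  have spP: "space P = ?C" and setsP: "sets P = Pow ?C" by (simp_all add: P_def space_point_measure sets_point_measure)
  have T: "?T \<in> P \<Otimes>\<^sub>M \<mu> \<rightarrow>\<^sub>M borel"
  proof -
    have "sets (P \<Otimes>\<^sub>M \<mu>) = sets (count_space ?C \<Otimes>\<^sub>M \<mu>)"
      by (intro sets_pair_measure_cong) (simp_all add: setsP)
    moreover have "?T \<in> count_space ?C \<Otimes>\<^sub>M \<mu> \<rightarrow>\<^sub>M borel"
      by (rule measurable_pair_measure_countable1) (auto simp: countable_finite)
    ultimately show ?thesis by (simp cong: measurable_cong_sets)
  qed
  define \<mu>' where "\<mu>' = distr (P \<Otimes>\<^sub>M \<mu>) borel ?T"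
  have nn: "(\<integral>\<^sup>+z. h z \<partial>\<mu>') = (\<Sum>i<n. \<Sum>j<m. ennreal (p i j) * (\<integral>\<^sup>+z. h (grid_map n m i j z) \<partial>\<mu>))"
    if h: "h \<in> borel_measurable borel" for h
  proof -
    have "(\<integral>\<^sup>+z. h z \<partial>\<mu>') = (\<integral>\<^sup>+x. h (?T x) \<partial>(P \<Otimes>\<^sub>M \<mu>))"
      unfolding \<mu>'_def by (rule nn_integral_distr[OF T]) (simp add: h)
    also have "\<dots> = (\<integral>\<^sup>+c. \<integral>\<^sup>+z. h (?T (c, z)) \<partial>\<mu> \<partial>P)"
      by (rule nn_integral_fst[symmetric]) (rule measurable_compose[OF T h])
    also have "\<dots> = (\<Sum>c\<in>?C. ennreal (p (fst c) (snd c)) * (\<integral>\<^sup>+z. h (grid_map n m (fst c) (snd c) z) \<partial>\<mu>))"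
      unfolding P_def by (subst nn_integral_point_measure_finite) auto
    finally show ?thesis by (simp add: sum.cartesian_product split_beta')
  qed
  have "\<mu> = \<mu>'"
  proof (rule measure_eqI_generator_eq[where E = "{S. open S}" and \<Omega> = UNIV and A = "\<lambda>_. UNIV"])
    show "sets \<mu> = sigma_sets UNIV {S. open S}" "sets \<mu>' = sigma_sets UNIV {S. open S}"
      by (simp_all add: sets_\<mu> \<mu>'_def sets_borel)
    fix U :: "(real \<times> real) set" assume "U \<in> {S. open S}"
    then have U: "open U" "U \<in> sets borel" by auto
    have m: "grid_map n m i j -` U \<in> sets \<mu>" for i j
      using measurable_sets[OF measurable_grid_map U(2)] by (simp add: sets_\<mu>)
    have "emeasure \<mu>' U = (\<integral>\<^sup>+z. indicator U z \<partial>\<mu>')"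
      using U by (simp add: \<mu>'_def)
    also have "\<dots> = (\<Sum>i<n. \<Sum>j<m. ennreal (p i j) * (\<integral>\<^sup>+z. indicator U (grid_map n m i j z) \<partial>\<mu>))"
      using U by (intro nn) auto
    also have "\<dots> = (\<Sum>i<n. \<Sum>j<m. ennreal (p i j * measure \<mu> (grid_map n m i j -` U)))"
    proof (intro sum.cong refl)
      fix i j assume ij: "i \<in> {..<n}" "j \<in> {..<m}"
      have "(\<integral>\<^sup>+z. indicator U (grid_map n m i j z) \<partial>\<mu>) = (\<integral>\<^sup>+z. indicator (grid_map n m i j -` U) z \<partial>\<mu>)"
        by (intro nn_integral_cong) (simp add: indicator_def)
      then show "ennreal (p i j) * (\<integral>\<^sup>+z. indicator U (grid_map n m i j z) \<partial>\<mu>)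
          = ennreal (p i j * measure \<mu> (grid_map n m i j -` U))"
        using m ij p by (simp add: emeasure_eq_measure ennreal_mult)
    qed
    also have "\<dots> = ennreal (\<Sum>i<n. \<Sum>j<m. p i j * measure \<mu> (grid_map n m i j -` U))"
      using p by (intro double_sum_ennreal) simp
    also have "\<dots> = emeasure \<mu> U"
      using invariant_measure_open[OF inv U(1) p1] by (simp add: emeasure_eq_measure)
    finally show "emeasure \<mu> U = emeasure \<mu>' U" ..
  qed (auto simp: Int_stable_def)
  moreover have "AE z in \<mu>. z \<notin> UNIV - {0..1} \<times> {0..1}"
  proof (rule AE_not_in)
    have "{0..1} \<times> {0..1} \<in> sets (borel :: (real \<times> real) measure)" by (intro borel_Times) auto
    then show "UNIV - {0..1} \<times> {0..1} \<in> null_sets \<mu>"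
      using inv by (auto simp: invariant_measure_def null_sets_def)
  qed
  then have "AE z in \<mu>. z \<in> {0..1} \<times> {0..1}" by eventually_elim simp
  ultimately show ?thesis
    unfolding self_affine_def using nn sets_\<mu> prob_space_axioms by auto
qed

section \<open>Exchange of the coordinates and null edges\<close>

lemma measurable_swap_borel: "prod.swap \<in> (borel :: (real \<times> real) measure) \<rightarrow>\<^sub>M borel"
  unfolding prod.swap_def by (intro borel_measurable_continuous_onI continuous_intros)

text \<open>Through this exchange the upper edge reduces to the right edge, and the statement on
  columns to the one on rows.\<close>

lemma self_affine_swap:
  assumes "self_affine n m p \<mu>"
  shows "self_affine m n (\<lambda>i j. p j i) (distr \<mu> borel prod.swap)"
proof -
  note \<mu> = self_affineD[OF assms]
  have swap: "prod.swap \<in> \<mu> \<rightarrow>\<^sub>M borel"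
    using measurable_swap_borel by (simp cong: measurable_cong_sets add: \<mu>(2))
  have "prob_space (distr \<mu> borel prod.swap)"
    by (rule prob_space.prob_space_distr[OF \<mu>(1) swap])
  moreover have "AE z in distr \<mu> borel prod.swap. z \<in> {0..1} \<times> {0..1}"
  proof (subst AE_distr_iff[OF swap])
    have "{0..1} \<times> {0..1} \<in> sets (borel :: (real \<times> real) measure)" by (intro borel_Times) auto
    then show "{x \<in> space borel. x \<in> {0..1::real} \<times> {0..1::real}} \<in> sets borel" by simp
    show "AE x in \<mu>. prod.swap x \<in> {0..1} \<times> {0..1}"
      using \<mu>(3) by eventually_elim auto
  qed
  moreover have "(\<integral>\<^sup>+z. h z \<partial>distr \<mu> borel prod.swap)
      = (\<Sum>i<m. \<Sum>j<n. ennreal (p j i) * (\<integral>\<^sup>+z. h (grid_map m n i j z) \<partial>distr \<mu> borel prod.swap))"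
    if h: "h \<in> borel_measurable borel" for h
  proof -
    have "(\<integral>\<^sup>+z. h z \<partial>distr \<mu> borel prod.swap) = (\<integral>\<^sup>+z. h (prod.swap z) \<partial>\<mu>)"
      by (rule nn_integral_distr[OF swap]) (simp add: h)
    also have "\<dots> = (\<Sum>i<n. \<Sum>j<m. ennreal (p i j) * (\<integral>\<^sup>+z. h (prod.swap (grid_map n m i j z)) \<partial>\<mu>))"
      by (rule \<mu>(4)) (rule measurable_compose[OF measurable_swap_borel h])
    also have "\<dots> = (\<Sum>j<m. \<Sum>i<n. ennreal (p i j) * (\<integral>\<^sup>+z. h (prod.swap (grid_map n m i j z)) \<partial>\<mu>))"
      by (rule sum.swap)
    also have "\<dots> = (\<Sum>j<m. \<Sum>i<n. ennreal (p i j) * (\<integral>\<^sup>+z. h (grid_map m n j i z) \<partial>distr \<mu> borel prod.swap))"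
    proof (intro sum.cong refl arg_cong2[where f = "(*)"])
      fix i j
      have "(\<integral>\<^sup>+z. h (grid_map m n j i z) \<partial>distr \<mu> borel prod.swap) = (\<integral>\<^sup>+z. h (grid_map m n j i (prod.swap z)) \<partial>\<mu>)"
        by (rule nn_integral_distr[OF swap]) (simp add: measurable_compose[OF measurable_grid_map h])
      then show "(\<integral>\<^sup>+z. h (prod.swap (grid_map n m i j z)) \<partial>\<mu>) = (\<integral>\<^sup>+z. h (grid_map m n j i z) \<partial>distr \<mu> borel prod.swap)"
        by (simp add: grid_map_def split_beta' prod.swap_def)
    qed
    finally show ?thesis .
  qed
  ultimately show ?thesis by (simp add: self_affine_def)
qed

text \<open>The edge pulls back to itself under the maps of the last column and misses the square
  under all others. Its mass is thus reproduced with the total weight of the last column as factor,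
  which is less than 1 because column 0 is a different one.\<close>

lemma self_affine_right_edge:
  assumes sa: "self_affine n m p \<mu>" and n: "n \<ge> 2" "m \<ge> 2"
    and p: "\<And>i j. i < n \<Longrightarrow> j < m \<Longrightarrow> p i j > 0" and p1: "(\<Sum>i<n. \<Sum>j<m. p i j) = 1"
  shows "AE z in \<mu>. fst z < 1"
proof -
  note \<mu> = self_affineD[OF sa]
  interpret prob_space \<mu> by (rule \<mu>(1))
  let ?E = "{z :: real \<times> real. fst z = 1}"
  have "closed ?E" by (intro closed_Collect_eq continuous_intros)
  then have E: "?E \<in> sets borel" by simp
  then have E': "?E \<in> sets \<mu>" by (simp add: \<mu>(2))
  have eq: "(\<integral>\<^sup>+z. indicator ?E (grid_map n m i j z) \<partial>\<mu>) = (if i = n - 1 then ennreal (measure \<mu> ?E) else 0)"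
    if i: "i < n" for i j
  proof -
    have "(\<integral>\<^sup>+z. indicator ?E (grid_map n m i j z) \<partial>\<mu>) = (\<integral>\<^sup>+z. (if i = n - 1 then indicator ?E z else 0) \<partial>\<mu>)"
    proof (rule nn_integral_cong_AE)
      show "AE z in \<mu>. indicator ?E (grid_map n m i j z) = (if i = n - 1 then indicator ?E z else (0 :: ennreal))"
        using \<mu>(3)
      proof eventually_elim
        case (elim z)
        have "fst z / real n + real i / real n = 1 \<longleftrightarrow> fst z = real n - real i"
          using n by (auto simp: field_simps)
        also have "\<dots> \<longleftrightarrow> i = n - 1 \<and> fst z = 1"
        proof (cases "i = n - 1")
          case True
          then show ?thesis using n by (auto simp: of_nat_diff)
        next
          case False
          then have "real i + 2 \<le> real n" using i by linarith
          then show ?thesis using elim False by auto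
        qed
        finally show ?case by (auto simp: grid_map_def split_beta' indicator_def)
      qed
    qed
    then show ?thesis using E' by (simp add: emeasure_eq_measure)
  qed
  have "ennreal (measure \<mu> ?E) = (\<integral>\<^sup>+z. indicator ?E z \<partial>\<mu>)" using E' by (simp add: emeasure_eq_measure)
  also have "\<dots> = (\<Sum>i<n. \<Sum>j<m. ennreal (p i j) * (if i = n - 1 then ennreal (measure \<mu> ?E) else 0))"
    using E by (subst \<mu>(4)) (auto simp: eq intro!: sum.cong)
  also have "\<dots> = (\<Sum>i<n. if i = n - 1 then (\<Sum>j<m. ennreal (p i j * measure \<mu> ?E)) else 0)"
    using p by (intro sum.cong refl) (auto simp: ennreal_mult less_imp_le)
  also have "\<dots> = (\<Sum>j<m. ennreal (p (n - 1) j * measure \<mu> ?E))"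
    using n by (simp add: sum.delta)
  also have "\<dots> = ennreal ((\<Sum>j<m. p (n - 1) j) * measure \<mu> ?E)"
    using less_imp_le[OF p] n by (subst sum_ennreal) (auto simp: sum_distrib_right)
  finally have "measure \<mu> ?E = (\<Sum>j<m. p (n - 1) j) * measure \<mu> ?E"
    using p n by (subst (asm) ennreal_inj) (auto intro!: mult_nonneg_nonneg sum_nonneg less_imp_le[OF p])
  moreover have "(\<Sum>j<m. p (n - 1) j) < 1"
  proof -
    have "(\<Sum>j<m. p (n - 1) j) < (\<Sum>j<m. p 0 j) + (\<Sum>j<m. p (n - 1) j)"
    proof -
      have "0 < (\<Sum>j<m. p 0 j)"
        using n by (intro sum_pos p) (auto simp: lessThan_empty_iff)
      then show ?thesis by simp
    qed
    also have "\<dots> = (\<Sum>i\<in>{0, n - 1}. \<Sum>j<m. p i j)" using n by simp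
    also have "\<dots> \<le> (\<Sum>i<n. \<Sum>j<m. p i j)"
      using n by (intro sum_mono2) (auto intro!: sum_nonneg less_imp_le[OF p])
    finally show ?thesis using p1 by simp
  qed
  ultimately have "measure \<mu> ?E = 0" by (metis mult_cancel_right1 less_irrefl)
  then have "?E \<in> null_sets \<mu>" using E' by (simp add: null_sets_def emeasure_eq_measure)
  from AE_not_in[OF this] \<mu>(3) show ?thesis by eventually_elim auto
qed

lemma self_affine_half_open:
  assumes sa: "self_affine n m p \<mu>" and n: "n \<ge> 2" "m \<ge> 2"
    and p: "\<And>i j. i < n \<Longrightarrow> j < m \<Longrightarrow> p i j > 0" and p1: "(\<Sum>i<n. \<Sum>j<m. p i j) = 1"
  shows "AE z in \<mu>. z \<in> {0..<1} \<times> {0..<1}"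
proof -
  note \<mu> = self_affineD[OF sa]
  have swap: "prod.swap \<in> \<mu> \<rightarrow>\<^sub>M borel"
    using measurable_swap_borel by (simp cong: measurable_cong_sets add: \<mu>(2))
  have "AE z in distr \<mu> borel prod.swap. fst z < 1"
    by (rule self_affine_right_edge[OF self_affine_swap[OF sa] n(2,1)]) (use p p1 sum.swap[of p] in auto)
  then have "AE z in \<mu>. fst (prod.swap z) < 1"
    by (rule AE_distrD[OF swap])
  moreover have "AE z in \<mu>. fst z < 1"
    by (rule self_affine_right_edge[OF sa n _ p1]) (rule p)
  ultimately show ?thesis using \<mu>(3)
    by eventually_elim auto
qed

section \<open>Digits, the shift and mutual singularity\<close>

definition grid_digit :: "nat \<Rightarrow> nat \<Rightarrow> real \<times> real \<Rightarrow> nat \<times> nat" where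
  "grid_digit n m z = (nat \<lfloor>real n * fst z\<rfloor>, nat \<lfloor>real m * snd z\<rfloor>)"

definition grid_shift :: "nat \<Rightarrow> nat \<Rightarrow> real \<times> real \<Rightarrow> real \<times> real" where
  "grid_shift n m z = (frac (real n * fst z), frac (real m * snd z))"

text \<open>Half-openness is essential: a point with a coordinate 1 would be given the digit of the
  next cell. This is why the edges were shown to be null.\<close>

lemma grid_digit_shift_grid_map:
  assumes "n > 0" "m > 0" "z \<in> {0..<1} \<times> {0..<1}"
  shows "grid_digit n m (grid_map n m i j z) = (i, j)" "grid_shift n m (grid_map n m i j z) = z"
proof -
  have eq: "real k * (t / real k + real l / real k) = t + real l" if "k > 0" for k l :: nat and t :: real
    using that by (simp add: field_simps)
  have fl: "\<lfloor>t\<rfloor> = 0" if "0 \<le> t" "t < 1" for t :: real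
    using that by (simp add: floor_eq_iff)
  show "grid_digit n m (grid_map n m i j z) = (i, j)"
    using assms by (auto simp: grid_digit_def grid_map_def eq fl)
  show "grid_shift n m (grid_map n m i j z) = z"
    using assms by (auto simp: grid_shift_def grid_map_def eq fl frac_def)
qed

lemma measurable_grid_shift [measurable]: "grid_shift n m \<in> borel \<rightarrow>\<^sub>M borel"
  unfolding grid_shift_def[abs_def] frac_def borel_prod[symmetric] by measurable

lemma measurable_grid_digit [measurable]: "grid_digit n m \<in> borel \<rightarrow>\<^sub>M count_space UNIV"
proof -
  have "(\<lambda>z. nat \<lfloor>real n * fst z\<rfloor>) \<in> (borel \<Otimes>\<^sub>M borel) \<rightarrow>\<^sub>M count_space (UNIV :: nat set)"
    "(\<lambda>z. nat \<lfloor>real m * snd z\<rfloor>) \<in> (borel \<Otimes>\<^sub>M borel) \<rightarrow>\<^sub>M count_space (UNIV :: nat set)"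
    by measurable
  then have "grid_digit n m \<in> (borel \<Otimes>\<^sub>M borel) \<rightarrow>\<^sub>M count_space UNIV \<Otimes>\<^sub>M count_space UNIV"
    unfolding grid_digit_def[abs_def] by (rule measurable_Pair)
  then show ?thesis by (simp add: pair_measure_countable borel_prod)
qed

text \<open>On the image of a cell map the digit is constant and the shift undoes the map. In
  probabilistic terms, the first digit is independent of the shifted point, whose law is
  \<open>\<mu>\<close> again.\<close>

lemma nn_integral_digit_shift:
  assumes sa: "self_affine n m p \<mu>" and half: "AE z in \<mu>. z \<in> {0..<1} \<times> {0..<1}"
    and nm: "n > 0" "m > 0" and h[measurable]: "h \<in> borel_measurable borel"
  shows "(\<integral>\<^sup>+z. g (grid_digit n m z) * h (grid_shift n m z) \<partial>\<mu>)
    = (\<Sum>i<n. \<Sum>j<m. ennreal (p i j) * g (i, j)) * (\<integral>\<^sup>+z. h z \<partial>\<mu>)"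
proof -
  note \<mu> = self_affineD[OF sa]
  have [measurable]: "g \<in> borel_measurable (count_space UNIV)" by simp
  have hm: "h \<in> borel_measurable \<mu>" by (simp cong: measurable_cong_sets add: \<mu>(2))
  have "(\<integral>\<^sup>+z. g (grid_digit n m z) * h (grid_shift n m z) \<partial>\<mu>)
    = (\<Sum>i<n. \<Sum>j<m. ennreal (p i j) * (\<integral>\<^sup>+z. g (grid_digit n m (grid_map n m i j z)) * h (grid_shift n m (grid_map n m i j z)) \<partial>\<mu>))"
    by (rule \<mu>(4)) measurable
  also have "\<dots> = (\<Sum>i<n. \<Sum>j<m. ennreal (p i j) * (\<integral>\<^sup>+z. g (i, j) * h z \<partial>\<mu>))"
  proof (intro sum.cong refl arg_cong2[where f = "(*)"] nn_integral_cong_AE)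
    fix i j
    show "AE z in \<mu>. g (grid_digit n m (grid_map n m i j z)) * h (grid_shift n m (grid_map n m i j z)) = g (i, j) * h z"
      using half by eventually_elim (simp only: grid_digit_shift_grid_map[OF nm])
  qed
  also have "\<dots> = (\<Sum>i<n. \<Sum>j<m. (ennreal (p i j) * g (i, j)) * (\<integral>\<^sup>+z. h z \<partial>\<mu>))"
    by (simp add: nn_integral_cmult[OF hm] mult.assoc)
  finally show ?thesis by (simp add: sum_distrib_right)
qed

fun digit_product :: "nat \<Rightarrow> nat \<Rightarrow> (nat \<times> nat \<Rightarrow> real) \<Rightarrow> nat \<Rightarrow> real \<times> real \<Rightarrow> real" where
  "digit_product n m w 0 z = 1"
| "digit_product n m w (Suc k) z = w (grid_digit n m z) * digit_product n m w k (grid_shift n m z)"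

lemma measurable_digit_product [measurable]: "digit_product n m w k \<in> borel_measurable borel"
proof (induction k)
  case (Suc k)
  note [measurable] = Suc
  have [measurable]: "w \<in> borel_measurable (count_space UNIV)" by simp
  show ?case unfolding digit_product.simps[abs_def] by measurable
qed simp

lemma digit_product_pos: "(\<And>c. w c > 0) \<Longrightarrow> digit_product n m w k z > 0"
  by (induction k arbitrary: z) auto

lemma digit_product_inverse:
  "digit_product n m (\<lambda>c. inverse (w c)) k z = inverse (digit_product n m w k z)"
  by (induction k arbitrary: z) auto

lemma nn_integral_digit_product:
  assumes sa: "self_affine n m p \<mu>" and half: "AE z in \<mu>. z \<in> {0..<1} \<times> {0..<1}"
    and nm: "n > 0" "m > 0" and w: "\<And>c. w c > 0"
    and p: "\<And>i j. i < n \<Longrightarrow> j < m \<Longrightarrow> p i j > 0"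
  shows "(\<integral>\<^sup>+z. ennreal (digit_product n m w k z) \<partial>\<mu>) = ennreal ((\<Sum>i<n. \<Sum>j<m. p i j * w (i, j)) ^ k)"
proof (induction k)
  case 0
  then show ?case using prob_space.emeasure_space_1[OF self_affineD(1)[OF sa]] by simp
next
  case (Suc k)
  have "(\<integral>\<^sup>+z. ennreal (digit_product n m w (Suc k) z) \<partial>\<mu>)
      = (\<integral>\<^sup>+z. ennreal (w (grid_digit n m z)) * ennreal (digit_product n m w k (grid_shift n m z)) \<partial>\<mu>)"
    using w by (intro nn_integral_cong) (simp add: ennreal_mult less_imp_le digit_product_pos)
  also have "\<dots> = (\<Sum>i<n. \<Sum>j<m. ennreal (p i j) * ennreal (w (i, j))) * (\<integral>\<^sup>+z. ennreal (digit_product n m w k z) \<partial>\<mu>)"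
    by (rule nn_integral_digit_shift[OF sa half nm]) measurable
  also have "(\<Sum>i<n. \<Sum>j<m. ennreal (p i j) * ennreal (w (i, j))) = ennreal (\<Sum>i<n. \<Sum>j<m. p i j * w (i, j))"
    using less_imp_le[OF p] less_imp_le[OF w]
    by (subst double_sum_ennreal[symmetric]) (auto simp: ennreal_mult intro!: sum.cong)
  also have "\<dots> * (\<integral>\<^sup>+z. ennreal (digit_product n m w k z) \<partial>\<mu>) = ennreal ((\<Sum>i<n. \<Sum>j<m. p i j * w (i, j)) ^ Suc k)"
    unfolding Suc using less_imp_le[OF p] less_imp_le[OF w]
    by (subst ennreal_mult[symmetric]) (auto intro!: sum_nonneg zero_le_power)
  finally show ?case .
qed

text \<open>Kakutani's argument: the square root of the likelihood ratio of the first \<open>k\<close> digits has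
  \<open>\<mu>\<close>-mean \<open>a ^ k\<close>, and so has its reciprocal under \<open>\<nu>\<close>, where \<open>a = (\<Sum>ij. sqrt (p i j * q i j)) < 1\<close>.\<close>

lemma self_affine_mutually_singular:
  assumes sa: "self_affine n m p \<mu>" "self_affine n m q \<nu>"
    and half: "AE z in \<mu>. z \<in> {0..<1} \<times> {0..<1}" "AE z in \<nu>. z \<in> {0..<1} \<times> {0..<1}"
    and nm: "n > 0" "m > 0"
    and p: "\<And>i j. i < n \<Longrightarrow> j < m \<Longrightarrow> p i j > 0" and p1: "(\<Sum>i<n. \<Sum>j<m. p i j) = 1"
    and q: "\<And>i j. i < n \<Longrightarrow> j < m \<Longrightarrow> q i j > 0" and q1: "(\<Sum>i<n. \<Sum>j<m. q i j) = 1"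
    and neq: "i0 < n" "j0 < m" "p i0 j0 \<noteq> q i0 j0"
  obtains E where "E \<in> sets borel" "AE z in \<mu>. z \<in> E" "AE z in \<nu>. z \<notin> E"
proof -
  interpret \<mu>: prob_space \<mu> by (rule self_affineD(1)[OF sa(1)])
  interpret \<nu>: prob_space \<nu> by (rule self_affineD(1)[OF sa(2)])
  have sets_\<mu>[measurable_cong]: "sets \<mu> = sets borel" by (rule self_affineD(2)[OF sa(1)])
  have sets_\<nu>[measurable_cong]: "sets \<nu> = sets borel" by (rule self_affineD(2)[OF sa(2)])
  have sp: "space \<mu> = UNIV" "space \<nu> = UNIV"
    using sets_\<mu> sets_\<nu> by (auto dest: sets_eq_imp_space_eq)
  define a where "a = (\<Sum>i<n. \<Sum>j<m. sqrt (p i j * q i j))"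
  \<comment> \<open>The value 1 off the grid keeps \<open>w\<close> positive for all arguments, as
    \<open>digit_product_pos\<close> requires.\<close>
  define w where "w c = (if fst c < n \<and> snd c < m then sqrt (q (fst c) (snd c) / p (fst c) (snd c)) else 1)" for c
  have w: "w c > 0" for c using p q by (auto simp: w_def)
  have iw: "inverse (w c) > 0" for c using w by simp
  have pw: "p i j * w (i, j) = sqrt (p i j * q i j)" if "i < n" "j < m" for i j
  proof -
    have "p i j * w (i, j) = sqrt ((p i j)\<^sup>2 * (q i j / p i j))"
      using p[OF that] that by (simp add: w_def real_sqrt_mult real_sqrt_divide)
    then show ?thesis using p[OF that] by (simp add: power2_eq_square)
  qed
  have qw: "q i j * inverse (w (i, j)) = sqrt (p i j * q i j)" if "i < n" "j < m" for i j
  proof -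
    have "q i j * inverse (w (i, j)) = sqrt ((q i j)\<^sup>2 * (p i j / q i j))"
      using q[OF that] that by (simp add: w_def real_sqrt_mult real_sqrt_divide)
    then show ?thesis using q[OF that] by (simp add: power2_eq_square mult.commute)
  qed
  let ?R = "digit_product n m w"
  have R: "?R k z > 0" for k z by (rule digit_product_pos[OF w])
  have int\<mu>: "(\<integral>\<^sup>+z. ennreal (?R k z) \<partial>\<mu>) = ennreal (a ^ k)" for k
    using nn_integral_digit_product[OF sa(1) half(1) nm, where w = w and k = k] w p
    by (simp add: a_def pw)
  have int\<nu>: "(\<integral>\<^sup>+z. ennreal (inverse (?R k z)) \<partial>\<nu>) = ennreal (a ^ k)" for k
    using nn_integral_digit_product[OF sa(2) half(2) nm, where w = "\<lambda>c. inverse (w c)" and k = k] iw q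
    by (simp add: a_def qw digit_product_inverse)
  have le: "sqrt (p i j * q i j) \<le> (p i j + q i j) / 2" if "i < n" "j < m" for i j
    using p[OF that] q[OF that] by (intro arith_geo_mean_sqrt) auto
  have a: "0 \<le> a" "a < 1"
  proof -
    show "0 \<le> a"
      unfolding a_def
      by (intro sum_nonneg real_sqrt_ge_zero mult_nonneg_nonneg less_imp_le[OF p] less_imp_le[OF q]) auto
    \<comment> \<open>One cell with different weights makes the inequality of arithmetic and
      geometric means strict, and so forces \<open>a < 1\<close>.\<close>
    have strict: "sqrt (p i0 j0 * q i0 j0) < (p i0 j0 + q i0 j0) / 2"
    proof -
      have "sqrt (p i0 j0 * q i0 j0) \<noteq> (p i0 j0 + q i0 j0) / 2"
      proof
        assume "sqrt (p i0 j0 * q i0 j0) = (p i0 j0 + q i0 j0) / 2"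
        then have "p i0 j0 * q i0 j0 = ((p i0 j0 + q i0 j0) / 2)\<^sup>2"
          using p[OF neq(1,2)] q[OF neq(1,2)]
          by (metis less_imp_le mult_nonneg_nonneg real_sqrt_pow2)
        then have "(p i0 j0 - q i0 j0)\<^sup>2 = 0" by (simp add: power2_eq_square field_simps)
        then show False using neq(3) by simp
      qed
      then show ?thesis using le[OF neq(1,2)] by simp
    qed
    have "a < (\<Sum>i<n. \<Sum>j<m. (p i j + q i j) / 2)"
      unfolding a_def
    proof (rule sum_strict_mono_ex1)
      show "\<forall>i\<in>{..<n}. (\<Sum>j<m. sqrt (p i j * q i j)) \<le> (\<Sum>j<m. (p i j + q i j) / 2)"
        using le by (auto intro!: sum_mono)
      have "(\<Sum>j<m. sqrt (p i0 j * q i0 j)) < (\<Sum>j<m. (p i0 j + q i0 j) / 2)"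
        using le neq(1,2) strict by (intro sum_strict_mono_ex1) auto
      then show "\<exists>i\<in>{..<n}. (\<Sum>j<m. sqrt (p i j * q i j)) < (\<Sum>j<m. (p i j + q i j) / 2)"
        using neq(1) by auto
    qed simp
    also have "\<dots> = 1"
      using p1 q1 by (simp add: sum.distrib flip: sum_divide_distrib)
    finally show "a < 1" .
  qed
  have sm: "summable (\<lambda>k. a ^ k)" using a by (simp add: summable_geometric)
  have [measurable]: "{z. 1 \<le> ?R k z} \<in> sets borel" "{z. ?R k z < 1} \<in> sets borel" for k
    by measurable
  \<comment> \<open>Markov's inequality at level 1, here and for the reciprocal below. The bounds
    are summable, so by Borel-Cantelli \<open>?R k\<close> is eventually below 1 for one measure and
    eventually at least 1 for the other.\<close>
  have m\<mu>: "measure \<mu> {z. 1 \<le> ?R k z} \<le> a ^ k" for k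
  proof -
    have "emeasure \<mu> {z. 1 \<le> ?R k z} = (\<integral>\<^sup>+z. indicator {z. 1 \<le> ?R k z} z \<partial>\<mu>)"
      by (simp add: sets_\<mu>)
    also have "\<dots> \<le> (\<integral>\<^sup>+z. ennreal (?R k z) \<partial>\<mu>)"
      by (intro nn_integral_mono) (auto simp: indicator_def)
    finally show ?thesis unfolding int\<mu> using a by (simp add: \<mu>.emeasure_eq_measure)
  qed
  have m\<nu>: "measure \<nu> {z. ?R k z < 1} \<le> a ^ k" for k
  proof -
    have "emeasure \<nu> {z. ?R k z < 1} = (\<integral>\<^sup>+z. indicator {z. ?R k z < 1} z \<partial>\<nu>)"
      by (simp add: sets_\<nu>)
    also have "\<dots> \<le> (\<integral>\<^sup>+z. ennreal (inverse (?R k z)) \<partial>\<nu>)"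
      using R by (intro nn_integral_mono) (auto simp: indicator_def intro!: one_le_inverse[OF R less_imp_le])
    finally show ?thesis unfolding int\<nu> using a by (simp add: \<nu>.emeasure_eq_measure)
  qed
  have ev\<mu>: "AE z in \<mu>. \<forall>\<^sub>F k in sequentially. z \<in> space \<mu> - {z. 1 \<le> ?R k z}"
    by (rule borel_cantelli_AE1)
      (auto simp: sets_\<mu> \<mu>.emeasure_eq_measure intro!: summable_comparison_test'[OF sm] m\<mu>)
  have ev\<nu>: "AE z in \<nu>. \<forall>\<^sub>F k in sequentially. z \<in> space \<nu> - {z. ?R k z < 1}"
    by (rule borel_cantelli_AE1)
      (auto simp: sets_\<nu> \<nu>.emeasure_eq_measure intro!: summable_comparison_test'[OF sm] m\<nu>)
  \<comment> \<open>The points where \<open>?R k < 1\<close> infinitely often: implied by eventually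
    on the one side, excluded by eventually not on the other.\<close>
  let ?E = "{z. \<forall>k0. \<exists>k\<ge>k0. ?R k z < 1}"
  have "?E \<in> sets borel"
  proof -
    have "?E = (\<Inter>k0. \<Union>k\<in>{k0..}. {z. ?R k z < 1})" by auto
    then show ?thesis by simp
  qed
  moreover have "AE z in \<mu>. z \<in> ?E"
    using ev\<mu>
  proof eventually_elim
    case (elim z)
    then obtain N where N: "\<And>k. k \<ge> N \<Longrightarrow> ?R k z < 1" by (auto simp: eventually_sequentially not_le)
    have "\<exists>k\<ge>k0. ?R k z < 1" for k0 using N[of "max N k0"] by (intro exI[of _ "max N k0"]) simp
    then show ?case by simp
  qed
  moreover have "AE z in \<nu>. z \<notin> ?E"
    using ev\<nu> by eventually_elim (auto simp: eventually_sequentially)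
  ultimately show thesis by (rule that)
qed

section \<open>The product of Lebesgue measure with the marginal\<close>

lemma nn_integral_unit_lebesgue_subdivide:
  assumes n: "n > 0" and h[measurable]: "h \<in> borel_measurable borel"
  shows "(\<integral>\<^sup>+x. h x \<partial>unit_lebesgue)
    = (\<Sum>i<n. ennreal (1 / real n) * (\<integral>\<^sup>+x. h (x / real n + real i / real n) \<partial>unit_lebesgue))"
proof -
  \<comment> \<open>The \<open>n\<close> intervals of length \<open>1 / n\<close> tile the half-open
    unit interval; \<open>x\<close> lies in the one numbered by its first base-\<open>n\<close>
    digit.\<close>
  have part: "(\<Sum>i<n. indicator {0..<1} (real n * x - real i)) = (indicator {0..<1} x :: ennreal)" for x
  proof (cases "0 \<le> x \<and> x < 1")
    case True
    define i0 where "i0 = nat \<lfloor>real n * x\<rfloor>"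
    have "0 \<le> real n * x" using True n by simp
    then have i0: "real i0 = of_int \<lfloor>real n * x\<rfloor>" by (simp add: i0_def)
    have "real n * x < real n" using True n by simp
    then have lt: "i0 < n" using i0 by linarith
    have "indicator {0..<1} (real n * x - real i) = (if i = i0 then 1 else 0 :: ennreal)" for i
    proof -
      have "0 \<le> real n * x - real i \<and> real n * x - real i < 1 \<longleftrightarrow> \<lfloor>real n * x\<rfloor> = int i"
        by (auto simp: floor_eq_iff)
      also have "\<dots> \<longleftrightarrow> i = i0" using i0 by linarith
      finally show ?thesis by (auto simp: indicator_def)
    qed
    then show ?thesis using True lt by simp
  next
    case False
    have "indicator {0..<1} (real n * x - real i) = (0 :: ennreal)" if "i < n" for i
    proof -
      have "\<not> (0 \<le> real n * x - real i \<and> real n * x - real i < 1)"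
      proof
        assume *: "0 \<le> real n * x - real i \<and> real n * x - real i < 1"
        have "real i + 1 \<le> real n" using that by linarith
        then have "real n * x < real n" using * by linarith
        then have "x < 1" using n by simp
        moreover have "0 \<le> real n * x" using * by linarith
        then have "0 \<le> x" using n by (simp add: zero_le_mult_iff)
        ultimately show False using False by simp
      qed
      then show ?thesis by (simp add: indicator_def)
    qed
    then show ?thesis using False by (auto simp: indicator_def)
  qed
  have "(\<integral>\<^sup>+x. h x \<partial>unit_lebesgue) = (\<integral>\<^sup>+x. (\<Sum>i<n. indicator {0..<1} (real n * x - real i) * h x) \<partial>lborel)"
    by (simp add: nn_integral_unit_lebesgue part flip: sum_distrib_right)
  also have "\<dots> = (\<Sum>i<n. \<integral>\<^sup>+x. indicator {0..<1} (real n * x - real i) * h x \<partial>lborel)"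
    by (rule nn_integral_sum) measurable
  also have "\<dots> = (\<Sum>i<n. ennreal (1 / real n) * (\<integral>\<^sup>+x. h (x / real n + real i / real n) \<partial>unit_lebesgue))"
  proof (intro sum.cong refl)
    fix i
    have "(\<integral>\<^sup>+x. indicator {0..<1} (real n * x - real i) * h x \<partial>lborel)
        = \<bar>1 / real n\<bar> * (\<integral>\<^sup>+x. indicator {0..<1} (real n * (real i / real n + 1 / real n * x) - real i)
            * h (real i / real n + 1 / real n * x) \<partial>lborel)"
      using n by (intro nn_integral_real_affine) auto
    also have "(\<lambda>x. indicator {0..<1} (real n * (real i / real n + 1 / real n * x) - real i)
            * h (real i / real n + 1 / real n * x)) = (\<lambda>x. indicator {0..<1} x * h (x / real n + real i / real n))"
      using n by (simp add: field_simps)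
    finally show "(\<integral>\<^sup>+x. indicator {0..<1} (real n * x - real i) * h x \<partial>lborel)
        = ennreal (1 / real n) * (\<integral>\<^sup>+x. h (x / real n + real i / real n) \<partial>unit_lebesgue)"
      by (simp add: nn_integral_unit_lebesgue)
  qed
  finally show ?thesis .
qed

lemma nn_integral_y_marginal:
  assumes "sets \<mu> = sets borel" and h: "h \<in> borel_measurable borel"
  shows "(\<integral>\<^sup>+y. h y \<partial>y_marginal \<mu>) = (\<integral>\<^sup>+z. h (snd z) \<partial>\<mu>)"
  unfolding y_marginal_def
  by (rule nn_integral_distr) (simp_all add: h projections_measurable[OF assms(1)])

lemma nn_integral_y_marginal_self_affine:
  assumes sa: "self_affine n m p \<mu>" and p: "\<And>i j. i < n \<Longrightarrow> j < m \<Longrightarrow> p i j \<ge> 0"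
    and h: "h \<in> borel_measurable borel"
  shows "(\<integral>\<^sup>+y. h y \<partial>y_marginal \<mu>)
    = (\<Sum>j<m. ennreal (row_weight n p j) * (\<integral>\<^sup>+y. h (y / real m + real j / real m) \<partial>y_marginal \<mu>))"
proof -
  note \<mu> = self_affineD[OF sa]
  have hs: "(\<lambda>z :: real \<times> real. h (snd z)) \<in> borel_measurable borel"
    by (rule measurable_compose[OF projections_measurable(2)[OF refl] h])
  have "(\<integral>\<^sup>+y. h y \<partial>y_marginal \<mu>) = (\<integral>\<^sup>+z. h (snd z) \<partial>\<mu>)"
    by (rule nn_integral_y_marginal[OF \<mu>(2) h])
  also have "\<dots> = (\<Sum>i<n. \<Sum>j<m. ennreal (p i j) * (\<integral>\<^sup>+z. h (snd (grid_map n m i j z)) \<partial>\<mu>))"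
    by (rule \<mu>(4)[OF hs])
  also have "\<dots> = (\<Sum>j<m. \<Sum>i<n. ennreal (p i j) * (\<integral>\<^sup>+y. h (y / real m + real j / real m) \<partial>y_marginal \<mu>))"
  proof (subst sum.swap, intro sum.cong refl arg_cong2[where f = "(*)"])
    fix i j
    have "(\<lambda>y. h (y / real m + real j / real m)) \<in> borel_measurable borel"
      using h by measurable
    from nn_integral_y_marginal[OF \<mu>(2) this]
    show "(\<integral>\<^sup>+z. h (snd (grid_map n m i j z)) \<partial>\<mu>) = (\<integral>\<^sup>+y. h (y / real m + real j / real m) \<partial>y_marginal \<mu>)"
      by (simp add: grid_map_def split_beta')
  qed
  also have "\<dots> = (\<Sum>j<m. ennreal (row_weight n p j) * (\<integral>\<^sup>+y. h (y / real m + real j / real m) \<partial>y_marginal \<mu>))"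
  proof (intro sum.cong refl)
    fix j assume "j \<in> {..<m}"
    then have "ennreal (row_weight n p j) = (\<Sum>i<n. ennreal (p i j))"
      unfolding row_weight_def using p by (intro sum_ennreal[symmetric]) simp
    then show "(\<Sum>i<n. ennreal (p i j) * (\<integral>\<^sup>+y. h (y / real m + real j / real m) \<partial>y_marginal \<mu>))
        = ennreal (row_weight n p j) * (\<integral>\<^sup>+y. h (y / real m + real j / real m) \<partial>y_marginal \<mu>)"
      by (simp only: sum_distrib_right)
  qed
  finally show ?thesis .
qed

text \<open>Lebesgue measure is self-similar with weights \<open>1 / n\<close>, the marginal with
  the row weights. The product therefore lives on the same grid with the weight of each row spread
  evenly, and its weights differ from \<open>p\<close> precisely in the rows with unequal
  weights.\<close>

lemma self_affine_lebesgue_product: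
  assumes sa: "self_affine n m p \<mu>" and p: "\<And>i j. i < n \<Longrightarrow> j < m \<Longrightarrow> p i j \<ge> 0"
    and n: "n > 0" and half: "AE z in \<mu>. z \<in> {0..<1} \<times> {0..<1}"
  shows "self_affine n m (\<lambda>i j. row_weight n p j / real n) (unit_lebesgue \<Otimes>\<^sub>M y_marginal \<mu>)"
    and "AE z in unit_lebesgue \<Otimes>\<^sub>M y_marginal \<mu>. z \<in> {0..<1} \<times> {0..<1}"
proof -
  note \<mu> = self_affineD[OF sa]
  define \<nu> where "\<nu> = y_marginal \<mu>"
  interpret \<nu>: prob_space \<nu> unfolding \<nu>_def by (rule prob_space_y_marginal[OF \<mu>(1,2)])
  have sets_\<nu>[simp, measurable_cong]: "sets \<nu> = sets borel" by (simp add: \<nu>_def y_marginal_def)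
  interpret P: pair_prob_space unit_lebesgue \<nu> ..
  have setsP: "sets (unit_lebesgue \<Otimes>\<^sub>M \<nu>) = sets borel"
    unfolding borel_prod[symmetric] by (intro sets_pair_measure_cong) simp_all
  have spP: "space (unit_lebesgue \<Otimes>\<^sub>M \<nu>) = UNIV"
    using sets_eq_imp_space_eq[OF setsP] unfolding space_borel .
  have nn: "(\<integral>\<^sup>+z. h z \<partial>(unit_lebesgue \<Otimes>\<^sub>M \<nu>)) = (\<integral>\<^sup>+y. \<integral>\<^sup>+x. h (x, y) \<partial>unit_lebesgue \<partial>\<nu>)"
    if "h \<in> borel_measurable borel" for h
    using that by (intro P.nn_integral_snd[symmetric]) (simp add: measurable_cong_sets[OF setsP refl])
  show half': "AE z in unit_lebesgue \<Otimes>\<^sub>M y_marginal \<mu>. z \<in> {0..<1} \<times> {0..<1}"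
    unfolding \<nu>_def[symmetric]
  proof (rule P.AE_pair_measure)
    have "{0..<1::real} \<times> {0..<1::real} \<in> sets borel" by (intro borel_Times) auto
    then show "{z \<in> space (unit_lebesgue \<Otimes>\<^sub>M \<nu>). z \<in> {0..<1} \<times> {0..<1}} \<in> sets (unit_lebesgue \<Otimes>\<^sub>M \<nu>)"
      unfolding spP setsP by simp
    have AEy: "AE y in \<nu>. 0 \<le> y \<and> y < 1"
      unfolding \<nu>_def y_marginal_def
    proof (subst AE_distr_iff[OF projections_measurable(2)[OF \<mu>(2)]])
      show "AE x in \<mu>. 0 \<le> snd x \<and> snd x < 1" using half by eventually_elim auto
    qed simp
    have "AE x in unit_lebesgue. 0 \<le> x \<and> x < 1" by (simp add: AE_unit_lebesgue)
    then show "AE x in unit_lebesgue. AE y in \<nu>. (x, y) \<in> {0..<1} \<times> {0..<1}"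
    proof eventually_elim
      case (elim x)
      from AEy show ?case by eventually_elim (use elim in auto)
    qed
  qed
  have "(\<integral>\<^sup>+z. h z \<partial>(unit_lebesgue \<Otimes>\<^sub>M \<nu>))
      = (\<Sum>i<n. \<Sum>j<m. ennreal (row_weight n p j / real n) * (\<integral>\<^sup>+z. h (grid_map n m i j z) \<partial>(unit_lebesgue \<Otimes>\<^sub>M \<nu>)))"
    if h: "h \<in> borel_measurable borel" for h
  proof -
    have h'[measurable]: "h \<in> borel_measurable (borel \<Otimes>\<^sub>M borel)" using h by (simp add: borel_prod)
    let ?H = "\<lambda>i y. \<integral>\<^sup>+x. h (x / real n + real i / real n, y) \<partial>unit_lebesgue"
    have H: "?H i \<in> borel_measurable borel" for i by measurable
    have "(\<integral>\<^sup>+z. h z \<partial>(unit_lebesgue \<Otimes>\<^sub>M \<nu>)) = (\<integral>\<^sup>+y. (\<Sum>i<n. ennreal (1 / real n) * ?H i y) \<partial>\<nu>)"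
      unfolding nn[OF h] by (intro nn_integral_cong nn_integral_unit_lebesgue_subdivide n) measurable
    also have "\<dots> = (\<Sum>i<n. ennreal (1 / real n) * (\<integral>\<^sup>+y. ?H i y \<partial>\<nu>))"
      using H by (subst nn_integral_sum) (auto simp: nn_integral_cmult)
    also have "\<dots> = (\<Sum>i<n. ennreal (1 / real n) *
        (\<Sum>j<m. ennreal (row_weight n p j) * (\<integral>\<^sup>+y. ?H i (y / real m + real j / real m) \<partial>\<nu>)))"
      unfolding \<nu>_def
      by (intro sum.cong refl arg_cong2[where f = "(*)"] nn_integral_y_marginal_self_affine[OF sa _ H] p)
    also have "\<dots> = (\<Sum>i<n. \<Sum>j<m. ennreal (row_weight n p j / real n) * (\<integral>\<^sup>+z. h (grid_map n m i j z) \<partial>(unit_lebesgue \<Otimes>\<^sub>M \<nu>)))"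
      unfolding sum_distrib_left
    proof (intro sum.cong refl)
      fix i j assume j: "j \<in> {..<m}"
      have "row_weight n p j \<ge> 0" using p j by (auto simp: row_weight_def intro!: sum_nonneg)
      then have "ennreal (row_weight n p j / real n) = ennreal (1 / real n) * ennreal (row_weight n p j)"
        using n by (simp flip: ennreal_mult)
      moreover have "(\<integral>\<^sup>+z. h (grid_map n m i j z) \<partial>(unit_lebesgue \<Otimes>\<^sub>M \<nu>)) = (\<integral>\<^sup>+y. ?H i (y / real m + real j / real m) \<partial>\<nu>)"
        by (subst nn) (simp_all add: grid_map_def measurable_compose[OF measurable_grid_map h, unfolded grid_map_def split_beta'] split_beta')
      ultimately show "ennreal (1 / real n) * (ennreal (row_weight n p j) * (\<integral>\<^sup>+y. ?H i (y / real m + real j / real m) \<partial>\<nu>))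
          = ennreal (row_weight n p j / real n) * (\<integral>\<^sup>+z. h (grid_map n m i j z) \<partial>(unit_lebesgue \<Otimes>\<^sub>M \<nu>))"
        by (simp add: mult.assoc)
    qed
    finally show ?thesis .
  qed
  moreover have "AE z in unit_lebesgue \<Otimes>\<^sub>M \<nu>. z \<in> {0..1} \<times> {0..1}"
    using half'[folded \<nu>_def] by eventually_elim auto
  ultimately show "self_affine n m (\<lambda>i j. row_weight n p j / real n) (unit_lebesgue \<Otimes>\<^sub>M y_marginal \<mu>)"
    unfolding \<nu>_def[symmetric] self_affine_def using setsP P.prob_space_axioms by auto
qed

section \<open>Singular slices and the double series\<close>

lemma (in disintegrated) lebesgue_singular_slices:
  assumes sa: "self_affine n m p \<mu>" and n: "n \<ge> 2" "m \<ge> 2"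
    and p: "\<And>i j. i < n \<Longrightarrow> j < m \<Longrightarrow> p i j > 0" and p1: "(\<Sum>i<n. \<Sum>j<m. p i j) = 1"
    and uneq: "j0 < m" "\<not> (\<forall>i<n. \<forall>i'<n. p i j0 = p i' j0)"
  shows "AE y in \<nu>. lebesgue_singular (\<rho> y)"
proof -
  have nm: "n > 0" "m > 0" using n by auto
  have half: "AE z in \<mu>. z \<in> {0..<1} \<times> {0..<1}"
    by (rule self_affine_half_open[OF sa n _ p1]) (rule p)
  let ?q = "\<lambda>i j. row_weight n p j / real n"
  let ?L = "unit_lebesgue \<Otimes>\<^sub>M y_marginal \<mu>"
  have q: "?q i j > 0" if "i < n" "j < m" for i j
    unfolding row_weight_def using nm that by (intro divide_pos_pos sum_pos p) (auto simp: lessThan_empty_iff)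
  have q1: "(\<Sum>i<n. \<Sum>j<m. ?q i j) = 1"
  proof -
    have "(\<Sum>i<n. \<Sum>j<m. ?q i j) = (\<Sum>j<m. row_weight n p j)"
      using nm by (simp flip: sum_divide_distrib)
    also have "\<dots> = (\<Sum>i<n. \<Sum>j<m. p i j)" unfolding row_weight_def by (rule sum.swap)
    finally show ?thesis using p1 by simp
  qed
  \<comment> \<open>If each weight of the row were the average of the row, they would all be
    equal.\<close>
  have "\<exists>i<n. p i j0 \<noteq> ?q i j0"
  proof (rule ccontr)
    assume "\<not> (\<exists>i<n. p i j0 \<noteq> ?q i j0)"
    then have "p i j0 = row_weight n p j0 / real n" if "i < n" for i using that by blast
    then have "\<forall>i<n. \<forall>i'<n. p i j0 = p i' j0" by simp
    with uneq(2) show False by (rule notE)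
  qed
  then obtain i0 where i0: "i0 < n" "p i0 j0 \<noteq> ?q i0 j0" by blast
  have sa': "self_affine n m ?q ?L" and half': "AE z in ?L. z \<in> {0..<1} \<times> {0..<1}"
    by (rule self_affine_lebesgue_product[OF sa _ nm(1) half], rule less_imp_le, rule p, assumption, assumption)+
  obtain E where E: "E \<in> sets borel" "AE z in \<mu>. z \<in> E" "AE z in ?L. z \<notin> E"
    by (rule self_affine_mutually_singular[OF sa sa' half half' nm _ p1 _ q1 i0(1) uneq(1) i0(2)])
      (rule p, assumption, assumption, rule q, assumption, assumption)
  have 1: "AE y in \<nu>. AE x in \<rho> y. (x, y) \<in> E" by (rule AE_slice[OF E(1,2)])
  have B: "{0..<1} \<times> {0..<1} \<in> sets (borel :: (real \<times> real) measure)" by (intro borel_Times) auto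
  have 2: "AE y in \<nu>. AE x in \<rho> y. (x, y) \<in> {0..<1} \<times> {0..<1}" by (rule AE_slice[OF B half])
  interpret P': pair_prob_space unit_lebesgue \<nu> ..
  have 3: "AE y in \<nu>. AE x in unit_lebesgue. (x, y) \<notin> E"
  proof -
    have "AE w in \<nu> \<Otimes>\<^sub>M unit_lebesgue. (case w of (y, x) \<Rightarrow> (x, y)) \<notin> E"
      using E(3) by (subst (asm) P'.distr_pair_swap) (rule AE_distrD[OF measurable_pair_swap'])
    from P.AE_pair[OF this] show ?thesis by simp
  qed
  show ?thesis
    using 1 2 3
  proof eventually_elim
    case (elim y)
    \<comment> \<open>The cut to the unit interval is needed because \<open>E\<close> is known to be
      null only for \<open>unit_lebesgue\<close>, and a null set of \<open>lborel\<close> is asked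
      for.\<close>
    define N where "N = {x. (x, y) \<in> E} \<inter> {0..<1}"
    have Ey: "{x. (x, y) \<in> E} \<in> sets borel"
      using measurable_sets[OF measurable_slice[of "indicator E :: _ \<Rightarrow> real" y], of "{1}"] E(1)
      by (simp add: indicator_def vimage_def)
    then have N: "N \<in> sets borel" by (simp add: N_def)
    have "AE x in lborel. x \<notin> N"
      using elim(3) unfolding AE_unit_lebesgue by eventually_elim (auto simp: N_def)
    then have "emeasure lborel N = 0"
      using N AE_iff_null_sets[of N lborel] by (auto simp: null_sets_def)
    moreover have "AE x in \<rho> y. x \<notin> UNIV - N"
      using elim(1,2) by eventually_elim (auto simp: N_def)
    then have "emeasure (\<rho> y) (UNIV - N) = 0"
      using N AE_iff_null_sets[of "UNIV - N" "\<rho> y"] by (auto simp: null_sets_def)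
    ultimately show ?case using N by (auto simp: lebesgue_singular_def)
  qed
qed

lemma (in real_distribution) kaczmarz_sums:
  assumes "lebesgue_singular M" "emeasure M (UNIV - {0..<1}) = 0" "in_L2 M f"
  shows "(\<lambda>N. sq_norm M (\<lambda>x. f x - (\<Sum>k<N. kaczmarz_coeff M f k * wave (int k) x))) \<longlonglongrightarrow> 0"
  using kaczmarz_singular[OF assms] by (simp add: kaczmarz_expansion sq_norm_def norm_mult)

text \<open>Convergence on almost every slice becomes convergence over \<open>\<mu>\<close> by
  domination: the residual on a slice never exceeds the initial squared norm \<open>F 0\<close>,
  which is integrable over the marginal. The same majorant puts the coefficients \<open>c k\<close>
  into L2 of the marginal.\<close>

lemma (in disintegrated) double_fourier_expansion:
  assumes half: "AE z in \<mu>. z \<in> {0..<1} \<times> {0..<1}"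
    and sing\<nu>: "lebesgue_singular \<nu>" and sing\<rho>: "AE y in \<nu>. lebesgue_singular (\<rho> y)"
    and f: "in_L2 \<mu> f"
  shows "\<exists>d. L2_double_sums \<mu> (\<lambda>k l (x, y). d k l * (wave (int k) x * wave (int l) y)) f"
proof -
  interpret \<mu>: prob_space \<mu> by (rule prob_\<mu>)
  have meas\<mu>: "borel_measurable \<mu> = borel_measurable borel"
    by (rule measurable_cong_sets[OF sets_\<mu> refl])
  have fm: "f \<in> borel_measurable borel" using f by (simp add: in_L2_def meas\<mu>)
  have snd_m: "snd \<in> borel_measurable \<mu>" by (rule projections_measurable[OF sets_\<mu>])
  have fst_m: "fst \<in> borel_measurable \<mu>" by (rule projections_measurable[OF sets_\<mu>])
  \<comment> \<open>The rotated residual on the slice over \<open>y\<close>. Joint measurability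
    goes by induction on \<open>k\<close>, each step subtracting a mean that is measurable in
    \<open>y\<close>.\<close>
  define T where "T k y = (twist (\<rho> y) ^^ k) (\<lambda>x. f (x, y))" for k y
  have T_meas: "(\<lambda>(y, x). T k y x) \<in> borel_measurable (borel \<Otimes>\<^sub>M borel)" for k
  proof (induction k)
    case 0
    have "(\<lambda>(y, x). (x, y)) \<in> (borel \<Otimes>\<^sub>M borel) \<rightarrow>\<^sub>M (borel :: (real \<times> real) measure)"
      unfolding borel_prod[symmetric] by measurable
    from measurable_compose[OF this fm] show ?case by (simp add: T_def split_beta')
  next
    case (Suc k)
    note [measurable] = Suc measurable_integral_slice[OF Suc]
    have "T (Suc k) y x = wave (- 1) x * (T k y x - (\<integral>t. T k y t \<partial>\<rho> y))" for y x
      by (simp add: T_def twist_def)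
    then show ?case by simp
  qed
  define c where "c k y = kaczmarz_coeff (\<rho> y) (\<lambda>x. f (x, y)) k" for k y
  have c_meas: "c k \<in> borel_measurable borel" for k
    using measurable_integral_slice[OF T_meas[of k]] by (simp add: c_def[abs_def] kaczmarz_coeff_def T_def)
  define F where "F k y = sq_norm (\<rho> y) (T k y)" for k y
  have int_f: "integrable \<mu> (\<lambda>z. (cmod (f z))\<^sup>2)" using f by (simp add: in_L2_def)
  have F0: "integrable \<nu> (F 0)"
    using integrable_integral_slice[OF int_f] by (simp add: F_def[abs_def] T_def sq_norm_def)
  have slice_L2: "AE y in \<nu>. in_L2 (\<rho> y) (\<lambda>x. f (x, y))"
    using AE_integrable_slice[OF int_f]
    by eventually_elim (simp add: in_L2_def \<rho>.borel_measurable_M_eq measurable_slice[OF fm])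
  have B: "{0..<1} \<times> {0..<1} \<in> sets (borel :: (real \<times> real) measure)" by (intro borel_Times) auto
  have unit\<rho>: "AE y in \<nu>. emeasure (\<rho> y) (UNIV - {0..<1}) = 0"
    using AE_slice[OF B half]
  proof eventually_elim
    case (elim y)
    then have "AE x in \<rho> y. x \<notin> UNIV - {0..<1}" by eventually_elim auto
    then show ?case using AE_iff_null_sets[of "UNIV - {0..<1}" "\<rho> y"] by (auto simp: null_sets_def)
  qed
  have unit\<nu>: "emeasure \<nu> (UNIV - {0..<1}) = 0"
  proof -
    have "AE y in \<nu>. y \<notin> UNIV - {0..<1}"
      unfolding y_marginal_def using half
      by (subst AE_distr_iff[OF snd_m]) (auto elim!: eventually_mono)
    then show ?thesis using AE_iff_null_sets[of "UNIV - {0..<1}" \<nu>] by (auto simp: null_sets_def)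
  qed
  have c_L2: "in_L2 \<nu> (c k)" for k
    unfolding in_L2_def
  proof
    show "c k \<in> borel_measurable \<nu>" using c_meas by (simp add: \<nu>.borel_measurable_M_eq)
    show "integrable \<nu> (\<lambda>y. (cmod (c k y))\<^sup>2)"
    proof (rule Bochner_Integration.integrable_bound[OF F0])
      show "(\<lambda>y. (cmod (c k y))\<^sup>2) \<in> borel_measurable \<nu>"
        using c_meas by (simp add: \<nu>.borel_measurable_M_eq)
      show "AE y in \<nu>. norm ((cmod (c k y))\<^sup>2) \<le> norm (F 0 y)"
        using slice_L2 by eventually_elim (simp add: F_def T_def c_def \<rho>.kaczmarz_coeff_bound)
    qed
  qed
  let ?g = "\<lambda>k z. c k (snd z) * wave (int k) (fst z)"
  have snd_L2: "in_L2 \<mu> (\<lambda>z. h (snd z))" if "in_L2 \<nu> h" for h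
    using that integrable_distr[OF snd_m, of "\<lambda>y. (cmod (h y))\<^sup>2"]
    by (simp add: in_L2_def \<nu>.borel_measurable_M_eq y_marginal_def measurable_compose[OF snd_m])
  have wave_L2: "in_L2 \<mu> (\<lambda>z. h z * wave (int k) (fst z))" if "in_L2 \<mu> h" for h k
    using in_L2_mult_bounded[OF that, of "\<lambda>z. wave (int k) (fst z)" 1]
    by (simp add: mult.commute measurable_compose[OF fst_m measurable_wave])
  have g_L2: "in_L2 \<mu> (?g k)" for k
    by (rule wave_L2[OF snd_L2[OF c_L2]])
  have g_sum_L2: "in_L2 \<mu> (\<lambda>z. f z - (\<Sum>k<N. ?g k z))" for N
  proof (induction N)
    case (Suc N)
    from in_L2_diff[OF this g_L2[of N]] show ?case by (simp add: algebra_simps)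
  qed (simp add: f)
  have outer: "L2_sums \<mu> ?g f"
    unfolding L2_sums_def L2_norm_tendsto_0_iff
  proof (intro conjI allI g_L2 f)
    have eq: "sq_norm \<mu> (\<lambda>z. f z - (\<Sum>k<N. ?g k z)) = (\<integral>y. F N y \<partial>\<nu>)" for N
    proof -
      have "sq_norm \<mu> (\<lambda>z. f z - (\<Sum>k<N. ?g k z))
          = (\<integral>y. (\<integral>x. (cmod (f (x, y) - (\<Sum>k<N. ?g k (x, y))))\<^sup>2 \<partial>\<rho> y) \<partial>\<nu>)"
        using integral_slice[of "\<lambda>z. (cmod (f z - (\<Sum>k<N. ?g k z)))\<^sup>2"] g_sum_L2[of N]
        by (simp add: sq_norm_def in_L2_def)
      moreover have "f (x, y) - (\<Sum>k<N. ?g k (x, y)) = wave (int N) x * T N y x" for x y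
        using kaczmarz_expansion[where f = "\<lambda>x. f (x, y)" and x = x and N = N and M = "\<rho> y"] by (simp add: c_def T_def)
      ultimately show ?thesis by (simp add: F_def sq_norm_def norm_mult)
    qed
    have F_meas: "F N \<in> borel_measurable \<nu>" for N
    proof -
      have [measurable]: "(\<lambda>(y, x). T N y x) \<in> borel_measurable (borel \<Otimes>\<^sub>M borel)" by (rule T_meas)
      \<comment> \<open>\<open>measurable_integral_slice\<close> is about complex integrands, hence
        the detour.\<close>
      have "(\<lambda>y. \<integral>x. complex_of_real ((cmod (T N y x))\<^sup>2) \<partial>\<rho> y) \<in> borel_measurable borel"
        by (rule measurable_integral_slice) measurable
      then have "(\<lambda>y. Re (complex_of_real (F N y))) \<in> borel_measurable borel"
        unfolding F_def sq_norm_def integral_complex_of_real by measurable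
      then show ?thesis by (simp add: \<nu>.borel_measurable_M_eq)
    qed
    have "(\<lambda>N. \<integral>y. F N y \<partial>\<nu>) \<longlonglongrightarrow> (\<integral>y. 0 \<partial>\<nu>)"
    proof (rule integral_dominated_convergence[OF _ F_meas F0])
      show "AE y in \<nu>. (\<lambda>N. F N y) \<longlonglongrightarrow> 0"
        using slice_L2 sing\<rho> unit\<rho> by eventually_elim (simp add: F_def T_def \<rho>.kaczmarz_singular)
      show "AE y in \<nu>. norm (F N y) \<le> F 0 y" for N
        using slice_L2 by eventually_elim (simp add: F_def T_def \<rho>.sq_norm_twist_iter_le)
    qed simp
    then show "(\<lambda>N. sq_norm \<mu> (\<lambda>z. f z - (\<Sum>k<N. ?g k z))) \<longlonglongrightarrow> 0" by (simp add: eq)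
  qed
  define d where "d k = kaczmarz_coeff \<nu> (c k)" for k
  have inner: "L2_sums \<mu> (\<lambda>l (x, y). d k l * (wave (int k) x * wave (int l) y)) (?g k)" for k
    unfolding L2_sums_def L2_norm_tendsto_0_iff
  proof (intro conjI allI g_L2)
    show "in_L2 \<mu> (\<lambda>(x, y). d k l * (wave (int k) x * wave (int l) y))" for l
      using wave_L2[OF snd_L2[OF in_L2_cmult[OF \<nu>.in_L2_wave]], of "d k l" "int l" k]
      by (simp add: split_beta' mult_ac)
    have "sq_norm \<mu> (\<lambda>z. ?g k z - (\<Sum>l<N. case z of (x, y) \<Rightarrow> d k l * (wave (int k) x * wave (int l) y)))
        = sq_norm \<nu> (\<lambda>y. c k y - (\<Sum>l<N. d k l * wave (int l) y))" for N
    proof -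
      let ?r = "\<lambda>y. c k y - (\<Sum>l<N. d k l * wave (int l) y)"
      \<comment> \<open>The first coordinate enters only through a unimodular factor, so the inner
        sum converges over \<open>\<mu>\<close> as it does over the marginal.\<close>
      have "?g k z - (\<Sum>l<N. case z of (x, y) \<Rightarrow> d k l * (wave (int k) x * wave (int l) y))
          = wave (int k) (fst z) * ?r (snd z)" for z
        by (simp add: split_beta' right_diff_distrib sum_distrib_left mult_ac)
      moreover have "(\<lambda>y. (cmod (?r y))\<^sup>2) \<in> borel_measurable borel"
        using c_meas by measurable
      then have "sq_norm \<nu> ?r = (\<integral>z. (cmod (?r (snd z)))\<^sup>2 \<partial>\<mu>)"
        unfolding sq_norm_def y_marginal_def by (rule integral_distr[OF snd_m])
      ultimately show ?thesis by (simp add: sq_norm_def norm_mult)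
    qed
    moreover have "(\<lambda>N. sq_norm \<nu> (\<lambda>y. c k y - (\<Sum>l<N. d k l * wave (int l) y))) \<longlonglongrightarrow> 0"
      unfolding d_def by (rule \<nu>.kaczmarz_sums[OF sing\<nu> unit\<nu> c_L2])
    ultimately show "(\<lambda>N. sq_norm \<mu> (\<lambda>z. ?g k z - (\<Sum>l<N. case z of (x, y) \<Rightarrow> d k l * (wave (int k) x * wave (int l) y)))) \<longlonglongrightarrow> 0"
      by simp
  qed
  show ?thesis
    unfolding L2_double_sums_def by (intro exI[of _ d] exI[of _ ?g] conjI allI inner outer)
qed

text \<open>The condition on the maximal weight only excludes that all rows have equal weights.\<close>

lemma unequal_row_exists:
  assumes "m > 0" and p1: "(\<Sum>i<n. \<Sum>j<m. p i j) = 1"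
    and cond: "equal_rows n m p = 0 \<or> max_row_weight n m p < 1 / real (equal_rows n m p)"
  shows "\<exists>j<m. \<not> (\<forall>i<n. \<forall>i'<n. p i j = p i' j)"
proof (rule ccontr)
  assume "\<not> ?thesis"
  then have "{j. j < m \<and> (\<forall>i<n. \<forall>i'<n. p i j = p i' j)} = {..<m}" by auto
  then have b: "equal_rows n m p = m" by (simp add: equal_rows_def)
  then have "max_row_weight n m p < 1 / real m" using cond \<open>m > 0\<close> by auto
  have "row_weight n p j \<le> max_row_weight n m p" if "j < m" for j
    using that by (simp add: max_row_weight_def)
  then have "(\<Sum>j<m. row_weight n p j) \<le> (\<Sum>j<m. max_row_weight n m p)"
    by (intro sum_mono) simp
  also have "\<dots> < 1"
    using \<open>max_row_weight n m p < 1 / real m\<close> \<open>m > 0\<close> by (simp add: field_simps)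
  finally have "(\<Sum>j<m. row_weight n p j) < 1" .
  moreover have "(\<Sum>j<m. row_weight n p j) = 1"
    unfolding row_weight_def by (subst sum.swap) (rule p1)
  ultimately show False by simp
qed

text \<open>Formulated for \<open>self_affine\<close>, so that it applies verbatim to the image of
  \<open>\<mu>\<close> under the exchange of coordinates.\<close>

theorem y_slice_singular_fourier:
  assumes n: "n \<ge> 2" "m \<ge> 2"
    and p: "\<And>i j. i < n \<Longrightarrow> j < m \<Longrightarrow> p i j > 0" and p1: "(\<Sum>i<n. \<Sum>j<m. p i j) = 1"
    and sa: "self_affine n m p \<mu>" and sing: "lebesgue_singular (y_marginal \<mu>)"
    and cond: "equal_rows n m p = 0 \<or> max_row_weight n m p < 1 / real (equal_rows n m p)"
  shows "y_slice_singular \<mu>"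
    and "in_L2 \<mu> f \<Longrightarrow> \<exists>d. L2_double_sums \<mu>
      (\<lambda>k l (x, y). d k l * exp (2 * of_real pi * \<i> * of_real (real k * x + real l * y))) f"
proof -
  note \<mu> = self_affineD[OF sa]
  have unit: "AE z in \<mu>. 0 \<le> fst z \<and> fst z \<le> 1" using \<mu>(3) by eventually_elim auto
  obtain Q :: "real \<Rightarrow> real \<Rightarrow> real" where Q: "(\<lambda>(y, u). Q y u) \<in> borel_measurable (borel \<Otimes>\<^sub>M borel)"
    "\<And>y u. Q y u \<in> {0..1}" "\<mu> = distr (y_marginal \<mu> \<Otimes>\<^sub>M unit_lebesgue) borel (\<lambda>(y, u). (Q y u, y))"
    by (rule conditional_quantile[OF \<mu>(1,2) unit]) (rule that; assumption)
  interpret disintegrated \<mu> Q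
    by (rule disintegrated.intro[OF \<mu>(1,2) Q])
  have "m > 0" using n by simp
  from unequal_row_exists[OF this p1 cond]
  obtain j0 where j0: "j0 < m" "\<not> (\<forall>i<n. \<forall>i'<n. p i j0 = p i' j0)"
    by blast
  have sing\<rho>: "AE y in y_marginal \<mu>. lebesgue_singular (\<rho> y)"
    by (rule lebesgue_singular_slices[OF sa n _ p1 j0]) (rule p)
  then show "y_slice_singular \<mu>"
    unfolding y_slice_singular_def by (intro conjI exI[of _ \<rho>] sing y_disintegration_\<rho>)
  assume f: "in_L2 \<mu> f"
  have half: "AE z in \<mu>. z \<in> {0..<1} \<times> {0..<1}"
    by (rule self_affine_half_open[OF sa n _ p1]) (rule p)
  have eq: "wave (int k) x * wave (int l) y = exp (2 * of_real pi * \<i> * of_real (real k * x + real l * y))" for k l x y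
    unfolding wave_eq_exp exp_add[symmetric] by (simp only: distrib_left of_real_add)
  show "\<exists>d. L2_double_sums \<mu>
      (\<lambda>k l (x, y). d k l * exp (2 * of_real pi * \<i> * of_real (real k * x + real l * y))) f"
    by (rule double_fourier_expansion[OF half sing sing\<rho> f, unfolded eq])
qed

section \<open>Transfer from rows to columns\<close>

lemma L2_double_sums_distr:
  assumes T: "T \<in> M \<rightarrow>\<^sub>M N" and sums: "L2_double_sums (distr M N T) u f"
  shows "L2_double_sums M (\<lambda>k l z. u k l (T z)) (\<lambda>z. f (T z))"
proof -
  have L2: "in_L2 M (\<lambda>z. h (T z))" if "in_L2 (distr M N T) h" for h
    using that integrable_distr[OF T, of "\<lambda>y. (cmod (h y))\<^sup>2"]
    by (simp add: in_L2_def measurable_compose[OF T])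
  have sums': "L2_sums M (\<lambda>k z. v k (T z)) (\<lambda>z. g (T z))" if "L2_sums (distr M N T) v g" for v g
  proof -
    have v: "in_L2 (distr M N T) (v k)" "in_L2 (distr M N T) g" for k
      using that by (auto simp: L2_sums_def)
    have "L2_norm M (\<lambda>z. g (T z) - (\<Sum>k<K. v k (T z))) = L2_norm (distr M N T) (\<lambda>z. g z - (\<Sum>k<K. v k z))" for K
    proof -
      have [measurable]: "g \<in> borel_measurable N" "v k \<in> borel_measurable N" for k
        using v by (auto simp: in_L2_def)
      have "(\<lambda>z. (cmod (g z - (\<Sum>k<K. v k z)))\<^sup>2) \<in> borel_measurable N" by measurable
      from integral_distr[OF T this] show ?thesis by (simp add: L2_norm_def)
    qed
    then show ?thesis using that L2[OF v(1)] L2[OF v(2)] by (simp add: L2_sums_def)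
  qed
  obtain g where "\<And>k. L2_sums (distr M N T) (u k) (g k)" "L2_sums (distr M N T) g f"
    using sums by (auto simp: L2_double_sums_def)
  then show ?thesis
    unfolding L2_double_sums_def by (intro exI[of _ "\<lambda>k z. g k (T z)"]) (simp add: sums')
qed

lemma y_marginal_swap:
  assumes "sets \<mu> = sets borel"
  shows "y_marginal (distr \<mu> borel prod.swap) = x_marginal \<mu>"
proof -
  have "prod.swap \<in> \<mu> \<rightarrow>\<^sub>M borel"
    using measurable_swap_borel by (simp add: measurable_cong_sets[OF assms refl])
  then show ?thesis
    unfolding y_marginal_def x_marginal_def
    by (subst distr_distr) (auto simp: projections_measurable comp_def)
qed

lemma x_slice_singular_if_swap:
  assumes sets_\<mu>: "sets \<mu> = sets borel" and "y_slice_singular (distr \<mu> borel prod.swap)"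
  shows "x_slice_singular \<mu>"
proof -
  note marg = y_marginal_swap[OF sets_\<mu>]
  have swap: "prod.swap \<in> \<mu> \<rightarrow>\<^sub>M borel"
    using measurable_swap_borel by (simp add: measurable_cong_sets[OF sets_\<mu> refl])
  obtain \<rho> where sing: "lebesgue_singular (x_marginal \<mu>)"
    and dis: "y_disintegration (distr \<mu> borel prod.swap) \<rho>"
    and AE: "AE x in x_marginal \<mu>. lebesgue_singular (\<rho> x)"
    using assms(2) unfolding y_slice_singular_def marg by blast
  have "(\<integral>z. f z \<partial>\<mu>) = (\<integral>x. (\<integral>y. f (x, y) \<partial>\<rho> x) \<partial>x_marginal \<mu>)" if f: "integrable \<mu> f" for f :: "real \<times> real \<Rightarrow> real"
  proof -
    have fm: "f \<in> borel_measurable borel"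
      using borel_measurable_integrable[OF f] by (simp add: measurable_cong_sets[OF sets_\<mu> refl])
    have fs: "(\<lambda>z. f (prod.swap z)) \<in> borel_measurable borel"
      by (rule measurable_compose[OF measurable_swap_borel fm])
    have int: "integrable (distr \<mu> borel prod.swap) (\<lambda>z. f (prod.swap z))"
      using f by (simp add: integrable_distr_eq[OF swap fs])
    have "(\<integral>z. f z \<partial>\<mu>) = (\<integral>z. f (prod.swap z) \<partial>distr \<mu> borel prod.swap)"
      by (simp add: integral_distr[OF swap fs])
    also have "\<dots> = (\<integral>x. (\<integral>y. f (prod.swap (y, x)) \<partial>\<rho> x) \<partial>y_marginal (distr \<mu> borel prod.swap))"
      using dis int unfolding y_disintegration_def by blast
    finally show ?thesis by (simp add: marg)
  qed
  then have "x_disintegration \<mu> \<rho>"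
    using dis unfolding x_disintegration_def y_disintegration_def by blast
  then show ?thesis using sing AE by (auto simp: x_slice_singular_def)
qed

theorem theorem11:
  fixes n m :: nat and p :: "nat \<Rightarrow> nat \<Rightarrow> real" and \<mu> :: "(real \<times> real) measure"
  assumes "n \<ge> 2" and "m \<ge> 2"
    and "\<And>i j. i < n \<Longrightarrow> j < m \<Longrightarrow> p i j > 0"
    and "(\<Sum>i<n. \<Sum>j<m. p i j) = 1"
    and "invariant_measure n m p \<mu>"
  shows
    "(lebesgue_singular (y_marginal \<mu>) \<and>
      (equal_rows n m p = 0 \<or> max_row_weight n m p < 1 / real (equal_rows n m p)) \<longrightarrow>
        y_slice_singular \<mu> \<and>
        (\<forall>f. in_L2 \<mu> f \<longrightarrow>
          (\<exists>d :: nat \<Rightarrow> nat \<Rightarrow> complex.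
            L2_double_sums \<mu>
              (\<lambda>k l (x, y). d k l *
                 exp (2 * of_real pi * \<i> * of_real (real k * x + real l * y))) f)))
     \<and>
     (lebesgue_singular (x_marginal \<mu>) \<and>
      (equal_columns n m p = 0 \<or> max_column_weight n m p < 1 / real (equal_columns n m p)) \<longrightarrow>
        x_slice_singular \<mu> \<and>
        (\<forall>f. in_L2 \<mu> f \<longrightarrow>
          (\<exists>d :: nat \<Rightarrow> nat \<Rightarrow> complex.
            L2_double_sums \<mu>
              (\<lambda>k l (x, y). d k l *
                 exp (2 * of_real pi * \<i> * of_real (real k * y + real l * x))) f)))"
proof -
  have sa: "self_affine n m p \<mu>"
    by (rule invariant_measure_self_affine[OF assms(5) _ assms(4)]) (simp add: assms(3) less_imp_le)
  note sets_\<mu> = self_affineD(2)[OF sa]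
  let ?\<mu>' = "distr \<mu> borel prod.swap" and ?p' = "\<lambda>i j. p j i"
  have swap: "prod.swap \<in> \<mu> \<rightarrow>\<^sub>M borel"
    using measurable_swap_borel by (simp add: measurable_cong_sets[OF sets_\<mu> refl])
  have p1': "(\<Sum>i<m. \<Sum>j<n. p j i) = 1"
    by (subst sum.swap) (rule assms(4))
  note sa' = self_affine_swap[OF sa]
  show ?thesis
  proof (intro conjI impI)
    assume *: "lebesgue_singular (y_marginal \<mu>) \<and>
      (equal_rows n m p = 0 \<or> max_row_weight n m p < 1 / real (equal_rows n m p))"
    note y = y_slice_singular_fourier[OF assms(1-4) sa conjunct1[OF *] conjunct2[OF *]]
    show "y_slice_singular \<mu>" by (rule y(1))
    show "\<forall>f. in_L2 \<mu> f \<longrightarrow> (\<exists>d. L2_double_sums \<mu> (\<lambda>k l (x, y). d k l *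
                 exp (2 * of_real pi * \<i> * of_real (real k * x + real l * y))) f)"
      using y(2) by blast
  next
    assume *: "lebesgue_singular (x_marginal \<mu>) \<and>
      (equal_columns n m p = 0 \<or> max_column_weight n m p < 1 / real (equal_columns n m p))"
    \<comment> \<open>From here on the rows of the transposed weights \<open>?p'\<close> stand for
      the columns of \<open>p\<close>.\<close>
    have sing: "lebesgue_singular (y_marginal ?\<mu>')" using * by (simp add: y_marginal_swap[OF sets_\<mu>])
    have cond: "equal_rows m n ?p' = 0 \<or> max_row_weight m n ?p' < 1 / real (equal_rows m n ?p')"
      using * by (simp add: equal_rows_def equal_columns_def max_row_weight_def max_column_weight_def
          row_weight_def column_weight_def)
    note y = y_slice_singular_fourier[OF assms(2,1) _ p1' sa' sing cond]
    show "x_slice_singular \<mu>"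
      by (rule x_slice_singular_if_swap[OF sets_\<mu> y(1)]) (simp add: assms(3))
    show "\<forall>f. in_L2 \<mu> f \<longrightarrow> (\<exists>d. L2_double_sums \<mu> (\<lambda>k l (x, y). d k l *
                 exp (2 * of_real pi * \<i> * of_real (real k * y + real l * x))) f)"
    proof (intro allI impI)
      fix f assume f: "in_L2 \<mu> f"
      have fm: "f \<in> borel_measurable borel"
        using f by (simp add: in_L2_def measurable_cong_sets[OF sets_\<mu> refl])
      have fs: "(\<lambda>z. f (prod.swap z)) \<in> borel_measurable borel"
        by (rule measurable_compose[OF measurable_swap_borel fm])
      have "in_L2 ?\<mu>' (\<lambda>z. f (prod.swap z))"
        using f fs integrable_distr_eq[OF swap, of "\<lambda>z. (cmod (f (prod.swap z)))\<^sup>2"]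
        by (simp add: in_L2_def)
      then obtain d where "L2_double_sums ?\<mu>' (\<lambda>k l (x, y). d k l *
          exp (2 * of_real pi * \<i> * of_real (real k * x + real l * y))) (\<lambda>z. f (prod.swap z))"
        using y(2) assms(3) by blast
      from L2_double_sums_distr[OF swap this]
      have "L2_double_sums \<mu> (\<lambda>k l (x, y). d k l *
          exp (2 * of_real pi * \<i> * of_real (real k * y + real l * x))) f"
        by (simp add: split_beta')
      then show "\<exists>d. L2_double_sums \<mu> (\<lambda>k l (x, y). d k l *
          exp (2 * of_real pi * \<i> * of_real (real k * y + real l * x))) f" by blast
    qed
  qed
qed

end
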